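(* Let $\phi,\psi$ be meromorphic functions on $\mathbb P$. Then 1. if $D\subset\mathbb P$ is a disc and $\phi,\psi$ are regular along $\partial D$, then ${}_D\Phi\circ{}_D\Psi-{}_D\Psi\circ{}_D\Phi=-\frac{1}{2\pi i}\int_{\partial D}\phi\,d\psi$; 2. for $P\in\mathbb P$, $\Phi_P\circ\Psi_P-\Psi_P\circ\Phi_P=\mathrm{Res}_P(\phi\,d\psi)$; 3. for $O\in\mathbb P$, ${}_O\Phi\circ{}_O\Psi-{}_O\Psi\circ{}_O\Phi=-\mathrm{Res}_O(\phi\,d\psi)$. (The right sides act as scalars.)
   Context: $\mathbb P$ is a complex projective line. $\mathbf K$ is the space of meromorphic 1-forms on $\mathbb P$ with all residues zero, $\mathbf W=S^*\mathbf K$ its symmetric algebra (product $\otimes^s$). A disc $D\subset\mathbb P$ is an open simply connected domain, biholomorphic to a disc, with smooth boundary $\partial D$ oriented counterclockwise around $D$; $D'$ is the complement of its closure. $\mathbf W_{\partial D}$ is the symmetric algebra over the space of forms in $\mathbf K$ regular along $\partial D$. The following operators depend linearly on the function $\phi$; every meromorphic function (in the first case: regular along $\partial D$) is a sum of functions of the two listed types, unique up to constants, and constants act by zero. (a) For $\phi$ regular along $\partial D$, ${}_D\Phi:\mathbf W_{\partial D}\to\mathbf W_{\partial D}$ is $${}_D\Phi[\alpha_1\otimes^s\cdots\otimes^s\alpha_p]=-\sum_i(\alpha_1\otimes^s\cdots\widehat{\alpha_i}\cdots\otimes^s\alpha_p)\,\frac1{2\pi i}\int_{\partial D}\phi\alpha_i+\delta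 ,$$ with $\delta=d\phi\otimes^s\alpha_1\otimes^s\cdots\otimes^s\alpha_p$ if $\phi$ is regular in $D'$, and $\delta=0$ if $\phi$ is regular in $D$. (b) For $\phi$ meromorphic, $\Phi_P:\mathbf W\to\mathbf W$ is $$\Phi_P[\alpha_1\otimes^s\cdots\otimes^s\alpha_p]=\sum_i(\alpha_1\otimes^s\cdots\widehat{\alpha_i}\cdots\otimes^s\alpha_p)\,\mathrm{Res}_P(\phi\alpha_i)+\delta ,$$ with $\delta=d\phi\otimes^s\alpha_1\otimes^s\cdots\otimes^s\alpha_p$ if $\phi$ is regular at $P$, and $\delta=0$ if $\phi$ is regular away from $P$. (c) For $\phi$ meromorphic, ${}_O\Phi:\mathbf W\to\mathbf W$ is $${}_O\Phi[\alpha_1\otimes^s\cdots\otimes^s\alpha_p]=-\sum_i(\alpha_1\otimes^s\cdots\widehat{\alpha_i}\cdots\otimes^s\alpha_p)\,\mathrm{Res}_O(\phi\alpha_i)+\delta ,$$ with $\delta=d\phi\otimes^s\alpha_1\otimes^s\cdots\otimes^s\alpha_p$ if $\phi$ is regular away from $O$, and $\delta=0$ if $\phi$ is regular at $O$. A hat marks an omitted factor. $\Psi$ denotes the analogous operators built from $\psi$. *)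

theory Defs
  imports
    "HOL-Complex_Analysis.Complex_Analysis"
    "HOL-Algebra.QuotRing"
    "HOL-Library.Poly_Mapping"
begin

section \<open>The complex projective line\<close>

text \<open>
  \<open>Some z\<close> is the point with affine coordinate \<open>z\<close>, and \<open>None\<close> is the point at infinity.
  Around every point \<open>p\<close> we use the coordinate \<open>h\<close> centred at \<open>p\<close>: \<open>h = z - a\<close> for \<open>p = Some a\<close>,
  and \<open>h = 1 / z\<close> for \<open>p = None\<close>. All local notions are independent of this choice.
\<close>

type_synonym proj_line = "complex option"

fun from_coord :: "proj_line \<Rightarrow> complex \<Rightarrow> proj_line" where
  "from_coord (Some a) h = Some (a + h)"
| "from_coord None h = (if h = 0 then None else Some (inverse h))"

text \<open>
  Only meaningful for \<open>q\<close> near \<open>p\<close>; the single point outside the domain of the chart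
  is sent to the junk value 0.
\<close>

fun to_coord :: "proj_line \<Rightarrow> proj_line \<Rightarrow> complex" where
  "to_coord (Some a) q = (case q of Some z \<Rightarrow> z - a | None \<Rightarrow> 0)"
| "to_coord None q = (case q of Some z \<Rightarrow> inverse z | None \<Rightarrow> 0)"

definition proj_top :: "proj_line topology" where
  "proj_top = topology (\<lambda>U. \<forall>p. open {h. from_coord p h \<in> U})"

lemma openin_proj_top: "openin proj_top U \<longleftrightarrow> (\<forall>p. open {h. from_coord p h \<in> U})"
proof -
  have "istopology (\<lambda>U. \<forall>p. open {h. from_coord p h \<in> U})"
    unfolding istopology_def
  proof (intro conjI allI impI)
    fix S T p
    assume "\<forall>p. open {h. from_coord p h \<in> S}" "\<forall>p. open {h. from_coord p h \<in> T}"
    then show "open {h. from_coord p h \<in> S \<inter> T}"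
      using open_Int[of "{h. from_coord p h \<in> S}" "{h. from_coord p h \<in> T}"]
      by (simp add: Int_def)
  next
    fix \<K> p
    assume "\<forall>K\<in>\<K>. \<forall>p. open {h. from_coord p h \<in> K}"
    then have "open (\<Union>K\<in>\<K>. {h. from_coord p h \<in> K})" by blast
    moreover have "(\<Union>K\<in>\<K>. {h. from_coord p h \<in> K}) = {h. from_coord p h \<in> \<Union>\<K>}" by blast
    ultimately show "open {h. from_coord p h \<in> \<Union>\<K>}" by simp
  qed
  then show ?thesis
    by (simp add: proj_top_def topology_inverse')
qed

lemma topspace_proj_top [simp]: "topspace proj_top = UNIV"
proof -
  have "openin proj_top UNIV" by (simp add: openin_proj_top)
  then show ?thesis using openin_subset by blast
qed


section \<open>Meromorphic functions and meromorphic 1-forms\<close>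

text \<open>
  A meromorphic function on the projective line is represented by its expression in the affine
  coordinate \<open>z\<close>, normalised as usual in the library: removable singularities are removed and the
  value at a pole is 0. The second condition is meromorphy at infinity.
\<close>

definition merom_fun_set :: "(complex \<Rightarrow> complex) set" where
  "merom_fun_set = {f. f nicely_meromorphic_on UNIV \<and> (\<lambda>h. f (inverse h)) meromorphic_on {0}}"

text \<open>
  A meromorphic 1-form is represented by its coefficient \<open>f\<close> in \<open>f dz\<close>.
  With \<open>z = 1 / h\<close> this form is \<open>- f (1 / h) / h\<^sup>2 dh\<close> near infinity.
\<close>

definition merom_form_set :: "(complex \<Rightarrow> complex) set" where
  "merom_form_set =
     {f. f nicely_meromorphic_on UNIV \<and> (\<lambda>h. - f (inverse h) / h ^ 2) meromorphic_on {0}}"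

lemma meromorphic_at_cong:
  assumes "f meromorphic_on {z}" "eventually (\<lambda>w. f w = g w) (at z)"
  shows "g meromorphic_on {z}"
  using meromorphic_on_cong[of "{z}" f g "{z}"] assms by blast

lemma merom_form_set_eq: "merom_form_set = merom_fun_set"
proof -
  have "(\<lambda>h. - f (inverse h) / h ^ 2) meromorphic_on {0} \<longleftrightarrow> (\<lambda>h. f (inverse h)) meromorphic_on {0}"
    for f :: "complex \<Rightarrow> complex"
  proof
    assume f: "(\<lambda>h. - f (inverse h) / h ^ 2) meromorphic_on {0}"
    have "(\<lambda>h. - (h ^ 2) * (- f (inverse h) / h ^ 2)) meromorphic_on {0}"
      by (intro meromorphic_on_mult meromorphic_on_uminus meromorphic_on_power meromorphic_on_id f)
    moreover have "eventually (\<lambda>h::complex. - (h ^ 2) * (- f (inverse h) / h ^ 2) = f (inverse h)) (at 0)"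
      by (auto simp: eventually_at_filter)
    ultimately show "(\<lambda>h. f (inverse h)) meromorphic_on {0}"
      by (rule meromorphic_at_cong)
  next
    assume f: "(\<lambda>h. f (inverse h)) meromorphic_on {0}"
    show "(\<lambda>h. - f (inverse h) / h ^ 2) meromorphic_on {0}"
      by (intro meromorphic_on_divide meromorphic_on_uminus meromorphic_on_power meromorphic_on_id f)
  qed
  then show ?thesis
    by (simp add: merom_form_set_def merom_fun_set_def)
qed

lemma eventually_analytic_at_infinity:
  assumes "f meromorphic_on UNIV" "(\<lambda>h. f (inverse h)) meromorphic_on {0}"
  shows "eventually (\<lambda>h. f analytic_on {inverse h}) (at 0)"
proof -
  have "eventually (\<lambda>h. (\<lambda>h. f (inverse h)) analytic_on {h}) (at 0)"
    using meromorphic_on_isolated_singularity[OF assms(2)]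
    by (simp add: isolated_singularity_at_altdef)
  moreover have "eventually (\<lambda>h::complex. h \<noteq> 0) (at 0)"
    by (simp add: eventually_at_filter)
  ultimately show ?thesis
  proof eventually_elim
    case (elim h)
    have "((\<lambda>h. f (inverse h)) \<circ> inverse) analytic_on {inverse h}"
      by (intro analytic_on_compose_gen[where T = "{h}"] analytic_intros) (use elim in auto)
    then show ?case by (simp add: o_def)
  qed
qed

lemma remove_sings_in_merom_fun_set:
  assumes "f meromorphic_on UNIV" "(\<lambda>h. f (inverse h)) meromorphic_on {0}"
  shows "remove_sings f \<in> merom_fun_set"
proof -
  have "eventually (\<lambda>h. f (inverse h) = remove_sings f (inverse h)) (at 0)"
    using eventually_analytic_at_infinity[OF assms] by eventually_elim simp
  with assms(2) have "(\<lambda>h. remove_sings f (inverse h)) meromorphic_on {0}"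
    by (rule meromorphic_at_cong)
  then show ?thesis
    by (simp add: merom_fun_set_def remove_sings_nicely_meromorphic[OF assms(1)])
qed

lemma merom_fun_setD:
  assumes "f \<in> merom_fun_set"
  shows "f nicely_meromorphic_on UNIV" "f meromorphic_on UNIV"
    "(\<lambda>h. f (inverse h)) meromorphic_on {0}"
  using assms by (auto simp: merom_fun_set_def nicely_meromorphic_on_def)


lemma remove_sings_merom_fun:
  assumes "f \<in> merom_fun_set"
  shows "remove_sings f = f"
proof
  fix z
  have "is_pole f z \<and> f z = 0 \<or> f \<midarrow>z\<rightarrow> f z"
    using assms by (auto simp: merom_fun_set_def nicely_meromorphic_on_def)
  then show "remove_sings f z = f z" by auto
qed

lemma eventually_remove_sings_at:
  "f meromorphic_on UNIV \<Longrightarrow> eventually (\<lambda>w. remove_sings f w = f w) (at z)"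
  by (rule eventually_cosparse_imp_eventually_at[OF eventually_remove_sings_eq]) auto

lemma remove_sings_eqI_at:
  assumes "\<And>z. eventually (\<lambda>w. f w = g w) (at z)"
  shows "remove_sings f = remove_sings g"
  using assms by (intro ext remove_sings_cong) auto

lemma remove_sings_add_assoc:
  assumes "f \<in> merom_fun_set" "g \<in> merom_fun_set" "k \<in> merom_fun_set"
  shows "remove_sings (\<lambda>z. remove_sings (\<lambda>z. f z + g z) z + k z) =
         remove_sings (\<lambda>z. f z + remove_sings (\<lambda>z. g z + k z) z)"
proof (rule remove_sings_eqI_at)
  fix z
  have "(\<lambda>z. f z + g z) meromorphic_on UNIV" "(\<lambda>z. g z + k z) meromorphic_on UNIV"
    by (intro meromorphic_on_add meromorphic_on_uminus merom_fun_setD(2) assms)+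
  from this[THEN eventually_remove_sings_at, of z]
  show "eventually (\<lambda>w. remove_sings (\<lambda>z. f z + g z) w + k w
                      = f w + remove_sings (\<lambda>z. g z + k z) w) (at z)"
    by eventually_elim (simp add: add.assoc)
qed

lemma remove_sings_minus_eq:
  assumes "f \<in> merom_fun_set" "g \<in> merom_fun_set"
  shows "remove_sings (\<lambda>z. f z - g z) = remove_sings (\<lambda>z. f z + remove_sings (\<lambda>z. - g z) z)"
proof (rule remove_sings_eqI_at)
  fix z
  have "(\<lambda>z. - g z) meromorphic_on UNIV"
    by (intro meromorphic_on_add meromorphic_on_uminus merom_fun_setD(2) assms)+
  from this[THEN eventually_remove_sings_at, of z]
  show "eventually (\<lambda>w. f w - g w = f w + remove_sings (\<lambda>z. - g z) w) (at z)"
    by eventually_elim simp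
qed

lemma remove_sings_left_minus:
  assumes "f \<in> merom_fun_set"
  shows "remove_sings (\<lambda>z. remove_sings (\<lambda>z. - f z) z + f z) = (\<lambda>_. 0)"
proof -
  have "remove_sings (\<lambda>z. remove_sings (\<lambda>z. - f z) z + f z) = remove_sings (\<lambda>_. 0)"
  proof (rule remove_sings_eqI_at)
    fix z
    have "(\<lambda>z. - f z) meromorphic_on UNIV"
      by (intro meromorphic_on_add meromorphic_on_uminus merom_fun_setD(2) assms)+
    from this[THEN eventually_remove_sings_at, of z]
    show "eventually (\<lambda>w. remove_sings (\<lambda>z. - f z) w + f w = 0) (at z)"
      by eventually_elim simp
  qed
  then show ?thesis by (auto simp: fun_eq_iff)
qed

lemma merom_fun_set_ops:
  shows "(\<lambda>_. c) \<in> merom_fun_set"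
    and "f \<in> merom_fun_set \<Longrightarrow> g \<in> merom_fun_set \<Longrightarrow> remove_sings (\<lambda>z. f z + g z) \<in> merom_fun_set"
    and "f \<in> merom_fun_set \<Longrightarrow> g \<in> merom_fun_set \<Longrightarrow> remove_sings (\<lambda>z. f z - g z) \<in> merom_fun_set"
    and "f \<in> merom_fun_set \<Longrightarrow> g \<in> merom_fun_set \<Longrightarrow> remove_sings (\<lambda>z. f z * g z) \<in> merom_fun_set"
    and "f \<in> merom_fun_set \<Longrightarrow> remove_sings (\<lambda>z. - f z) \<in> merom_fun_set"
    and "f \<in> merom_fun_set \<Longrightarrow> remove_sings (\<lambda>z. c * f z) \<in> merom_fun_set"
proof -
  show "(\<lambda>_. c) \<in> merom_fun_set"
    by (simp add: merom_fun_set_def nicely_meromorphic_on_const meromorphic_on_const)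
qed (rule remove_sings_in_merom_fun_set; intro meromorphic_intros merom_fun_setD; assumption)+

lemma deriv_in_merom_fun_set:
  assumes "f \<in> merom_fun_set"
  shows "remove_sings (deriv f) \<in> merom_fun_set"
proof (rule remove_sings_in_merom_fun_set)
  note f = merom_fun_setD[OF assms]
  show "deriv f meromorphic_on UNIV"
    using f(2) by (intro meromorphic_intros)
  have "(\<lambda>h. - (h ^ 2) * deriv (\<lambda>h. f (inverse h)) h) meromorphic_on {0}"
    by (intro meromorphic_on_mult meromorphic_on_uminus meromorphic_on_power meromorphic_on_id
        meromorphic_on_deriv f(3))
  moreover have "eventually (\<lambda>h. - (h ^ 2) * deriv (\<lambda>h. f (inverse h)) h = deriv f (inverse h)) (at 0)"
  proof -
    have "eventually (\<lambda>h::complex. h \<noteq> 0) (at 0)"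
      by (simp add: eventually_at_filter)
    with eventually_analytic_at_infinity[OF f(2,3)] show ?thesis
    proof eventually_elim
      case (elim h)
      have "(f has_field_derivative deriv f (inverse h)) (at (inverse h))"
        using elim(1) by (simp add: analytic_on_imp_differentiable_at DERIV_deriv_iff_field_differentiable)
      from DERIV_chain2[OF this DERIV_inverse[OF elim(2)]]
      have "deriv (\<lambda>h. f (inverse h)) h = deriv f (inverse h) * - (inverse h ^ 2)"
        by (simp add: DERIV_imp_deriv numeral_2_eq_2)
      then show ?case using elim(2) by (simp add: field_simps)
    qed
  qed
  ultimately show "(\<lambda>h. deriv f (inverse h)) meromorphic_on {0}"
    by (rule meromorphic_at_cong)
qed

typedef merom_fun = merom_fun_set
  using merom_fun_set_ops(1) by blast

typedef merom_form = merom_form_set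
  using merom_fun_set_ops(1) by (auto simp: merom_form_set_eq)

setup_lifting type_definition_merom_fun
setup_lifting type_definition_merom_form

instantiation merom_fun :: ab_group_add
begin
lift_definition zero_merom_fun :: merom_fun is "\<lambda>_. 0"
  by (rule merom_fun_set_ops)
lift_definition plus_merom_fun :: "merom_fun \<Rightarrow> merom_fun \<Rightarrow> merom_fun"
  is "\<lambda>f g. remove_sings (\<lambda>z. f z + g z)" by (rule merom_fun_set_ops)
lift_definition minus_merom_fun :: "merom_fun \<Rightarrow> merom_fun \<Rightarrow> merom_fun"
  is "\<lambda>f g. remove_sings (\<lambda>z. f z - g z)" by (rule merom_fun_set_ops)
lift_definition uminus_merom_fun :: "merom_fun \<Rightarrow> merom_fun"
  is "\<lambda>f. remove_sings (\<lambda>z. - f z)" by (rule merom_fun_set_ops)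
instance
proof
  fix a b c :: merom_fun
  show "a + b + c = a + (b + c)"
    by transfer (rule remove_sings_add_assoc)
  show "a + b = b + a"
    by transfer (simp add: add.commute)
  show "0 + a = a"
    by transfer (simp add: remove_sings_merom_fun)
  show "- a + a = 0"
    by transfer (simp add: remove_sings_left_minus)
  show "a - b = a + - b"
    by transfer (rule remove_sings_minus_eq)
qed
end

instantiation merom_form :: ab_group_add
begin
lift_definition zero_merom_form :: merom_form is "\<lambda>_. 0"
  unfolding merom_form_set_eq by (rule merom_fun_set_ops)
lift_definition plus_merom_form :: "merom_form \<Rightarrow> merom_form \<Rightarrow> merom_form"
  is "\<lambda>f g. remove_sings (\<lambda>z. f z + g z)" unfolding merom_form_set_eq by (rule merom_fun_set_ops)
lift_definition minus_merom_form :: "merom_form \<Rightarrow> merom_form \<Rightarrow> merom_form"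
  is "\<lambda>f g. remove_sings (\<lambda>z. f z - g z)" unfolding merom_form_set_eq by (rule merom_fun_set_ops)
lift_definition uminus_merom_form :: "merom_form \<Rightarrow> merom_form"
  is "\<lambda>f. remove_sings (\<lambda>z. - f z)" unfolding merom_form_set_eq by (rule merom_fun_set_ops)
instance
proof
  fix a b c :: merom_form
  show "a + b + c = a + (b + c)"
    by transfer (unfold merom_form_set_eq, rule remove_sings_add_assoc)
  show "a + b = b + a"
    by transfer (simp add: add.commute)
  show "0 + a = a"
    by transfer (simp add: remove_sings_merom_fun merom_form_set_eq)
  show "- a + a = 0"
    by transfer (simp add: remove_sings_left_minus merom_form_set_eq)
  show "a - b = a + - b"
    by transfer (unfold merom_form_set_eq, rule remove_sings_minus_eq)
qed
end

lift_definition scale_form :: "complex \<Rightarrow> merom_form \<Rightarrow> merom_form"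
  is "\<lambda>c f. remove_sings (\<lambda>z. c * f z)" unfolding merom_form_set_eq by (rule merom_fun_set_ops)

lift_definition mult_form :: "merom_fun \<Rightarrow> merom_form \<Rightarrow> merom_form"
  is "\<lambda>f g. remove_sings (\<lambda>z. f z * g z)" unfolding merom_form_set_eq by (rule merom_fun_set_ops)

lift_definition ext_d :: "merom_fun \<Rightarrow> merom_form"
  is "\<lambda>f. remove_sings (deriv f)" unfolding merom_form_set_eq by (rule deriv_in_merom_fun_set)

text \<open>Expressions in the coordinate \<open>h\<close> at \<open>p\<close>; a form is given by its coefficient of \<open>dh\<close>.\<close>

fun fun_germ :: "merom_fun \<Rightarrow> proj_line \<Rightarrow> complex \<Rightarrow> complex" where
  "fun_germ \<phi> (Some a) h = Rep_merom_fun \<phi> (a + h)"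
| "fun_germ \<phi> None h = Rep_merom_fun \<phi> (inverse h)"

fun form_germ :: "merom_form \<Rightarrow> proj_line \<Rightarrow> complex \<Rightarrow> complex" where
  "form_germ \<alpha> (Some a) h = Rep_merom_form \<alpha> (a + h)"
| "form_germ \<alpha> None h = - Rep_merom_form \<alpha> (inverse h) / h ^ 2"

definition fun_regular_on :: "merom_fun \<Rightarrow> proj_line set \<Rightarrow> bool" where
  "fun_regular_on \<phi> S \<longleftrightarrow> (\<forall>p\<in>S. \<not> is_pole (fun_germ \<phi> p) 0)"

definition form_regular_on :: "merom_form \<Rightarrow> proj_line set \<Rightarrow> bool" where
  "form_regular_on \<alpha> S \<longleftrightarrow> (\<forall>p\<in>S. \<not> is_pole (form_germ \<alpha> p) 0)"

definition Res :: "proj_line \<Rightarrow> merom_form \<Rightarrow> complex" where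
  "Res p \<alpha> = residue (form_germ \<alpha> p) 0"

definition K_forms :: "merom_form set" where
  "K_forms = {\<alpha>. \<forall>p. Res p \<alpha> = 0}"


section \<open>Discs and integration along their boundary\<close>

definition simply_connectedin :: "'a topology \<Rightarrow> 'a set \<Rightarrow> bool" where
  "simply_connectedin X S \<longleftrightarrow> path_connectedin X S \<and>
     (\<forall>f. continuous_map (top_of_set (sphere (0::complex) 1)) (subtopology X S) f \<longrightarrow>
       (\<exists>c. homotopic_with (\<lambda>_. True) (top_of_set (sphere (0::complex) 1)) (subtopology X S)
               f (\<lambda>_. c)))"

definition biholomorphic_to_disc :: "proj_line set \<Rightarrow> bool" where
  "biholomorphic_to_disc D \<longleftrightarrow>
     (\<exists>u v. homeomorphic_maps (top_of_set (ball 0 1)) (subtopology proj_top D) u v \<and>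
       (\<forall>z\<in>ball 0 1. (\<lambda>w. to_coord (u z) (u w)) analytic_on {z}) \<and>
       (\<forall>p\<in>D. (\<lambda>h. v (from_coord p h)) analytic_on {0}))"

definition smooth_at :: "(real \<Rightarrow> complex) \<Rightarrow> real \<Rightarrow> bool" where
  "smooth_at f t \<longleftrightarrow>
     (\<exists>\<epsilon>>0. \<exists>g :: nat \<Rightarrow> real \<Rightarrow> complex. \<forall>s\<in>ball t \<epsilon>.
        g 0 s = f s \<and> (\<forall>n. (g n has_vector_derivative g (Suc n) s) (at s)))"

definition velocity :: "(real \<Rightarrow> proj_line) \<Rightarrow> real \<Rightarrow> complex" where
  "velocity \<gamma> t = vector_derivative (\<lambda>s. to_coord (\<gamma> t) (\<gamma> s)) (at t)"

definition smooth_simple_closed :: "(real \<Rightarrow> proj_line) \<Rightarrow> bool" where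
  "smooth_simple_closed \<gamma> \<longleftrightarrow>
     continuous_map euclideanreal proj_top \<gamma> \<and>
     (\<forall>t. \<gamma> (t + 1) = \<gamma> t) \<and> inj_on \<gamma> {0..<1} \<and>
     (\<forall>t. smooth_at (\<lambda>s. to_coord (\<gamma> t) (\<gamma> s)) t \<and> velocity \<gamma> t \<noteq> 0)"

text \<open>
  \<open>\<gamma>\<close> parametrises the boundary of \<open>D\<close> counterclockwise around \<open>D\<close>: at every boundary point
  the left normal \<open>\<i> * velocity \<gamma> t\<close> points into \<open>D\<close>. This local description also makes sense
  when \<open>D\<close> or its boundary contains the point at infinity.
\<close>

definition oriented_boundary :: "proj_line set \<Rightarrow> (real \<Rightarrow> proj_line) \<Rightarrow> bool" where
  "oriented_boundary D \<gamma> \<longleftrightarrow>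
     smooth_simple_closed \<gamma> \<and> \<gamma> ` UNIV = proj_top frontier_of D \<and>
     (\<forall>t. \<forall>\<^sub>F s in at_right 0. from_coord (\<gamma> t) (of_real s * (\<i> * velocity \<gamma> t)) \<in> D)"

definition is_disc :: "proj_line set \<Rightarrow> bool" where
  "is_disc D \<longleftrightarrow> openin proj_top D \<and> D \<noteq> {} \<and> connectedin proj_top D \<and>
     simply_connectedin proj_top D \<and> biholomorphic_to_disc D \<and> (\<exists>\<gamma>. oriented_boundary D \<gamma>)"

text \<open>
  The integral of a form along \<open>\<gamma>\<close>, i.e. of its pullback to \<open>[0, 1]\<close>. The coefficient
  at \<open>\<gamma> t\<close> is the value at \<open>h = 0\<close> of the expression in the coordinate \<open>h\<close> at \<open>\<gamma> t\<close>; the library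
  function \<^const>\<open>remove_sings\<close> supplies this value at infinity.
\<close>

definition curve_integral :: "(real \<Rightarrow> proj_line) \<Rightarrow> merom_form \<Rightarrow> complex" where
  "curve_integral \<gamma> \<alpha> =
     integral {0..1} (\<lambda>t. remove_sings (form_germ \<alpha> (\<gamma> t)) 0 * velocity \<gamma> t)"


section \<open>The symmetric algebra of a space of forms\<close>

text \<open>
  For a subspace \<open>V\<close> of the space of meromorphic forms, the symmetric algebra of \<open>V\<close> is the quotient
  of the polynomial algebra with one indeterminate for each element of \<open>V\<close> (monomials are finite
  multisets in \<open>V\<close>) by the ideal which makes the inclusion of \<open>V\<close> linear.
\<close>

type_synonym form_poly = "merom_form multiset \<Rightarrow>\<^sub>0 complex"

definition poly_alg :: "merom_form set \<Rightarrow> form_poly ring" where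
  "poly_alg V = \<lparr>carrier = {x. \<forall>M\<in>Poly_Mapping.keys x. set_mset M \<subseteq> V},
                 mult = (*), one = 1, zero = 0, add = (+)\<rparr>"

definition const_poly :: "complex \<Rightarrow> form_poly" where
  "const_poly c = Poly_Mapping.single {#} c"

definition var_poly :: "merom_form \<Rightarrow> form_poly" where
  "var_poly \<alpha> = Poly_Mapping.single {#\<alpha>#} 1"

definition sym_ideal :: "merom_form set \<Rightarrow> form_poly set" where
  "sym_ideal V = Idl\<^bsub>poly_alg V\<^esub>
     ({var_poly (\<alpha> + \<beta>) - var_poly \<alpha> - var_poly \<beta> | \<alpha> \<beta>. \<alpha> \<in> V \<and> \<beta> \<in> V} \<union>
      {var_poly (scale_form c \<alpha>) - const_poly c * var_poly \<alpha> | c \<alpha>. \<alpha> \<in> V})"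

definition Sym :: "merom_form set \<Rightarrow> form_poly set ring" where
  "Sym V = poly_alg V Quot sym_ideal V"

definition sym_incl :: "merom_form set \<Rightarrow> merom_form \<Rightarrow> form_poly set" where
  "sym_incl V \<alpha> = sym_ideal V +>\<^bsub>poly_alg V\<^esub> var_poly \<alpha>"

definition sym_scale :: "merom_form set \<Rightarrow> complex \<Rightarrow> form_poly set \<Rightarrow> form_poly set" where
  "sym_scale V c w = (sym_ideal V +>\<^bsub>poly_alg V\<^esub> const_poly c) \<otimes>\<^bsub>Sym V\<^esub> w"

definition sym_prod :: "merom_form set \<Rightarrow> merom_form list \<Rightarrow> form_poly set" where
  "sym_prod V \<alpha>s = foldr (\<lambda>\<alpha> w. sym_incl V \<alpha> \<otimes>\<^bsub>Sym V\<^esub> w) \<alpha>s \<one>\<^bsub>Sym V\<^esub>"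

definition omit :: "nat \<Rightarrow> 'a list \<Rightarrow> 'a list" where
  "omit i xs = take i xs @ drop (Suc i) xs"

definition sym_linear :: "merom_form set \<Rightarrow> (form_poly set \<Rightarrow> form_poly set) \<Rightarrow> bool" where
  "sym_linear V T \<longleftrightarrow>
     (\<forall>x\<in>carrier (Sym V). \<forall>y\<in>carrier (Sym V). T (x \<oplus>\<^bsub>Sym V\<^esub> y) = T x \<oplus>\<^bsub>Sym V\<^esub> T y) \<and>
     (\<forall>c. \<forall>x\<in>carrier (Sym V). T (sym_scale V c x) = sym_scale V c (T x))"


section \<open>The operators\<close>

text \<open>
  The linear operator on the symmetric algebra of \<open>V\<close> with
  \<open>\<alpha>\<^sub>1 \<cdots> \<alpha>\<^sub>p \<mapsto> (\<Sum>i. f \<alpha>\<^sub>i (\<alpha>\<^sub>1 \<cdots> omit \<alpha>\<^sub>i \<cdots> \<alpha>\<^sub>p)) + \<beta> \<alpha>\<^sub>1 \<cdots> \<alpha>\<^sub>p\<close>, for a linear functional \<open>f\<close> on \<open>V\<close>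
  and \<open>\<beta> \<in> V\<close>. The last term is the term \<open>\<delta>\<close>, with \<open>\<beta> = d\<phi>\<close> or \<open>\<beta> = 0\<close>.
\<close>

definition basic_op :: "merom_form set \<Rightarrow> (merom_form \<Rightarrow> complex) \<Rightarrow> merom_form \<Rightarrow>
    form_poly set \<Rightarrow> form_poly set" where
  "basic_op V f \<beta> = (THE T. T \<in> carrier (Sym V) \<rightarrow>\<^sub>E carrier (Sym V) \<and> sym_linear V T \<and>
     (\<forall>\<alpha>s\<in>lists V. T (sym_prod V \<alpha>s) =
        (\<Oplus>\<^bsub>Sym V\<^esub>i\<in>{..<length \<alpha>s}. sym_scale V (f (\<alpha>s ! i)) (sym_prod V (omit i \<alpha>s)))
        \<oplus>\<^bsub>Sym V\<^esub> sym_prod V (\<beta> # \<alpha>s)))"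

text \<open>
  \<open>F \<phi>\<close> is the functional attached to \<open>\<phi>\<close>. The operator is given by \<open>\<beta> = d\<phi>\<close> if \<open>\<phi>\<close> is regular
  on \<open>A\<close>, by \<open>\<beta> = 0\<close> if \<open>\<phi>\<close> is regular on \<open>B\<close>, and by linearity in \<open>\<phi>\<close> in general. The choice
  of the decomposition \<open>\<phi> = \<phi>\<^sub>1 + \<phi>\<^sub>2\<close> is immaterial, being unique up to constants.
\<close>

definition split_op :: "merom_form set \<Rightarrow> (merom_fun \<Rightarrow> merom_form \<Rightarrow> complex) \<Rightarrow>
    proj_line set \<Rightarrow> proj_line set \<Rightarrow> merom_fun \<Rightarrow> form_poly set \<Rightarrow> form_poly set" where
  "split_op V F A B \<phi> w =
     (let (\<phi>\<^sub>1, \<phi>\<^sub>2) = (SOME (\<phi>\<^sub>1, \<phi>\<^sub>2). \<phi> = \<phi>\<^sub>1 + \<phi>\<^sub>2 \<and> fun_regular_on \<phi>\<^sub>1 A \<and> fun_regular_on \<phi>\<^sub>2 B)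
      in basic_op V (F \<phi>\<^sub>1) (ext_d \<phi>\<^sub>1) w \<oplus>\<^bsub>Sym V\<^esub> basic_op V (F \<phi>\<^sub>2) 0 w)"

abbreviation boundary :: "proj_line set \<Rightarrow> proj_line set" where
  "boundary D \<equiv> proj_top frontier_of D"

definition K_along :: "proj_line set \<Rightarrow> merom_form set" where
  "K_along D = {\<alpha> \<in> K_forms. form_regular_on \<alpha> (boundary D)}"

abbreviation W :: "form_poly set ring" where
  "W \<equiv> Sym K_forms"

abbreviation W_along :: "proj_line set \<Rightarrow> form_poly set ring" where
  "W_along D \<equiv> Sym (K_along D)"

definition op_disc :: "proj_line set \<Rightarrow> (real \<Rightarrow> proj_line) \<Rightarrow> merom_fun \<Rightarrow>
    form_poly set \<Rightarrow> form_poly set" where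
  "op_disc D \<gamma> = split_op (K_along D)
     (\<lambda>\<phi> \<alpha>. - (1 / (2 * of_real pi * \<i>) * curve_integral \<gamma> (mult_form \<phi> \<alpha>)))
     (boundary D \<union> - Abstract_Topology.closure_of proj_top D) (boundary D \<union> D)"

definition op_at :: "proj_line \<Rightarrow> merom_fun \<Rightarrow> form_poly set \<Rightarrow> form_poly set" where
  "op_at P = split_op K_forms (\<lambda>\<phi> \<alpha>. Res P (mult_form \<phi> \<alpha>)) {P} (- {P})"

definition op_from :: "proj_line \<Rightarrow> merom_fun \<Rightarrow> form_poly set \<Rightarrow> form_poly set" where
  "op_from Q = split_op K_forms (\<lambda>\<phi> \<alpha>. - Res Q (mult_form \<phi> \<alpha>)) (- {Q}) {Q}"

end

theory Submission
  imports Defs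
begin

text \<open>
  On the symmetric algebra each operator is a derivation \<open>contract f\<close> (with \<open>f\<close> the functional
  attached to \<open>\<phi>\<close>) plus multiplication by a linear form \<open>d\<phi>\<^sub>1\<close>, where \<open>\<phi> = \<phi>\<^sub>1 + \<phi>\<^sub>2\<close>. Derivations of
  this kind commute, so the commutator is the scalar \<open>L (\<phi> d\<psi>\<^sub>1) - L (\<psi> d\<phi>\<^sub>1)\<close>, with \<open>L\<close> a multiple of
  the residue or of the boundary integral. It equals \<open>L (\<phi> d\<psi>)\<close> as soon as \<open>L\<close> vanishes on forms
  regular on either of the two sets where \<open>\<phi>\<^sub>1\<close> and \<open>\<phi>\<^sub>2\<close> are regular: splitting a function then shows
  that \<open>L\<close> also kills exact forms. For residues this is the fact that a form with at most one pole
  has residue 0. For a disc, let \<open>U\<close> be \<open>D\<close> or \<open>D'\<close>, and let the form be regular off \<open>U\<close>. A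
  coordinate sending a point of \<open>U\<close> to infinity turns the boundary into a Jordan curve in the plane;
  all poles lie outside it because \<open>U\<close> is connected (for \<open>D'\<close> this is the Jordan curve theorem), and
  the residue theorem applies.
\<close>

section \<open>The operators on the polynomial algebra\<close>

text \<open>The operators are given through \<open>THE\<close> and \<open>SOME\<close>, so the first
  obstacle is to compute them at all. This is done on representatives: \<open>basic_op\<close> sends
  the class of \<open>x\<close> to the class of \<open>contract f x + var_poly \<beta> * x\<close>,
  and linearity of \<open>f\<close> makes this descend to the quotient. The decompositions selected
  by \<open>SOME\<close> remain unknown, hence the commutator is evaluated for whatever pairs were
  picked. The mixed term \<open>\<phi>\<^sub>1 d\<psi>\<^sub>2\<close> is regular on neither set and
  \<open>L\<close> need not kill it; the product rule trades it for
  \<open>\<psi>\<^sub>2 d\<phi>\<^sub>1\<close>, and this is where exact forms enter. A curve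
  integral is additive only where the integrands are integrable, so the assumptions on
  \<open>L\<close> are restricted to forms regular on the intersection of the two sets. For a disc
  two coordinates are used, one with its pole in \<open>D\<close> and one with its pole in
  \<open>D'\<close>, since the poles of the form have to land on the unbounded side. That
  \<open>D'\<close> is nonempty and connected is not part of \<open>is_disc\<close> and has to be
  derived first.\<close>

lemma form_poly_sum_monomials:
  fixes x :: form_poly
  shows "x = (\<Sum>M\<in>Poly_Mapping.keys x. Poly_Mapping.single M (Poly_Mapping.lookup x M))"
proof (rule poly_mapping_eqI)
  fix k
  have "Poly_Mapping.lookup (\<Sum>M\<in>Poly_Mapping.keys x. Poly_Mapping.single M (Poly_Mapping.lookup x M)) k
      = (\<Sum>M\<in>Poly_Mapping.keys x. if M = k then Poly_Mapping.lookup x M else 0)"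
    by (simp add: lookup_sum lookup_single when_def)
  also have "\<dots> = Poly_Mapping.lookup x k"
    by (simp add: in_keys_iff)
  finally show "Poly_Mapping.lookup x k = Poly_Mapping.lookup
      (\<Sum>M\<in>Poly_Mapping.keys x. Poly_Mapping.single M (Poly_Mapping.lookup x M)) k" by simp
qed

lemma single_eq_const_mult:
  "Poly_Mapping.single M c = const_poly c * Poly_Mapping.single M 1"
  by (simp add: const_poly_def mult_single)

lemma const_poly_hom:
  "const_poly (a + b) = const_poly a + const_poly b"
  "const_poly (a * b) = const_poly a * const_poly b"
  "const_poly (- a) = - const_poly a"
  "const_poly (a - b) = const_poly a - const_poly b"
  "const_poly 0 = 0" "const_poly 1 = 1"
  by (simp_all add: const_poly_def single_add single_diff mult_single flip: single_uminus)

lemma form_poly_carrier_induct [consumes 1, case_names zero add monom]: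
  assumes "x \<in> carrier (poly_alg V)"
    and "P 0"
    and "\<And>x y. x \<in> carrier (poly_alg V) \<Longrightarrow> y \<in> carrier (poly_alg V) \<Longrightarrow> P x \<Longrightarrow> P y \<Longrightarrow> P (x + y)"
    and "\<And>M c. set_mset M \<subseteq> V \<Longrightarrow> P (Poly_Mapping.single M c)"
  shows "P x"
proof -
  have "(\<Sum>M\<in>A. Poly_Mapping.single M (g M)) \<in> carrier (poly_alg V) \<and>
        P (\<Sum>M\<in>A. Poly_Mapping.single M (g M))"
    \<comment> \<open>Membership of the partial sums is proved along with \<open>P\<close>, because
      the additive step demands it of both summands.\<close>
    if "finite A" "\<forall>M\<in>A. set_mset M \<subseteq> V" for A and g :: "merom_form multiset \<Rightarrow> complex"
    using that
  proof (induction A)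
    case empty
    then show ?case using assms(2) by (simp add: poly_alg_def)
  next
    case (insert N A)
    have "Poly_Mapping.single N (g N) \<in> carrier (poly_alg V)"
      using insert by (auto simp: poly_alg_def split: if_splits)
    moreover from this have "Poly_Mapping.single N (g N) + (\<Sum>M\<in>A. Poly_Mapping.single M (g M)) \<in> carrier (poly_alg V)"
      using insert by (auto simp: poly_alg_def dest!: subsetD[OF keys_add])
    ultimately show ?case
      using insert assms(3)[OF _ _ assms(4)] by auto
  qed
  from this[of "Poly_Mapping.keys x" "Poly_Mapping.lookup x"] assms(1)
  show ?thesis
    using form_poly_sum_monomials[of x] by (simp add: poly_alg_def)
qed

lemma form_poly_induct [case_names zero add monom]:
  fixes x :: form_poly
  assumes "P 0" "\<And>x y. P x \<Longrightarrow> P y \<Longrightarrow> P (x + y)" "\<And>M c. P (Poly_Mapping.single M c)"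
  shows "P x"
  by (rule form_poly_carrier_induct[where V = UNIV]) (auto simp: poly_alg_def intro: assms)

section \<open>Contractions as derivations of the polynomial algebra\<close>

definition contract_monom :: "(merom_form \<Rightarrow> complex) \<Rightarrow> merom_form multiset \<Rightarrow> form_poly" where
  "contract_monom f M = (\<Sum>\<alpha>\<in>#M. Poly_Mapping.single (M - {#\<alpha>#}) (f \<alpha>))"

text \<open>The derivation with value \<open>f \<alpha>\<close> on the indeterminate
  \<open>var_poly \<alpha>\<close>. The indeterminates are independent, so any \<open>f\<close>
  gives one; linearity of \<open>f\<close> enters when passing to the quotient.\<close>

definition contract :: "(merom_form \<Rightarrow> complex) \<Rightarrow> form_poly \<Rightarrow> form_poly" where
  "contract f x = (\<Sum>M\<in>Poly_Mapping.keys x. const_poly (Poly_Mapping.lookup x M) * contract_monom f M)"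

lemma contract_zero [simp]: "contract f 0 = 0"
  by (simp add: contract_def)

text \<open>Cancellation can make the keys of \<open>x + y\<close> fewer than the union of the keys;
  the lost monomials have coefficient 0 and contribute nothing.\<close>

lemma contract_add: "contract f (x + y) = contract f x + contract f y"
  unfolding contract_def
  by (rule setsum_keys_plus_distrib) (simp_all add: const_poly_hom algebra_simps)

lemma contract_single: "contract f (Poly_Mapping.single M c) = const_poly c * contract_monom f M"
  by (simp add: contract_def const_poly_hom)

text \<open>The occurrence to be deleted from \<open>M + N\<close> comes from \<open>M\<close> or
  from \<open>N\<close>, and deletion then takes place inside that summand. Counting occurrences
  with multiplicity makes this the Leibniz rule.\<close>

lemma contract_monom_add:
  "contract_monom f (M + N) =
     contract_monom f M * Poly_Mapping.single N 1 + Poly_Mapping.single M 1 * contract_monom f N"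
proof -
  have "(\<Sum>\<alpha>\<in>#M. Poly_Mapping.single (M + N - {#\<alpha>#}) (f \<alpha>)) =
        (\<Sum>\<alpha>\<in>#M. Poly_Mapping.single (M - {#\<alpha>#}) (f \<alpha>) * Poly_Mapping.single N 1)"
    by (intro arg_cong[of _ _ sum_mset] image_mset_cong) (simp add: mult_single)
  moreover have "(\<Sum>\<alpha>\<in>#N. Poly_Mapping.single (M + N - {#\<alpha>#}) (f \<alpha>)) =
        (\<Sum>\<alpha>\<in>#N. Poly_Mapping.single M 1 * Poly_Mapping.single (N - {#\<alpha>#}) (f \<alpha>))"
    by (intro arg_cong[of _ _ sum_mset] image_mset_cong) (simp add: mult_single)
  ultimately show ?thesis
    by (simp add: contract_monom_def sum_mset_distrib_left sum_mset_distrib_right)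
qed

lemma contract_mult: "contract f (x * y) = contract f x * y + x * contract f y"
proof (induction x rule: form_poly_induct)
  case (add x z)
  then show ?case by (simp add: contract_add distrib_right)
next
  case (monom M c)
  show ?case
  proof (induction y rule: form_poly_induct)
    case (add x z)
    then show ?case by (simp add: contract_add distrib_left)
  next
    case (monom N d)
    show ?case
      unfolding mult_single contract_single contract_monom_add const_poly_hom
      by (subst single_eq_const_mult[of N d], subst single_eq_const_mult[of M c]) (simp add: algebra_simps)
  qed simp
qed simp

lemma contract_const [simp]: "contract f (const_poly c) = 0"
  by (simp add: const_poly_def contract_single contract_monom_def)

lemma contract_var [simp]: "contract f (var_poly \<alpha>) = const_poly (f \<alpha>)"
  by (simp add: var_poly_def contract_single contract_monom_def const_poly_hom)
     (simp add: const_poly_def)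

lemma contract_uminus: "contract f (- x) = - contract f x"
  using contract_add[of f "- x" x] by (simp add: eq_neg_iff_add_eq_0)

lemma contract_diff: "contract f (x - y) = contract f x - contract f y"
  using contract_add[of f x "- y"] by (simp add: contract_uminus)

text \<open>Turns a monomial into a product of indeterminates, so that identities between
  derivations can be checked by induction on the multiset.\<close>

lemma single_eq_prod_var: "Poly_Mapping.single M 1 = (\<Prod>\<alpha>\<in>#M. var_poly \<alpha>)"
proof (induction M)
  case (add \<alpha> M)
  have "Poly_Mapping.single (add_mset \<alpha> M) 1 = var_poly \<alpha> * Poly_Mapping.single M 1"
    by (simp add: var_poly_def mult_single)
  then show ?case using add by simp
qed (simp flip: single_one)

text \<open>On an indeterminate both double contractions vanish, being contractions of constants;
  the mixed terms of the Leibniz rule are symmetric in \<open>f\<close> and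
  \<open>g\<close>.\<close>

lemma contract_commute: "contract f (contract g x) = contract g (contract f x)"
proof (induction x rule: form_poly_induct)
  case (monom M c)
  have "contract f (contract g (Poly_Mapping.single M 1)) = contract g (contract f (Poly_Mapping.single M 1))"
    unfolding single_eq_prod_var
    by (induction M) (simp_all add: contract_mult contract_add flip: const_poly_hom(6))
  then show ?case
    using single_eq_const_mult[of M c] by (simp add: contract_mult)
qed (simp_all add: contract_add)

text \<open>Merges the contractions belonging to the two summands of a decomposed function into a
  single one.\<close>

lemma contract_add_fun: "contract (\<lambda>\<alpha>. f \<alpha> + g \<alpha>) x = contract f x + contract g x"
proof -
  have "contract_monom (\<lambda>\<alpha>. f \<alpha> + g \<alpha>) M = contract_monom f M + contract_monom g M" for M
    by (simp add: contract_monom_def single_add sum_mset.distrib)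
  then show ?thesis by (simp add: contract_def distrib_left sum.distrib)
qed

text \<open>Passes from multisets to the indexed sum over list positions with \<open>omit\<close>
  that occurs in \<open>basic_op\<close>: positions of the list correspond to occurrences in its
  multiset.\<close>

lemma contract_single_mset:
  "contract f (Poly_Mapping.single (mset \<alpha>s) 1) =
     (\<Sum>i<length \<alpha>s. Poly_Mapping.single (mset (omit i \<alpha>s)) (f (\<alpha>s ! i)))"
proof -
  have "mset (omit i \<alpha>s) = mset \<alpha>s - {#\<alpha>s ! i#}" if "i < length \<alpha>s" for i
  proof -
    have "mset \<alpha>s = mset (take i \<alpha>s @ \<alpha>s ! i # drop (Suc i) \<alpha>s)"
      using that by (simp add: id_take_nth_drop[symmetric])
    then show ?thesis by (simp add: omit_def)
  qed
  moreover have "(\<Sum>\<alpha>\<in>#mset \<alpha>s. Poly_Mapping.single (mset \<alpha>s - {#\<alpha>#}) (f \<alpha>)) =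
    (\<Sum>i<length \<alpha>s. Poly_Mapping.single (mset \<alpha>s - {#\<alpha>s ! i#}) (f (\<alpha>s ! i)))"
    by (simp add: sum_mset_sum_list sum_list_sum_nth atLeast0LessThan flip: mset_map)
  ultimately show ?thesis
    by (simp add: contract_single contract_monom_def const_poly_hom)
qed

text \<open>Two contractions commute and so do two multiplications; only the derivation of one
  factor by the other contraction survives. For linear forms \<open>b\<close> and \<open>c\<close>
  the remaining factor is a constant.\<close>

lemma commutator_contract:
  "(contract f (contract g x + c * x) + b * (contract g x + c * x)) -
   (contract g (contract f x + b * x) + c * (contract f x + b * x)) =
   (contract f c - contract g b) * x"
  by (simp add: contract_add contract_mult contract_commute[of f g] algebra_simps)

section \<open>The operators on the symmetric algebra\<close>

lemma poly_alg_simps [simp]: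
  "x \<otimes>\<^bsub>poly_alg V\<^esub> y = x * y" "x \<oplus>\<^bsub>poly_alg V\<^esub> y = x + y"
  "\<one>\<^bsub>poly_alg V\<^esub> = 1" "\<zero>\<^bsub>poly_alg V\<^esub> = 0"
  by (simp_all add: poly_alg_def)

lemma poly_alg_add_closed:
  "x \<in> carrier (poly_alg V) \<Longrightarrow> y \<in> carrier (poly_alg V) \<Longrightarrow> x + y \<in> carrier (poly_alg V)"
  by (auto simp: poly_alg_def dest!: subsetD[OF keys_add])

lemma poly_alg_mult_closed:
  "x \<in> carrier (poly_alg V) \<Longrightarrow> y \<in> carrier (poly_alg V) \<Longrightarrow> x * y \<in> carrier (poly_alg V)"
  unfolding poly_alg_def by (fastforce dest!: subsetD[OF keys_mult])

lemma poly_alg_uminus_closed: "x \<in> carrier (poly_alg V) \<Longrightarrow> - x \<in> carrier (poly_alg V)"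
  by (auto simp: poly_alg_def in_keys_iff)

lemma poly_alg_diff_closed:
  "x \<in> carrier (poly_alg V) \<Longrightarrow> y \<in> carrier (poly_alg V) \<Longrightarrow> x - y \<in> carrier (poly_alg V)"
  using poly_alg_add_closed[of x V "- y"] poly_alg_uminus_closed[of y V] by simp

lemma single_in_poly_alg: "set_mset M \<subseteq> V \<Longrightarrow> Poly_Mapping.single M c \<in> carrier (poly_alg V)"
  by (auto simp: poly_alg_def split: if_splits)

lemma const_in_poly_alg: "const_poly c \<in> carrier (poly_alg V)"
  by (simp add: const_poly_def single_in_poly_alg)

lemma var_in_poly_alg: "\<alpha> \<in> V \<Longrightarrow> var_poly \<alpha> \<in> carrier (poly_alg V)"
  by (simp add: var_poly_def single_in_poly_alg)

lemma zero_in_poly_alg: "0 \<in> carrier (poly_alg V)"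
  by (simp add: poly_alg_def)

lemma one_in_poly_alg: "1 \<in> carrier (poly_alg V)"
  using const_in_poly_alg[of 1 V] by (simp add: const_poly_hom)

lemma poly_alg_sum_closed:
  "(\<And>i. i \<in> A \<Longrightarrow> g i \<in> carrier (poly_alg V)) \<Longrightarrow> sum g A \<in> carrier (poly_alg V)"
  by (induction A rule: infinite_finite_induct) (auto intro: zero_in_poly_alg poly_alg_add_closed)

lemmas poly_alg_closed = poly_alg_add_closed poly_alg_mult_closed poly_alg_uminus_closed
  poly_alg_diff_closed single_in_poly_alg const_in_poly_alg var_in_poly_alg zero_in_poly_alg
  one_in_poly_alg poly_alg_sum_closed

lemma contract_closed:
  assumes "x \<in> carrier (poly_alg V)"
  shows "contract f x \<in> carrier (poly_alg V)"
  using assms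
proof (induction x rule: form_poly_carrier_induct)
  case (monom M c)
  obtain \<alpha>s where M: "M = mset \<alpha>s" by (metis ex_mset)
  have "set_mset (mset (omit i \<alpha>s)) \<subseteq> V" if "i < length \<alpha>s" for i
    using monom by (auto simp: M omit_def dest: in_set_takeD in_set_dropD)
  then have "contract f (Poly_Mapping.single M 1) \<in> carrier (poly_alg V)"
    unfolding M contract_single_mset by (intro poly_alg_closed) auto
  then show ?case
    using single_eq_const_mult[of M c] by (simp add: contract_mult poly_alg_closed)
qed (simp_all add: contract_add poly_alg_closed)

lemma poly_alg_cring: "cring (poly_alg V)"
proof (rule cringI)
  show "abelian_group (poly_alg V)"
  proof (rule abelian_groupI)
    fix x assume "x \<in> carrier (poly_alg V)"
    then show "\<exists>y\<in>carrier (poly_alg V). y \<oplus>\<^bsub>poly_alg V\<^esub> x = \<zero>\<^bsub>poly_alg V\<^esub>"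
      by (intro bexI[of _ "- x"]) (simp_all add: poly_alg_uminus_closed)
  qed (simp_all add: poly_alg_closed algebra_simps)
  show "comm_monoid (poly_alg V)"
    by (rule comm_monoidI) (simp_all add: poly_alg_closed algebra_simps)
qed (simp add: algebra_simps)

text \<open>The ring record carries no subtraction of its own: its minus goes through the additive
  inverse taken in the carrier, and has to be identified with the type class minus.\<close>

lemma poly_alg_minus:
  assumes "x \<in> carrier (poly_alg V)" "y \<in> carrier (poly_alg V)"
  shows "x \<ominus>\<^bsub>poly_alg V\<^esub> y = x - y"
proof -
  interpret cring "poly_alg V" by (rule poly_alg_cring)
  have "(x \<ominus>\<^bsub>poly_alg V\<^esub> y) \<oplus>\<^bsub>poly_alg V\<^esub> y = x"
    using assms by algebra
  then show ?thesis by (simp add: eq_diff_eq)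
qed

section \<open>Passage to the quotient\<close>

locale form_space =
  fixes V :: "merom_form set"
  assumes zero_in: "0 \<in> V"
    and add_in: "\<alpha> \<in> V \<Longrightarrow> \<beta> \<in> V \<Longrightarrow> \<alpha> + \<beta> \<in> V"
    and scale_in: "\<alpha> \<in> V \<Longrightarrow> scale_form c \<alpha> \<in> V"
begin

text \<open>Linearity is asked on \<open>V\<close> alone, since the boundary integral is available
  as a linear functional only for forms regular along the curve.\<close>

definition linear_functional :: "(merom_form \<Rightarrow> complex) \<Rightarrow> bool" where
  "linear_functional f \<longleftrightarrow> (\<forall>\<alpha>\<in>V. \<forall>\<beta>\<in>V. f (\<alpha> + \<beta>) = f \<alpha> + f \<beta>) \<and>
     (\<forall>c. \<forall>\<alpha>\<in>V. f (scale_form c \<alpha>) = c * f \<alpha>)"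

definition gens :: "form_poly set" where
  "gens = {var_poly (\<alpha> + \<beta>) - var_poly \<alpha> - var_poly \<beta> | \<alpha> \<beta>. \<alpha> \<in> V \<and> \<beta> \<in> V} \<union>
      {var_poly (scale_form c \<alpha>) - const_poly c * var_poly \<alpha> | c \<alpha>. \<alpha> \<in> V}"

lemma gens_subset: "gens \<subseteq> carrier (poly_alg V)"
  unfolding gens_def using add_in scale_in by (fastforce intro: poly_alg_closed)

sublocale R: cring "poly_alg V" by (rule poly_alg_cring)

lemma sym_ideal_eq: "sym_ideal V = Idl\<^bsub>poly_alg V\<^esub> gens"
  by (simp add: sym_ideal_def gens_def)

sublocale I: ideal "sym_ideal V" "poly_alg V"
  unfolding sym_ideal_eq by (rule R.genideal_ideal[OF gens_subset])

sublocale S: cring "Sym V"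
  unfolding Sym_def by (rule I.quotient_is_cring) (rule poly_alg_cring)

abbreviation cls :: "form_poly \<Rightarrow> form_poly set" where
  "cls x \<equiv> sym_ideal V +>\<^bsub>poly_alg V\<^esub> x"

lemma cls_hom: "cls \<in> ring_hom (poly_alg V) (Sym V)"
  unfolding Sym_def by (rule I.rcos_ring_hom)

lemma cls_closed: "x \<in> carrier (poly_alg V) \<Longrightarrow> cls x \<in> carrier (Sym V)"
  using cls_hom by (rule ring_hom_closed)

lemma cls_add:
  "x \<in> carrier (poly_alg V) \<Longrightarrow> y \<in> carrier (poly_alg V) \<Longrightarrow> cls x \<oplus>\<^bsub>Sym V\<^esub> cls y = cls (x + y)"
  using ring_hom_add[OF cls_hom] by simp

lemma cls_mult:
  "x \<in> carrier (poly_alg V) \<Longrightarrow> y \<in> carrier (poly_alg V) \<Longrightarrow> cls x \<otimes>\<^bsub>Sym V\<^esub> cls y = cls (x * y)"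
  using ring_hom_mult[OF cls_hom] by simp

lemma cls_one: "\<one>\<^bsub>Sym V\<^esub> = cls 1"
  using ring_hom_one[OF cls_hom] by simp

lemma cls_zero: "\<zero>\<^bsub>Sym V\<^esub> = cls 0"
  using ring_hom_zero[OF cls_hom R.ring_axioms S.ring_axioms] by simp

lemma cls_diff:
  assumes "x \<in> carrier (poly_alg V)" "y \<in> carrier (poly_alg V)"
  shows "cls x \<ominus>\<^bsub>Sym V\<^esub> cls y = cls (x - y)"
proof -
  have "cls (x - y) \<oplus>\<^bsub>Sym V\<^esub> cls y = cls x"
    using assms by (simp add: cls_add poly_alg_closed)
  moreover have "cls (x - y) \<in> carrier (Sym V)" "cls y \<in> carrier (Sym V)"
    using assms by (auto intro: cls_closed poly_alg_closed)
  ultimately show ?thesis by (metis S.add.m_assoc S.minus_eq S.r_neg S.r_zero S.add.inv_closed)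
qed

lemma carrier_Sym: "carrier (Sym V) = cls ` carrier (poly_alg V)"
  by (auto simp: Sym_def FactRing_def A_RCOSETS_def' )

lemma cls_eq_iff:
  assumes "x \<in> carrier (poly_alg V)" "y \<in> carrier (poly_alg V)"
  shows "cls x = cls y \<longleftrightarrow> x - y \<in> sym_ideal V"
proof -
  have "cls x = cls y \<longleftrightarrow> x \<in> cls y"
    using assms by (metis I.a_rcos_self I.a_repr_independence')
  then show ?thesis
    using I.a_rcos_module_minus[OF R.ring_axioms assms(2,1)] poly_alg_minus[OF assms] by simp
qed

lemma sym_scale_cls:
  "x \<in> carrier (poly_alg V) \<Longrightarrow> sym_scale V c (cls x) = cls (const_poly c * x)"
  by (simp add: sym_scale_def cls_mult const_in_poly_alg)

lemma sym_prod_cls: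
  "set \<alpha>s \<subseteq> V \<Longrightarrow> sym_prod V \<alpha>s = cls (Poly_Mapping.single (mset \<alpha>s) 1)"
proof (induction \<alpha>s)
  case Nil
  then show ?case by (simp add: sym_prod_def cls_one flip: single_one)
next
  case (Cons \<alpha> \<alpha>s)
  have "sym_prod V (\<alpha> # \<alpha>s) = cls (var_poly \<alpha>) \<otimes>\<^bsub>Sym V\<^esub> sym_prod V \<alpha>s"
    by (simp add: sym_prod_def sym_incl_def)
  then show ?case
    using Cons by (simp add: cls_mult poly_alg_closed) (simp add: var_poly_def mult_single)
qed

lemma cls_sum:
  assumes "finite A" "\<And>i. i \<in> A \<Longrightarrow> g i \<in> carrier (poly_alg V)"
  shows "(\<Oplus>\<^bsub>Sym V\<^esub>i\<in>A. cls (g i)) = cls (sum g A)"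
  using assms
proof (induction A)
  case (insert i A)
  then show ?case
    by (subst S.finsum_insert) (auto simp: cls_add poly_alg_closed cls_closed)
qed (simp add: cls_zero)

text \<open>By the Leibniz rule, the elements of the ideal whose contraction is again in the ideal
  form an ideal \<open>?J\<close>. It contains the generators, so minimality of the generated ideal
  gives the claim.\<close>

lemma contract_sym_ideal:
  assumes "linear_functional f" "x \<in> sym_ideal V"
  shows "contract f x \<in> sym_ideal V"
proof -
  let ?J = "{x \<in> sym_ideal V. contract f x \<in> sym_ideal V}"
  have IR: "x \<in> carrier (poly_alg V)" if "x \<in> sym_ideal V" for x
    using that I.Icarr by blast
  have zero: "0 \<in> sym_ideal V" using I.zero_closed by simp
  have add: "x + y \<in> sym_ideal V" if "x \<in> sym_ideal V" "y \<in> sym_ideal V" for x y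
    using I.a_closed[OF that] by simp
  have mult: "x * y \<in> sym_ideal V" if "x \<in> sym_ideal V" "y \<in> carrier (poly_alg V)" for x y
    using I.I_r_closed[OF that] by simp
  have minus: "- x \<in> sym_ideal V" if "x \<in> sym_ideal V" for x
    using mult[OF that, of "- 1"] by (simp add: poly_alg_uminus_closed one_in_poly_alg)
  have "ideal ?J (poly_alg V)"
  proof (rule idealI)
    show "subgroup ?J (add_monoid (poly_alg V))"
    proof (rule R.add.subgroupI)
      fix x assume x: "x \<in> ?J"
      then have "\<ominus>\<^bsub>poly_alg V\<^esub> x = - x"
        using poly_alg_minus[of 0 V x] IR[of x] by (simp add: zero_in_poly_alg R.minus_eq)
      then show "\<ominus>\<^bsub>poly_alg V\<^esub> x \<in> ?J"
        using x minus by (simp add: contract_uminus)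
    qed (use zero add IR in \<open>auto simp: contract_add\<close>)
  next
    fix a x assume *: "a \<in> ?J" "x \<in> carrier (poly_alg V)"
    then have "contract f (a * x) \<in> sym_ideal V"
      by (simp add: contract_mult add mult contract_closed)
    then show "a \<otimes>\<^bsub>poly_alg V\<^esub> x \<in> ?J" "x \<otimes>\<^bsub>poly_alg V\<^esub> a \<in> ?J"
      using * mult[of a x] by (simp_all add: mult.commute)
  qed (rule R.ring_axioms)
  moreover have "gens \<subseteq> ?J"
  proof
    fix g assume g: "g \<in> gens"
    \<comment> \<open>A generator contracts to the constant
      \<open>f (\<alpha> + \<beta>) - f \<alpha> - f \<beta>\<close> or
      \<open>f (scale_form c \<alpha>) - c * f \<alpha>\<close>, which is where linearity of
      \<open>f\<close> is used.\<close>
    then have "contract f g = 0"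
      using assms(1) by (auto simp: gens_def linear_functional_def contract_diff contract_mult
          const_poly_hom)
    then show "g \<in> ?J"
      using g zero R.genideal_self[OF gens_subset] by (auto simp: sym_ideal_eq)
  qed
  ultimately have "sym_ideal V \<subseteq> ?J"
    unfolding sym_ideal_eq by (rule R.genideal_minimal)
  with assms(2) show ?thesis by blast
qed

text \<open>To evaluate the \<open>THE\<close>, existence and uniqueness are both required. The map
  \<open>E\<close> on polynomials descends to the quotient and satisfies the defining formula;
  uniqueness holds because the products of forms span and values off the carrier are fixed by the
  extensional function space.\<close>

lemma basic_op_cls:
  assumes f: "linear_functional f" and \<beta>: "\<beta> \<in> V" and x: "x \<in> carrier (poly_alg V)"
  shows "basic_op V f \<beta> (cls x) = cls (contract f x + var_poly \<beta> * x)"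
proof -
  let ?P = "\<lambda>T. T \<in> carrier (Sym V) \<rightarrow>\<^sub>E carrier (Sym V) \<and> sym_linear V T \<and>
     (\<forall>\<alpha>s\<in>lists V. T (sym_prod V \<alpha>s) =
        (\<Oplus>\<^bsub>Sym V\<^esub>i\<in>{..<length \<alpha>s}. sym_scale V (f (\<alpha>s ! i)) (sym_prod V (omit i \<alpha>s)))
        \<oplus>\<^bsub>Sym V\<^esub> sym_prod V (\<beta> # \<alpha>s))"
  define E where "E x = contract f x + var_poly \<beta> * x" for x
  have E_closed: "E x \<in> carrier (poly_alg V)" if "x \<in> carrier (poly_alg V)" for x
    using that \<beta> by (simp add: E_def poly_alg_closed contract_closed)
  have E_add: "E (x + y) = E x + E y" and E_const: "E (const_poly c * x) = const_poly c * E x" for x y c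
    by (simp_all add: E_def contract_add contract_mult algebra_simps)
  have E_cong: "cls (E x) = cls (E y)"
    if "x \<in> carrier (poly_alg V)" "y \<in> carrier (poly_alg V)" "cls x = cls y" for x y
  proof -
    have d: "x - y \<in> sym_ideal V" using that cls_eq_iff by blast
    \<comment> \<open>Written with the operations of the ring record so that the closure rules of
      the ideal apply.\<close>
    have "contract f (x - y) \<oplus>\<^bsub>poly_alg V\<^esub> var_poly \<beta> \<otimes>\<^bsub>poly_alg V\<^esub> (x - y) \<in> sym_ideal V"
      by (intro I.a_closed I.I_l_closed d contract_sym_ideal f var_in_poly_alg \<beta>)
    then have "E x - E y \<in> sym_ideal V"
      by (simp add: E_def contract_diff algebra_simps)
    then show ?thesis using that cls_eq_iff E_closed by blast
  qed
  \<comment> \<open>The representative is chosen arbitrarily; \<open>E_cong\<close> makes the choice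
    harmless.\<close>
  define T where "T = (\<lambda>w\<in>carrier (Sym V). cls (E (SOME x. x \<in> carrier (poly_alg V) \<and> cls x = w)))"
  have T: "T (cls x) = cls (E x)" if "x \<in> carrier (poly_alg V)" for x
  proof -
    let ?y = "SOME y. y \<in> carrier (poly_alg V) \<and> cls y = cls x"
    have "?y \<in> carrier (poly_alg V) \<and> cls ?y = cls x"
      by (rule someI[of _ x]) (simp add: that)
    then have "cls (E ?y) = cls (E x)"
      using that E_cong by blast
    then show ?thesis
      using that by (simp add: T_def cls_closed)
  qed
  have prod_image: "(\<Oplus>\<^bsub>Sym V\<^esub>i\<in>{..<length \<alpha>s}. sym_scale V (f (\<alpha>s ! i)) (sym_prod V (omit i \<alpha>s)))
        \<oplus>\<^bsub>Sym V\<^esub> sym_prod V (\<beta> # \<alpha>s) = cls (E (Poly_Mapping.single (mset \<alpha>s) 1))"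
    if "\<alpha>s \<in> lists V" for \<alpha>s
  proof -
    have omit: "set (omit i \<alpha>s) \<subseteq> V" for i
      using that by (auto simp: omit_def dest: in_set_takeD in_set_dropD)
    have "sym_scale V (f (\<alpha>s ! i)) (sym_prod V (omit i \<alpha>s)) =
        cls (Poly_Mapping.single (mset (omit i \<alpha>s)) (f (\<alpha>s ! i)))" for i
      using omit[of i]
      by (simp add: sym_prod_cls sym_scale_cls poly_alg_closed flip: single_eq_const_mult)
    then have "(\<Oplus>\<^bsub>Sym V\<^esub>i\<in>{..<length \<alpha>s}. sym_scale V (f (\<alpha>s ! i)) (sym_prod V (omit i \<alpha>s))) =
        cls (contract f (Poly_Mapping.single (mset \<alpha>s) 1))"
      using omit by (simp add: cls_sum contract_single_mset poly_alg_closed)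
    moreover have "sym_prod V (\<beta> # \<alpha>s) = cls (var_poly \<beta> * Poly_Mapping.single (mset \<alpha>s) 1)"
      using that \<beta> by (subst sym_prod_cls) (auto simp: var_poly_def mult_single)
    ultimately show ?thesis
      using that \<beta> by (auto simp: E_def intro!: cls_add poly_alg_closed contract_closed)
  qed
  have "?P T"
  proof (intro conjI ballI)
    show "T \<in> carrier (Sym V) \<rightarrow>\<^sub>E carrier (Sym V)"
    proof (rule PiE_I)
      show "T w \<in> carrier (Sym V)" if "w \<in> carrier (Sym V)" for w
        using that unfolding carrier_Sym by (auto simp: T E_closed)
    qed (simp add: T_def)
    show "sym_linear V T"
      unfolding sym_linear_def carrier_Sym
      by (auto simp: T cls_add sym_scale_cls E_closed E_add E_const poly_alg_closed)
  next
    fix \<alpha>s assume "\<alpha>s \<in> lists V"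
    moreover from this have "sym_prod V \<alpha>s = cls (Poly_Mapping.single (mset \<alpha>s) 1)"
        "Poly_Mapping.single (mset \<alpha>s) 1 \<in> carrier (poly_alg V)"
      by (auto intro!: sym_prod_cls poly_alg_closed)
    ultimately show "T (sym_prod V \<alpha>s) = (\<Oplus>\<^bsub>Sym V\<^esub>i\<in>{..<length \<alpha>s}. sym_scale V (f (\<alpha>s ! i)) (sym_prod V (omit i \<alpha>s)))
        \<oplus>\<^bsub>Sym V\<^esub> sym_prod V (\<beta> # \<alpha>s)"
      by (simp only: prod_image T)
  qed
  moreover have "T' = T" if "?P T'" for T'
  proof -
    have add_T': "T' (w \<oplus>\<^bsub>Sym V\<^esub> v) = T' w \<oplus>\<^bsub>Sym V\<^esub> T' v"
      if "w \<in> carrier (Sym V)" "v \<in> carrier (Sym V)" for w v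
      using \<open>?P T'\<close> that by (auto simp: sym_linear_def)
    have scale_T': "T' (sym_scale V c w) = sym_scale V c (T' w)" if "w \<in> carrier (Sym V)" for w c
      using \<open>?P T'\<close> that by (auto simp: sym_linear_def)
    have monom: "T' (cls (Poly_Mapping.single M c)) = cls (E (Poly_Mapping.single M c))" if "set_mset M \<subseteq> V" for M c
    proof -
      obtain \<alpha>s where M: "M = mset \<alpha>s" by (metis ex_mset)
      have \<alpha>s: "\<alpha>s \<in> lists V" using that M by auto
      have M1: "Poly_Mapping.single M 1 \<in> carrier (poly_alg V)"
        using that by (rule single_in_poly_alg)
      have "T' (cls (Poly_Mapping.single M 1)) = cls (E (Poly_Mapping.single M 1))"
      proof -
        have "T' (sym_prod V \<alpha>s) = cls (E (Poly_Mapping.single (mset \<alpha>s) 1))"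
          using \<open>?P T'\<close> \<alpha>s unfolding prod_image[OF \<alpha>s, symmetric] by blast
        moreover have "sym_prod V \<alpha>s = cls (Poly_Mapping.single (mset \<alpha>s) 1)"
          using \<alpha>s by (intro sym_prod_cls) auto
        ultimately show ?thesis by (simp only: M)
      qed
      then have "T' (sym_scale V c (cls (Poly_Mapping.single M 1))) =
          sym_scale V c (cls (E (Poly_Mapping.single M 1)))"
        using M1 scale_T' cls_closed by simp
      then show ?thesis
        using M1 single_eq_const_mult[of M c] by (simp add: sym_scale_cls E_closed E_const)
    qed
    have "T' (cls x) = T (cls x)" if "x \<in> carrier (poly_alg V)" for x
      using that
    proof (induction x rule: form_poly_carrier_induct)
      case zero
      \<comment> \<open>The zero polynomial is treated as the empty monomial with coefficient 0, so
        the monomial case covers it.\<close>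
      show ?case using monom[of "{#}" 0] by (simp add: T zero_in_poly_alg)
    next
      case (add x y)
      then show ?case
        using add_T'[of "cls x" "cls y"]
        by (simp add: T cls_add cls_closed poly_alg_closed E_closed E_add)
    qed (simp add: T monom single_in_poly_alg)
    then have "T' w = T w" if "w \<in> carrier (Sym V)" for w
      using that by (auto simp: carrier_Sym)
    moreover have "T' w = T w" if "w \<notin> carrier (Sym V)" for w
      using that PiE_arb[OF conjunct1[OF \<open>?P T'\<close>]] PiE_arb[OF conjunct1[OF \<open>?P T\<close>]] by simp
    ultimately show ?thesis by (intro ext) blast
  qed
  ultimately have "basic_op V f \<beta> = T"
    unfolding basic_op_def by (rule the_equality)
  then show ?thesis using x by (simp add: T E_def)
qed

text \<open>\<open>var_poly 0\<close> is an indeterminate and not the zero polynomial, although its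
  class is zero. Contracting it yields \<open>f 0\<close>, so this value must be known.\<close>

lemma linear_functional_zero: "linear_functional f \<Longrightarrow> f 0 = 0"
  using zero_in by (force simp: linear_functional_def)

text \<open>Stated as an elimination rule because nothing is known of the selected pair beyond its
  defining properties. The summand \<open>var_poly 0\<close> stems from the second operator, whose
  form \<open>\<beta>\<close> is 0.\<close>

lemma split_op_cls:
  assumes "\<exists>\<phi>\<^sub>1 \<phi>\<^sub>2. \<phi> = \<phi>\<^sub>1 + \<phi>\<^sub>2 \<and> fun_regular_on \<phi>\<^sub>1 A \<and> fun_regular_on \<phi>\<^sub>2 B"
    and "\<And>\<eta>. fun_regular_on \<eta> A \<or> fun_regular_on \<eta> B \<Longrightarrow> linear_functional (F \<eta>) \<and> ext_d \<eta> \<in> V"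
  obtains \<phi>\<^sub>1 \<phi>\<^sub>2 where "\<phi> = \<phi>\<^sub>1 + \<phi>\<^sub>2" "fun_regular_on \<phi>\<^sub>1 A" "fun_regular_on \<phi>\<^sub>2 B"
    "\<And>x. x \<in> carrier (poly_alg V) \<Longrightarrow> split_op V F A B \<phi> (cls x) =
       cls (contract (\<lambda>\<alpha>. F \<phi>\<^sub>1 \<alpha> + F \<phi>\<^sub>2 \<alpha>) x + (var_poly (ext_d \<phi>\<^sub>1) + var_poly 0) * x)"
proof -
  define p where "p = (SOME (\<phi>\<^sub>1, \<phi>\<^sub>2). \<phi> = \<phi>\<^sub>1 + \<phi>\<^sub>2 \<and> fun_regular_on \<phi>\<^sub>1 A \<and> fun_regular_on \<phi>\<^sub>2 B)"
  obtain \<phi>\<^sub>1 \<phi>\<^sub>2 where p: "p = (\<phi>\<^sub>1, \<phi>\<^sub>2)" by (cases p)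
  have "case p of (\<phi>\<^sub>1, \<phi>\<^sub>2) \<Rightarrow> \<phi> = \<phi>\<^sub>1 + \<phi>\<^sub>2 \<and> fun_regular_on \<phi>\<^sub>1 A \<and> fun_regular_on \<phi>\<^sub>2 B"
    unfolding p_def by (rule someI_ex) (use assms(1) in auto)
  then have *: "\<phi> = \<phi>\<^sub>1 + \<phi>\<^sub>2" "fun_regular_on \<phi>\<^sub>1 A" "fun_regular_on \<phi>\<^sub>2 B"
    by (auto simp: p)
  show thesis
  proof (rule that[OF *])
    fix x assume x: "x \<in> carrier (poly_alg V)"
    have "split_op V F A B \<phi> (cls x) =
        basic_op V (F \<phi>\<^sub>1) (ext_d \<phi>\<^sub>1) (cls x) \<oplus>\<^bsub>Sym V\<^esub> basic_op V (F \<phi>\<^sub>2) 0 (cls x)"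
      by (simp add: split_op_def p flip: p_def)
    also have "\<dots> = cls ((contract (F \<phi>\<^sub>1) x + var_poly (ext_d \<phi>\<^sub>1) * x) + (contract (F \<phi>\<^sub>2) x + var_poly 0 * x))"
      using assms(2) * x zero_in
      by (simp add: basic_op_cls cls_add poly_alg_closed contract_closed)
    finally show "split_op V F A B \<phi> (cls x) =
        cls (contract (\<lambda>\<alpha>. F \<phi>\<^sub>1 \<alpha> + F \<phi>\<^sub>2 \<alpha>) x + (var_poly (ext_d \<phi>\<^sub>1) + var_poly 0) * x)"
      by (simp add: contract_add_fun algebra_simps)
  qed
qed

text \<open>\<open>F\<close> is arbitrary in its first argument, so the scalar keeps the
  contributions of the two summands apart; they are combined once \<open>F\<close> is made from
  \<open>L\<close>.\<close>

lemma commutator_split_op: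
  assumes "\<exists>\<phi>\<^sub>1 \<phi>\<^sub>2. \<phi> = \<phi>\<^sub>1 + \<phi>\<^sub>2 \<and> fun_regular_on \<phi>\<^sub>1 A \<and> fun_regular_on \<phi>\<^sub>2 B"
    and "\<exists>\<psi>\<^sub>1 \<psi>\<^sub>2. \<psi> = \<psi>\<^sub>1 + \<psi>\<^sub>2 \<and> fun_regular_on \<psi>\<^sub>1 A \<and> fun_regular_on \<psi>\<^sub>2 B"
    and F: "\<And>\<eta>. fun_regular_on \<eta> A \<or> fun_regular_on \<eta> B \<Longrightarrow> linear_functional (F \<eta>) \<and> ext_d \<eta> \<in> V"
  obtains \<phi>\<^sub>1 \<phi>\<^sub>2 \<psi>\<^sub>1 \<psi>\<^sub>2 where
    "\<phi> = \<phi>\<^sub>1 + \<phi>\<^sub>2" "fun_regular_on \<phi>\<^sub>1 A" "fun_regular_on \<phi>\<^sub>2 B"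
    "\<psi> = \<psi>\<^sub>1 + \<psi>\<^sub>2" "fun_regular_on \<psi>\<^sub>1 A" "fun_regular_on \<psi>\<^sub>2 B"
    "\<And>w. w \<in> carrier (Sym V) \<Longrightarrow>
       split_op V F A B \<phi> (split_op V F A B \<psi> w) \<ominus>\<^bsub>Sym V\<^esub> split_op V F A B \<psi> (split_op V F A B \<phi> w) =
       sym_scale V (F \<phi>\<^sub>1 (ext_d \<psi>\<^sub>1) + F \<phi>\<^sub>2 (ext_d \<psi>\<^sub>1) - (F \<psi>\<^sub>1 (ext_d \<phi>\<^sub>1) + F \<psi>\<^sub>2 (ext_d \<phi>\<^sub>1))) w"
proof -
  obtain \<phi>\<^sub>1 \<phi>\<^sub>2 where \<phi>: "\<phi> = \<phi>\<^sub>1 + \<phi>\<^sub>2" "fun_regular_on \<phi>\<^sub>1 A" "fun_regular_on \<phi>\<^sub>2 B"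
    and op_\<phi>: "\<And>x. x \<in> carrier (poly_alg V) \<Longrightarrow> split_op V F A B \<phi> (cls x) =
       cls (contract (\<lambda>\<alpha>. F \<phi>\<^sub>1 \<alpha> + F \<phi>\<^sub>2 \<alpha>) x + (var_poly (ext_d \<phi>\<^sub>1) + var_poly 0) * x)"
    by (rule split_op_cls[OF assms(1) F]) blast+
  obtain \<psi>\<^sub>1 \<psi>\<^sub>2 where \<psi>: "\<psi> = \<psi>\<^sub>1 + \<psi>\<^sub>2" "fun_regular_on \<psi>\<^sub>1 A" "fun_regular_on \<psi>\<^sub>2 B"
    and op_\<psi>: "\<And>x. x \<in> carrier (poly_alg V) \<Longrightarrow> split_op V F A B \<psi> (cls x) =
       cls (contract (\<lambda>\<alpha>. F \<psi>\<^sub>1 \<alpha> + F \<psi>\<^sub>2 \<alpha>) x + (var_poly (ext_d \<psi>\<^sub>1) + var_poly 0) * x)"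
    by (rule split_op_cls[OF assms(2) F]) blast+
  show thesis
  proof (rule that[OF \<phi> \<psi>])
    fix w assume "w \<in> carrier (Sym V)"
    then obtain x where w: "w = cls x" and x: "x \<in> carrier (poly_alg V)"
      by (auto simp: carrier_Sym)
    define f where "f = (\<lambda>\<alpha>. F \<phi>\<^sub>1 \<alpha> + F \<phi>\<^sub>2 \<alpha>)"
    define g where "g = (\<lambda>\<alpha>. F \<psi>\<^sub>1 \<alpha> + F \<psi>\<^sub>2 \<alpha>)"
    define b where "b = var_poly (ext_d \<phi>\<^sub>1) + var_poly 0"
    define c where "c = var_poly (ext_d \<psi>\<^sub>1) + var_poly 0"
    have bc: "b \<in> carrier (poly_alg V)" "c \<in> carrier (poly_alg V)"
      using F \<phi> \<psi> zero_in by (auto simp: b_def c_def intro!: poly_alg_closed)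
    have zeros: "F \<phi>\<^sub>1 0 = 0" "F \<phi>\<^sub>2 0 = 0" "F \<psi>\<^sub>1 0 = 0" "F \<psi>\<^sub>2 0 = 0"
      using F \<phi> \<psi> by (auto intro!: linear_functional_zero)
    have scalars: "contract f c - contract g b =
        const_poly (F \<phi>\<^sub>1 (ext_d \<psi>\<^sub>1) + F \<phi>\<^sub>2 (ext_d \<psi>\<^sub>1) - (F \<psi>\<^sub>1 (ext_d \<phi>\<^sub>1) + F \<psi>\<^sub>2 (ext_d \<phi>\<^sub>1)))"
      by (simp add: zeros f_def g_def b_def c_def contract_add const_poly_hom)
    have "split_op V F A B \<phi> (split_op V F A B \<psi> w) \<ominus>\<^bsub>Sym V\<^esub> split_op V F A B \<psi> (split_op V F A B \<phi> w) =
        cls (contract f (contract g x + c * x) + b * (contract g x + c * x)) \<ominus>\<^bsub>Sym V\<^esub>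
        cls (contract g (contract f x + b * x) + c * (contract f x + b * x))"
      using x bc by (simp add: w op_\<phi> op_\<psi> poly_alg_closed contract_closed flip: f_def g_def b_def c_def)
    also have "\<dots> = cls ((contract f c - contract g b) * x)"
      using x bc by (simp add: cls_diff poly_alg_closed contract_closed flip: commutator_contract)
    finally show "split_op V F A B \<phi> (split_op V F A B \<psi> w) \<ominus>\<^bsub>Sym V\<^esub> split_op V F A B \<psi> (split_op V F A B \<phi> w) =
        sym_scale V (F \<phi>\<^sub>1 (ext_d \<psi>\<^sub>1) + F \<phi>\<^sub>2 (ext_d \<psi>\<^sub>1) - (F \<psi>\<^sub>1 (ext_d \<phi>\<^sub>1) + F \<psi>\<^sub>2 (ext_d \<phi>\<^sub>1))) w"
      by (simp only: w scalars sym_scale_cls[OF x])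
  qed
qed

end

section \<open>Germs, regularity and residues\<close>

text \<open>The affine coordinate of \<open>from_coord p h\<close>. At infinity the value for
  \<open>h = 0\<close> is junk, hence statements about germs are made on punctured
  neighbourhoods.\<close>

fun affine_coord :: "proj_line \<Rightarrow> complex \<Rightarrow> complex" where
  "affine_coord (Some a) h = a + h"
| "affine_coord None h = inverse h"

text \<open>The factor dz/dh that turns a coefficient of dz into a coefficient of dh.\<close>

fun form_factor :: "proj_line \<Rightarrow> complex \<Rightarrow> complex" where
  "form_factor (Some a) h = 1"
| "form_factor None h = - 1 / h ^ 2"

lemma fun_germ_eq: "fun_germ \<phi> p h = Rep_merom_fun \<phi> (affine_coord p h)"
  by (cases p) auto

lemma form_germ_eq: "form_germ \<alpha> p h = form_factor p h * Rep_merom_form \<alpha> (affine_coord p h)"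
  by (cases p) auto

lemma eventually_nonzero_at_0: "eventually (\<lambda>h::complex. h \<noteq> 0) (at 0)"
  by (simp add: eventually_at_filter)

lemma eventually_at_shift:
  fixes a :: complex
  shows "eventually P (at a) \<longleftrightarrow> eventually (\<lambda>h. P (a + h)) (at 0)"
  by (simp add: at_to_0[of a] eventually_filtermap add.commute)

lemma affine_coord_has_derivative:
  "h \<noteq> 0 \<Longrightarrow> (affine_coord p has_field_derivative form_factor p h) (at h)"
proof (cases p)
  case None
  assume "h \<noteq> 0"
  moreover have "affine_coord None = inverse" by auto
  moreover have "(inverse has_field_derivative form_factor None h) (at h)"
    by (rule DERIV_cong[OF DERIV_inverse]) (use \<open>h \<noteq> 0\<close> in \<open>simp_all add: field_simps numeral_2_eq_2\<close>)
  ultimately show ?thesis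
    using None by simp
next
  case (Some a)
  moreover have "affine_coord (Some a) = (\<lambda>h. a + h)" by auto
  ultimately show ?thesis by (auto intro!: derivative_eq_intros)
qed

lemma eventually_affine_coord:
  assumes "\<And>z. eventually P (at z)" "eventually (\<lambda>h. P (inverse h)) (at 0)"
  shows "eventually (\<lambda>h. P (affine_coord p h)) (at 0)"
  using assms by (cases p) (simp_all flip: eventually_at_shift)

lemma eventually_analytic_affine_coord:
  assumes "f meromorphic_on UNIV" "(\<lambda>h. f (inverse h)) meromorphic_on {0}"
  shows "eventually (\<lambda>h. f analytic_on {affine_coord p h}) (at 0)"
proof (rule eventually_affine_coord)
  show "eventually (\<lambda>z. f analytic_on {z}) (at z)" for z
    using meromorphic_on_isolated_singularity[OF meromorphic_on_subset[OF assms(1)], of z]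
    by (simp add: isolated_singularity_at_altdef)
qed (rule eventually_analytic_at_infinity[OF assms])

text \<open>The operations on functions and forms are pointwise operations followed by
  \<open>remove_sings\<close>. Close to any point, infinity included, the removal changes nothing,
  so germs can be computed pointwise.\<close>

lemma eventually_remove_sings_affine_coord:
  assumes "f meromorphic_on UNIV" "(\<lambda>h. f (inverse h)) meromorphic_on {0}"
  shows "eventually (\<lambda>h. remove_sings f (affine_coord p h) = f (affine_coord p h)) (at 0)"
  using eventually_analytic_affine_coord[OF assms, of p] by eventually_elim simp

lemma Rep_merom_funD:
  "Rep_merom_fun \<phi> nicely_meromorphic_on UNIV" "Rep_merom_fun \<phi> meromorphic_on UNIV"
  "(\<lambda>h. Rep_merom_fun \<phi> (inverse h)) meromorphic_on {0}"
  using Rep_merom_fun[of \<phi>] by (auto dest: merom_fun_setD)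

lemma Rep_merom_formD:
  "Rep_merom_form \<alpha> nicely_meromorphic_on UNIV" "Rep_merom_form \<alpha> meromorphic_on UNIV"
  "(\<lambda>h. Rep_merom_form \<alpha> (inverse h)) meromorphic_on {0}"
  using Rep_merom_form[of \<alpha>] by (auto simp: merom_form_set_eq dest: merom_fun_setD)

lemmas Rep_meromD = Rep_merom_funD Rep_merom_formD

lemma fun_germ_meromorphic: "fun_germ \<phi> p meromorphic_on {0}"
proof (cases p)
  case None
  moreover have "fun_germ \<phi> None = (\<lambda>h. Rep_merom_fun \<phi> (inverse h))" by auto
  ultimately show ?thesis using Rep_merom_funD(3)[of \<phi>] by simp
next
  case (Some a)
  have "(\<lambda>h. Rep_merom_fun \<phi> (a + h)) meromorphic_on {0}"
    by (rule meromorphic_on_compose[OF Rep_merom_funD(2)]) (auto intro!: analytic_intros)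
  moreover have "fun_germ \<phi> (Some a) = (\<lambda>h. Rep_merom_fun \<phi> (a + h))" by auto
  ultimately show ?thesis using Some by simp
qed

lemma form_germ_meromorphic: "form_germ \<alpha> p meromorphic_on {0}"
proof (cases p)
  case None
  have "(\<lambda>h. - Rep_merom_form \<alpha> (inverse h) / h ^ 2) meromorphic_on {0}"
    by (intro meromorphic_intros Rep_merom_formD)
  moreover have "form_germ \<alpha> None = (\<lambda>h. - Rep_merom_form \<alpha> (inverse h) / h ^ 2)" by auto
  ultimately show ?thesis using None by simp
next
  case (Some a)
  have "(\<lambda>h. Rep_merom_form \<alpha> (a + h)) meromorphic_on {0}"
    by (rule meromorphic_on_compose[OF Rep_merom_formD(2)]) (auto intro!: analytic_intros)
  moreover have "form_germ \<alpha> (Some a) = (\<lambda>h. Rep_merom_form \<alpha> (a + h))" by auto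
  ultimately show ?thesis using Some by simp
qed

section \<open>Germs of sums, products and differentials\<close>

lift_definition mult_fun :: "merom_fun \<Rightarrow> merom_fun \<Rightarrow> merom_fun"
  is "\<lambda>f g. remove_sings (\<lambda>z. f z * g z)" by (rule merom_fun_set_ops)

lemma fun_germ_add:
  "eventually (\<lambda>h. fun_germ (\<phi> + \<psi>) p h = fun_germ \<phi> p h + fun_germ \<psi> p h) (at 0)"
proof -
  have "eventually (\<lambda>h. remove_sings (\<lambda>z. Rep_merom_fun \<phi> z + Rep_merom_fun \<psi> z) (affine_coord p h) =
      Rep_merom_fun \<phi> (affine_coord p h) + Rep_merom_fun \<psi> (affine_coord p h)) (at 0)"
    by (intro eventually_remove_sings_affine_coord meromorphic_intros Rep_meromD)
  then show ?thesis
    by eventually_elim (simp add: fun_germ_eq plus_merom_fun.rep_eq)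
qed

lemma fun_germ_diff:
  "eventually (\<lambda>h. fun_germ (\<phi> - \<psi>) p h = fun_germ \<phi> p h - fun_germ \<psi> p h) (at 0)"
proof -
  have "eventually (\<lambda>h. remove_sings (\<lambda>z. Rep_merom_fun \<phi> z - Rep_merom_fun \<psi> z) (affine_coord p h) =
      Rep_merom_fun \<phi> (affine_coord p h) - Rep_merom_fun \<psi> (affine_coord p h)) (at 0)"
    by (intro eventually_remove_sings_affine_coord meromorphic_intros Rep_meromD)
  then show ?thesis
    by eventually_elim (simp add: fun_germ_eq minus_merom_fun.rep_eq)
qed

lemma fun_germ_mult:
  "eventually (\<lambda>h. fun_germ (mult_fun \<phi> \<psi>) p h = fun_germ \<phi> p h * fun_germ \<psi> p h) (at 0)"
proof -
  have "eventually (\<lambda>h. remove_sings (\<lambda>z. Rep_merom_fun \<phi> z * Rep_merom_fun \<psi> z) (affine_coord p h) =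
      Rep_merom_fun \<phi> (affine_coord p h) * Rep_merom_fun \<psi> (affine_coord p h)) (at 0)"
    by (intro eventually_remove_sings_affine_coord meromorphic_intros Rep_meromD)
  then show ?thesis
    by eventually_elim (simp add: fun_germ_eq mult_fun.rep_eq)
qed

lemma form_germ_add:
  "eventually (\<lambda>h. form_germ (\<alpha> + \<beta>) p h = form_germ \<alpha> p h + form_germ \<beta> p h) (at 0)"
proof -
  have "eventually (\<lambda>h. remove_sings (\<lambda>z. Rep_merom_form \<alpha> z + Rep_merom_form \<beta> z) (affine_coord p h) =
      Rep_merom_form \<alpha> (affine_coord p h) + Rep_merom_form \<beta> (affine_coord p h)) (at 0)"
    by (intro eventually_remove_sings_affine_coord meromorphic_intros Rep_meromD)
  then show ?thesis
    by eventually_elim (simp add: form_germ_eq plus_merom_form.rep_eq algebra_simps)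
qed

lemma form_germ_scale:
  "eventually (\<lambda>h. form_germ (scale_form c \<alpha>) p h = c * form_germ \<alpha> p h) (at 0)"
proof -
  have "eventually (\<lambda>h. remove_sings (\<lambda>z. c * Rep_merom_form \<alpha> z) (affine_coord p h) =
      c * Rep_merom_form \<alpha> (affine_coord p h)) (at 0)"
    by (intro eventually_remove_sings_affine_coord meromorphic_intros Rep_meromD)
  then show ?thesis
    by eventually_elim (simp add: form_germ_eq scale_form.rep_eq)
qed

lemma form_germ_mult:
  "eventually (\<lambda>h. form_germ (mult_form \<phi> \<alpha>) p h = fun_germ \<phi> p h * form_germ \<alpha> p h) (at 0)"
proof -
  have "eventually (\<lambda>h. remove_sings (\<lambda>z. Rep_merom_fun \<phi> z * Rep_merom_form \<alpha> z) (affine_coord p h) =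
      Rep_merom_fun \<phi> (affine_coord p h) * Rep_merom_form \<alpha> (affine_coord p h)) (at 0)"
    by (intro eventually_remove_sings_affine_coord meromorphic_intros Rep_meromD)
  then show ?thesis
    by eventually_elim (simp add: fun_germ_eq form_germ_eq mult_form.rep_eq)
qed

text \<open>The differential is independent of the chart: the chain rule supplies the factor dz/dh
  by which the coefficient of a form changes.\<close>

lemma form_germ_ext_d:
  "eventually (\<lambda>h. form_germ (ext_d \<phi>) p h = deriv (fun_germ \<phi> p) h) (at 0)"
  using eventually_analytic_affine_coord[OF Rep_merom_funD(2,3), of \<phi> p] eventually_nonzero_at_0
proof eventually_elim
  case (elim h)
  let ?f = "Rep_merom_fun \<phi>"
  have "(?f has_field_derivative deriv ?f (affine_coord p h)) (at (affine_coord p h))"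
    using elim(1) by (simp add: analytic_on_imp_differentiable_at DERIV_deriv_iff_field_differentiable)
  from DERIV_chain2[OF this affine_coord_has_derivative[OF elim(2)]]
  have "((\<lambda>h. ?f (affine_coord p h)) has_field_derivative deriv ?f (affine_coord p h) * form_factor p h) (at h)" .
  moreover have "(\<lambda>h. ?f (affine_coord p h)) = fun_germ \<phi> p"
    by (simp add: fun_eq_iff fun_germ_eq)
  ultimately have "deriv (fun_germ \<phi> p) h = deriv ?f (affine_coord p h) * form_factor p h"
    by (simp add: DERIV_imp_deriv)
  moreover have "deriv ?f analytic_on {affine_coord p h}"
    using elim(1) by (rule analytic_deriv)
  ultimately show ?case
    by (simp add: form_germ_eq ext_d.rep_eq)
qed

text \<open>Normalised representatives are fixed by \<open>remove_sings\<close>, whose value at a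
  point depends only on the punctured germ there. A form is thus determined by its germs at finite
  points.\<close>

lemma merom_form_eqI:
  assumes "\<And>a. eventually (\<lambda>h. form_germ \<alpha> (Some a) h = form_germ \<beta> (Some a) h) (at 0)"
  shows "\<alpha> = \<beta>"
proof -
  have "remove_sings (Rep_merom_form \<alpha>) = remove_sings (Rep_merom_form \<beta>)"
    by (rule remove_sings_eqI_at) (subst eventually_at_shift, use assms in simp)
  then show ?thesis
    using Rep_merom_form by (metis Rep_merom_form_inject remove_sings_merom_fun merom_form_set_eq)
qed

lemma mult_form_add_right: "mult_form \<phi> (\<alpha> + \<beta>) = mult_form \<phi> \<alpha> + mult_form \<phi> \<beta>"
proof (rule merom_form_eqI)
  fix a
  show "eventually (\<lambda>h. form_germ (mult_form \<phi> (\<alpha> + \<beta>)) (Some a) h =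
      form_germ (mult_form \<phi> \<alpha> + mult_form \<phi> \<beta>) (Some a) h) (at 0)"
    using form_germ_mult[of \<phi> "\<alpha> + \<beta>" "Some a"] form_germ_add[of \<alpha> \<beta> "Some a"]
      form_germ_mult[of \<phi> \<alpha> "Some a"] form_germ_mult[of \<phi> \<beta> "Some a"]
      form_germ_add[of "mult_form \<phi> \<alpha>" "mult_form \<phi> \<beta>" "Some a"]
    by eventually_elim (simp only: distrib_left)
qed

lemma mult_form_add_left: "mult_form (\<phi> + \<psi>) \<alpha> = mult_form \<phi> \<alpha> + mult_form \<psi> \<alpha>"
proof (rule merom_form_eqI)
  fix a
  show "eventually (\<lambda>h. form_germ (mult_form (\<phi> + \<psi>) \<alpha>) (Some a) h =
      form_germ (mult_form \<phi> \<alpha> + mult_form \<psi> \<alpha>) (Some a) h) (at 0)"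
    using form_germ_mult[of "\<phi> + \<psi>" \<alpha> "Some a"] fun_germ_add[of \<phi> \<psi> "Some a"]
      form_germ_mult[of \<phi> \<alpha> "Some a"] form_germ_mult[of \<psi> \<alpha> "Some a"]
      form_germ_add[of "mult_form \<phi> \<alpha>" "mult_form \<psi> \<alpha>" "Some a"]
    by eventually_elim (simp only: distrib_right)
qed

lemma mult_form_scale: "mult_form \<phi> (scale_form c \<alpha>) = scale_form c (mult_form \<phi> \<alpha>)"
proof (rule merom_form_eqI)
  fix a
  show "eventually (\<lambda>h. form_germ (mult_form \<phi> (scale_form c \<alpha>)) (Some a) h =
      form_germ (scale_form c (mult_form \<phi> \<alpha>)) (Some a) h) (at 0)"
    using form_germ_mult[of \<phi> "scale_form c \<alpha>" "Some a"] form_germ_scale[of c \<alpha> "Some a"]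
      form_germ_mult[of \<phi> \<alpha> "Some a"] form_germ_scale[of c "mult_form \<phi> \<alpha>" "Some a"]
    by eventually_elim (simp only: mult.left_commute)
qed

lemma eventually_analytic_germ:
  "f meromorphic_on {0} \<Longrightarrow> eventually (\<lambda>h. f analytic_on {h}) (at 0)"
  using meromorphic_on_isolated_singularity[of f 0] by (simp add: isolated_singularity_at_altdef)

text \<open>A punctured neighbourhood is open, so each of its points has a full neighbourhood on
  which the two functions agree.\<close>

lemma deriv_cong_at:
  assumes "eventually (\<lambda>h. f h = g h) (at (0::complex))"
  shows "eventually (\<lambda>h. deriv f h = deriv g h) (at 0)"
proof -
  obtain A where A: "open A" "0 \<in> A" "\<And>h. h \<in> A - {0} \<Longrightarrow> f h = g h"
    using assms by (subst (asm) eventually_at_topological) blast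
  have "eventually (\<lambda>h. h \<in> A - {0}) (at 0)"
    using A by (intro eventually_at_in_open) auto
  then show ?thesis
  proof eventually_elim
    case (elim h)
    have "eventually (\<lambda>x. x \<in> A - {0}) (nhds h)"
      using A(1) elim by (intro eventually_nhds_in_open) auto
    then have "eventually (\<lambda>x. f x = g x) (nhds h)"
      by eventually_elim (use A(3) in auto)
    then show ?case by (rule deriv_cong_ev) simp
  qed
qed

lemma ext_d_add: "ext_d (\<phi> + \<psi>) = ext_d \<phi> + ext_d \<psi>"
proof (rule merom_form_eqI)
  fix a
  show "eventually (\<lambda>h. form_germ (ext_d (\<phi> + \<psi>)) (Some a) h =
      form_germ (ext_d \<phi> + ext_d \<psi>) (Some a) h) (at 0)"
    using form_germ_ext_d[of "\<phi> + \<psi>" "Some a"] deriv_cong_at[OF fun_germ_add[of \<phi> \<psi> "Some a"]]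
      form_germ_ext_d[of \<phi> "Some a"] form_germ_ext_d[of \<psi> "Some a"]
      form_germ_add[of "ext_d \<phi>" "ext_d \<psi>" "Some a"]
      eventually_analytic_germ[OF fun_germ_meromorphic[of \<phi> "Some a"]]
      eventually_analytic_germ[OF fun_germ_meromorphic[of \<psi> "Some a"]]
    by eventually_elim (simp only: deriv_add analytic_on_imp_differentiable_at[OF _ singletonI])
qed

lemma ext_d_mult: "ext_d (mult_fun \<phi> \<psi>) = mult_form \<phi> (ext_d \<psi>) + mult_form \<psi> (ext_d \<phi>)"
proof (rule merom_form_eqI)
  fix a
  show "eventually (\<lambda>h. form_germ (ext_d (mult_fun \<phi> \<psi>)) (Some a) h =
      form_germ (mult_form \<phi> (ext_d \<psi>) + mult_form \<psi> (ext_d \<phi>)) (Some a) h) (at 0)"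
    using form_germ_ext_d[of "mult_fun \<phi> \<psi>" "Some a"] deriv_cong_at[OF fun_germ_mult[of \<phi> \<psi> "Some a"]]
      form_germ_ext_d[of \<phi> "Some a"] form_germ_ext_d[of \<psi> "Some a"]
      form_germ_mult[of \<phi> "ext_d \<psi>" "Some a"] form_germ_mult[of \<psi> "ext_d \<phi>" "Some a"]
      form_germ_add[of "mult_form \<phi> (ext_d \<psi>)" "mult_form \<psi> (ext_d \<phi>)" "Some a"]
      eventually_analytic_germ[OF fun_germ_meromorphic[of \<phi> "Some a"]]
      eventually_analytic_germ[OF fun_germ_meromorphic[of \<psi> "Some a"]]
    by eventually_elim
       (simp only: deriv_mult analytic_on_imp_differentiable_at[OF _ singletonI] mult.commute)
qed

text \<open>A germ may have a junk value at 0, so regularity is expressed by an analytic function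
  that agrees with it away from 0. Meromorphy excludes essential singularities, leaving a removable
  one.\<close>

lemma not_pole_iff_analytic:
  assumes "f meromorphic_on {0}"
  shows "\<not> is_pole f 0 \<longleftrightarrow> (\<exists>k. k analytic_on {0} \<and> eventually (\<lambda>h. f h = k h) (at 0))"
proof
  assume "\<not> is_pole f 0"
  moreover have "isolated_singularity_at f 0" "not_essential f 0"
    using assms by (simp_all add: meromorphic_at_iff)
  ultimately obtain c where "f \<midarrow>0\<rightarrow> c"
    by (auto simp: not_essential_def)
  with \<open>isolated_singularity_at f 0\<close> have "remove_sings f analytic_on {0}"
    by (rule remove_sings_analytic_at)
  moreover have "eventually (\<lambda>h. f h = remove_sings f h) (at 0)"
    using eventually_remove_sings_eq_at[OF \<open>isolated_singularity_at f 0\<close>] by eventually_elim simp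
  ultimately show "\<exists>k. k analytic_on {0} \<and> eventually (\<lambda>h. f h = k h) (at 0)" by blast
next
  assume "\<exists>k. k analytic_on {0} \<and> eventually (\<lambda>h. f h = k h) (at 0)"
  then obtain k where k: "k analytic_on {0}" "eventually (\<lambda>h. f h = k h) (at 0)" by blast
  have "\<not> is_pole k 0"
    using k(1) analytic_at_imp_no_pole by blast
  then show "\<not> is_pole f 0"
    using is_pole_cong[OF k(2) refl] by simp
qed

lemma fun_regular_at_iff:
  "\<not> is_pole (fun_germ \<phi> p) 0 \<longleftrightarrow> (\<exists>k. k analytic_on {0} \<and> eventually (\<lambda>h. fun_germ \<phi> p h = k h) (at 0))"
  by (rule not_pole_iff_analytic[OF fun_germ_meromorphic])

lemma form_regular_at_iff:
  "\<not> is_pole (form_germ \<alpha> p) 0 \<longleftrightarrow> (\<exists>k. k analytic_on {0} \<and> eventually (\<lambda>h. form_germ \<alpha> p h = k h) (at 0))"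
  by (rule not_pole_iff_analytic[OF form_germ_meromorphic])

lemma regular_onE:
  "fun_regular_on \<phi> S \<Longrightarrow> p \<in> S \<Longrightarrow> \<exists>k. k analytic_on {0} \<and> eventually (\<lambda>h. fun_germ \<phi> p h = k h) (at 0)"
  "form_regular_on \<alpha> S \<Longrightarrow> p \<in> S \<Longrightarrow> \<exists>k. k analytic_on {0} \<and> eventually (\<lambda>h. form_germ \<alpha> p h = k h) (at 0)"
  unfolding fun_regular_on_def form_regular_on_def fun_regular_at_iff form_regular_at_iff by blast+

lemma fun_regular_on_subset: "fun_regular_on \<phi> S \<Longrightarrow> T \<subseteq> S \<Longrightarrow> fun_regular_on \<phi> T"
  by (auto simp: fun_regular_on_def)

lemma form_regular_on_subset: "form_regular_on \<alpha> S \<Longrightarrow> T \<subseteq> S \<Longrightarrow> form_regular_on \<alpha> T"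
  by (auto simp: form_regular_on_def)

lemma fun_regular_on_add:
  assumes "fun_regular_on \<phi> S" "fun_regular_on \<psi> S"
  shows "fun_regular_on (\<phi> + \<psi>) S"
  unfolding fun_regular_on_def
proof
  fix p assume "p \<in> S"
  then obtain k l where k: "k analytic_on {0}" "eventually (\<lambda>h. fun_germ \<phi> p h = k h) (at 0)"
    and l: "l analytic_on {0}" "eventually (\<lambda>h. fun_germ \<psi> p h = l h) (at 0)"
    using assms by (metis regular_onE)
  have "eventually (\<lambda>h. fun_germ (\<phi> + \<psi>) p h = k h + l h) (at 0)"
    using fun_germ_add[of \<phi> \<psi> p] k(2) l(2) by eventually_elim simp
  then show "\<not> is_pole (fun_germ (\<phi> + \<psi>) p) 0"
    unfolding fun_regular_at_iff using k l by (intro exI[of _ "\<lambda>h. k h + l h"]) (auto intro: analytic_intros)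
qed

lemma fun_regular_on_diff:
  assumes "fun_regular_on \<phi> S" "fun_regular_on \<psi> S"
  shows "fun_regular_on (\<phi> - \<psi>) S"
  unfolding fun_regular_on_def
proof
  fix p assume "p \<in> S"
  then obtain k l where k: "k analytic_on {0}" "eventually (\<lambda>h. fun_germ \<phi> p h = k h) (at 0)"
    and l: "l analytic_on {0}" "eventually (\<lambda>h. fun_germ \<psi> p h = l h) (at 0)"
    using assms by (metis regular_onE)
  have "eventually (\<lambda>h. fun_germ (\<phi> - \<psi>) p h = k h - l h) (at 0)"
    using fun_germ_diff[of \<phi> \<psi> p] k(2) l(2) by eventually_elim simp
  then show "\<not> is_pole (fun_germ (\<phi> - \<psi>) p) 0"
    unfolding fun_regular_at_iff using k l by (intro exI[of _ "\<lambda>h. k h - l h"]) (auto intro: analytic_intros)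
qed

lemma fun_regular_on_mult:
  assumes "fun_regular_on \<phi> S" "fun_regular_on \<psi> S"
  shows "fun_regular_on (mult_fun \<phi> \<psi>) S"
  unfolding fun_regular_on_def
proof
  fix p assume "p \<in> S"
  then obtain k l where k: "k analytic_on {0}" "eventually (\<lambda>h. fun_germ \<phi> p h = k h) (at 0)"
    and l: "l analytic_on {0}" "eventually (\<lambda>h. fun_germ \<psi> p h = l h) (at 0)"
    using assms by (metis regular_onE)
  have "eventually (\<lambda>h. fun_germ (mult_fun \<phi> \<psi>) p h = k h * l h) (at 0)"
    using fun_germ_mult[of \<phi> \<psi> p] k(2) l(2) by eventually_elim simp
  then show "\<not> is_pole (fun_germ (mult_fun \<phi> \<psi>) p) 0"
    unfolding fun_regular_at_iff using k l by (intro exI[of _ "\<lambda>h. k h * l h"]) (auto intro: analytic_intros)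
qed

lemma form_regular_on_add:
  assumes "form_regular_on \<alpha> S" "form_regular_on \<beta> S"
  shows "form_regular_on (\<alpha> + \<beta>) S"
  unfolding form_regular_on_def
proof
  fix p assume "p \<in> S"
  then obtain k l where k: "k analytic_on {0}" "eventually (\<lambda>h. form_germ \<alpha> p h = k h) (at 0)"
    and l: "l analytic_on {0}" "eventually (\<lambda>h. form_germ \<beta> p h = l h) (at 0)"
    using assms by (metis regular_onE)
  have "eventually (\<lambda>h. form_germ (\<alpha> + \<beta>) p h = k h + l h) (at 0)"
    using form_germ_add[of \<alpha> \<beta> p] k(2) l(2) by eventually_elim simp
  then show "\<not> is_pole (form_germ (\<alpha> + \<beta>) p) 0"
    unfolding form_regular_at_iff using k l by (intro exI[of _ "\<lambda>h. k h + l h"]) (auto intro: analytic_intros)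
qed

lemma form_regular_on_scale:
  assumes "form_regular_on \<alpha> S"
  shows "form_regular_on (scale_form c \<alpha>) S"
  unfolding form_regular_on_def
proof
  fix p assume "p \<in> S"
  then obtain k where k: "k analytic_on {0}" "eventually (\<lambda>h. form_germ \<alpha> p h = k h) (at 0)"
    using assms by (metis regular_onE)
  have "eventually (\<lambda>h. form_germ (scale_form c \<alpha>) p h = c * k h) (at 0)"
    using form_germ_scale[of c \<alpha> p] k(2) by eventually_elim simp
  then show "\<not> is_pole (form_germ (scale_form c \<alpha>) p) 0"
    unfolding form_regular_at_iff using k by (intro exI[of _ "\<lambda>h. c * k h"]) (auto intro: analytic_intros)
qed

lemma form_regular_on_mult:
  assumes "fun_regular_on \<phi> S" "form_regular_on \<alpha> S"
  shows "form_regular_on (mult_form \<phi> \<alpha>) S"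
  unfolding form_regular_on_def
proof
  fix p assume "p \<in> S"
  then obtain k l where k: "k analytic_on {0}" "eventually (\<lambda>h. fun_germ \<phi> p h = k h) (at 0)"
    and l: "l analytic_on {0}" "eventually (\<lambda>h. form_germ \<alpha> p h = l h) (at 0)"
    using assms by (metis regular_onE)
  have "eventually (\<lambda>h. form_germ (mult_form \<phi> \<alpha>) p h = k h * l h) (at 0)"
    using form_germ_mult[of \<phi> \<alpha> p] k(2) l(2) by eventually_elim simp
  then show "\<not> is_pole (form_germ (mult_form \<phi> \<alpha>) p) 0"
    unfolding form_regular_at_iff using k l by (intro exI[of _ "\<lambda>h. k h * l h"]) (auto intro: analytic_intros)
qed

lemma form_regular_on_ext_d:
  assumes "fun_regular_on \<phi> S"
  shows "form_regular_on (ext_d \<phi>) S"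
  unfolding form_regular_on_def
proof
  fix p assume "p \<in> S"
  then obtain k where k: "k analytic_on {0}" "eventually (\<lambda>h. fun_germ \<phi> p h = k h) (at 0)"
    using assms by (metis regular_onE)
  have "eventually (\<lambda>h. form_germ (ext_d \<phi>) p h = deriv k h) (at 0)"
    using form_germ_ext_d[of \<phi> p] deriv_cong_at[OF k(2)] by eventually_elim simp
  then show "\<not> is_pole (form_germ (ext_d \<phi>) p) 0"
    unfolding form_regular_at_iff using k by (intro exI[of _ "deriv k"]) (auto intro: analytic_deriv)
qed

lemma fun_regular_on_zero: "fun_regular_on 0 S"
  unfolding fun_regular_on_def fun_regular_at_iff
  by (auto simp: fun_germ_eq zero_merom_fun.rep_eq intro!: exI[of _ "\<lambda>_. 0"])

lemma form_regular_on_zero: "form_regular_on 0 S"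
  unfolding form_regular_on_def form_regular_at_iff
  by (auto simp: form_germ_eq zero_merom_form.rep_eq intro!: exI[of _ "\<lambda>_. 0"])

section \<open>Residues as Laurent coefficients\<close>

lemma germ_has_laurent_expansion:
  assumes "f meromorphic_on {0}"
  obtains F where "f has_laurent_expansion F"
  using assms by (auto simp: meromorphic_on_def)

lemma Res_add: "Res p (\<alpha> + \<beta>) = Res p \<alpha> + Res p \<beta>"
proof -
  obtain F where F: "form_germ \<alpha> p has_laurent_expansion F"
    by (rule germ_has_laurent_expansion[OF form_germ_meromorphic])
  obtain G where G: "form_germ \<beta> p has_laurent_expansion G"
    by (rule germ_has_laurent_expansion[OF form_germ_meromorphic])
  have "form_germ (\<alpha> + \<beta>) p has_laurent_expansion F + G"
    using has_laurent_expansion_add[OF F G] has_laurent_expansion_cong[OF form_germ_add[of \<alpha> \<beta> p] refl]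
    by blast
  then show ?thesis
    using F G by (simp add: Res_def has_laurent_expansion_residue_0)
qed

lemma Res_scale: "Res p (scale_form c \<alpha>) = c * Res p \<alpha>"
proof -
  obtain F where F: "form_germ \<alpha> p has_laurent_expansion F"
    by (rule germ_has_laurent_expansion[OF form_germ_meromorphic])
  have "form_germ (scale_form c \<alpha>) p has_laurent_expansion fls_const c * F"
    using has_laurent_expansion_cmult_left[OF F] has_laurent_expansion_cong[OF form_germ_scale[of c \<alpha> p] refl]
    by blast
  then show ?thesis
    using F by (simp add: Res_def has_laurent_expansion_residue_0)
qed

text \<open>The derivative of a Laurent series has no term of exponent -1.\<close>

lemma Res_ext_d: "Res p (ext_d \<phi>) = 0"
proof -
  obtain F where F: "fun_germ \<phi> p has_laurent_expansion F"
    by (rule germ_has_laurent_expansion[OF fun_germ_meromorphic])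
  have "form_germ (ext_d \<phi>) p has_laurent_expansion fls_deriv F"
    using has_laurent_expansion_deriv[OF F] has_laurent_expansion_cong[OF form_germ_ext_d[of \<phi> p] refl]
    by blast
  then show ?thesis
    by (simp add: Res_def has_laurent_expansion_residue_0)
qed

lemma Res_regular:
  assumes "form_regular_on \<alpha> {p}"
  shows "Res p \<alpha> = 0"
proof -
  obtain k where k: "k analytic_on {0}" "eventually (\<lambda>h. form_germ \<alpha> p h = k h) (at 0)"
    using regular_onE(2)[OF assms singletonI] by blast
  obtain A where "open A" "0 \<in> A" "k holomorphic_on A"
    using k(1) by (auto simp: analytic_at)
  then have "residue k 0 = 0"
    by (intro residue_holo)
  then show ?thesis
    using residue_cong[OF k(2) refl] by (simp add: Res_def)
qed

lemma ext_d_in_K_forms: "ext_d \<phi> \<in> K_forms"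
  by (simp add: K_forms_def Res_ext_d)

lemma zero_in_K_forms: "0 \<in> K_forms"
  by (simp add: K_forms_def Res_regular form_regular_on_zero)

lemma K_forms_closed:
  "\<alpha> \<in> K_forms \<Longrightarrow> \<beta> \<in> K_forms \<Longrightarrow> \<alpha> + \<beta> \<in> K_forms"
  "\<alpha> \<in> K_forms \<Longrightarrow> scale_form c \<alpha> \<in> K_forms"
  by (simp_all add: K_forms_def Res_add Res_scale)

section \<open>Partial fractions and coordinates with a prescribed pole\<close>

text \<open>The integral over a small circle is the residue up to a factor, and it vanishes for a
  function with a primitive on the punctured neighbourhood.\<close>

lemma residue_primitive:
  assumes "open S" "z \<in> S" and G: "\<And>w. w \<in> S - {z} \<Longrightarrow> (G has_field_derivative f w) (at w)"
    and f: "f holomorphic_on S - {z}"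
  shows "residue f z = 0"
proof -
  obtain r where r: "r > 0" "cball z r \<subseteq> S"
    using assms(1,2) by (auto simp: open_contains_cball_eq)
  have "(f has_contour_integral 2 * pi * \<i> * residue f z) (circlepath z r)"
    using assms(1,2) f r by (intro base_residue) auto
  moreover have "(f has_contour_integral 0) (circlepath z r)"
  proof (rule Cauchy_theorem_primitive)
    show "path_image (circlepath z r) \<subseteq> S - {z}" using r by auto
    show "(G has_field_derivative f w) (at w within S - {z})" if "w \<in> S - {z}" for w
      using G[OF that] by (rule has_field_derivative_at_within)
  qed auto
  ultimately show ?thesis
    by (auto dest: has_contour_integral_unique)
qed

lemma pole_order_bound:
  assumes "f meromorphic_on {0}"
  obtains n k where "k analytic_on {0}" "eventually (\<lambda>h. f h = k h / h ^ n) (at 0)"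
proof -
  obtain F where F: "f has_laurent_expansion F"
    by (rule germ_has_laurent_expansion[OF assms])
  \<comment> \<open>\<open>nat\<close> cuts the order off at 0 when there is no pole.\<close>
  define n where "n = nat (- fls_subdegree F)"
  have L: "(\<lambda>h. h ^ n * f h) has_laurent_expansion fls_X ^ n * F"
    by (intro laurent_expansion_intros F)
  have "\<not> is_pole (\<lambda>h. h ^ n * f h) 0"
  proof
    assume "is_pole (\<lambda>h. h ^ n * f h) 0"
    then have "fls_subdegree (fls_X ^ n * F) < 0"
      using L by (intro is_pole_imp_neg_fls_subdegree[of _ 0]) auto
    moreover from this have "F \<noteq> 0" by auto
    ultimately show False
      by (simp add: n_def fls_subdegree_pow split: if_splits)
  qed
  moreover have "(\<lambda>h. h ^ n * f h) meromorphic_on {0}"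
    by (intro meromorphic_intros assms)
  ultimately obtain k where k: "k analytic_on {0}" "eventually (\<lambda>h. h ^ n * f h = k h) (at 0)"
    using not_pole_iff_analytic by blast
  have "eventually (\<lambda>h. f h = k h / h ^ n) (at 0)"
    using k(2) eventually_nonzero_at_0 by eventually_elim (auto simp: field_simps)
  with k(1) show thesis by (rule that)
qed

lemma analytic_split_constant:
  assumes "k analytic_on {0}"
  obtains l where "l analytic_on {0}" "eventually (\<lambda>h. k h = k 0 + h * l h) (at 0)"
proof -
  let ?q = "\<lambda>h. (k h - k 0) / h"
  have "(k has_field_derivative deriv k 0) (at 0)"
    using assms by (simp add: analytic_on_imp_differentiable_at DERIV_deriv_iff_field_differentiable)
  then have "?q \<midarrow>0\<rightarrow> deriv k 0"
    by (simp add: has_field_derivative_iff)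
  then have "\<not> is_pole ?q 0"
    unfolding is_pole_def using not_tendsto_and_filterlim_at_infinity[of "at (0::complex)"] by auto
  moreover have "?q meromorphic_on {0}"
    by (intro meromorphic_intros analytic_on_imp_meromorphic_on assms)
  ultimately obtain l where l: "l analytic_on {0}" "eventually (\<lambda>h. ?q h = l h) (at 0)"
    using not_pole_iff_analytic by blast
  have "eventually (\<lambda>h. k h = k 0 + h * l h) (at 0)"
    using l(2) eventually_nonzero_at_0 by eventually_elim (auto simp: field_simps)
  with l(1) show thesis by (rule that)
qed

text \<open>This is \<open>c / h ^ n\<close> for the coordinate \<open>h\<close> centred at
  \<open>p\<close>, rewritten in the affine coordinate \<open>z\<close>.\<close>

definition pole_monomial_rep :: "proj_line \<Rightarrow> nat \<Rightarrow> complex \<Rightarrow> complex \<Rightarrow> complex" where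
  "pole_monomial_rep p n c z = c * (case p of None \<Rightarrow> z | Some a \<Rightarrow> inverse (z - a)) ^ n"

lemma pole_monomial_rep_meromorphic:
  "pole_monomial_rep p n c meromorphic_on UNIV"
  "(\<lambda>h. pole_monomial_rep p n c (inverse h)) meromorphic_on {0}"
  unfolding pole_monomial_rep_def by (cases p; simp; intro meromorphic_intros)+

definition pole_monomial :: "proj_line \<Rightarrow> nat \<Rightarrow> complex \<Rightarrow> merom_fun" where
  "pole_monomial p n c = Abs_merom_fun (remove_sings (pole_monomial_rep p n c))"

lemma fun_germ_pole_monomial:
  "eventually (\<lambda>h. fun_germ (pole_monomial p n c) q h = pole_monomial_rep p n c (affine_coord q h)) (at 0)"
proof -
  have "Rep_merom_fun (pole_monomial p n c) = remove_sings (pole_monomial_rep p n c)"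
    unfolding pole_monomial_def
    by (intro Abs_merom_fun_inverse remove_sings_in_merom_fun_set pole_monomial_rep_meromorphic)
  with eventually_remove_sings_affine_coord[OF pole_monomial_rep_meromorphic, of p n c q]
  show ?thesis by (simp add: fun_germ_eq)
qed

lemma fun_germ_pole_monomial_centre:
  "eventually (\<lambda>h. fun_germ (pole_monomial p n c) p h = c / h ^ n) (at 0)"
  using fun_germ_pole_monomial[of p n c p]
  by eventually_elim (cases p; simp add: pole_monomial_rep_def field_simps)

lemma pole_monomial_regular: "fun_regular_on (pole_monomial p n c) (- {p})"
  unfolding fun_regular_on_def
proof
  fix q assume "q \<in> - {p}"
  then have "q \<noteq> p" by simp
  have "\<exists>k. k analytic_on {0} \<and>
      eventually (\<lambda>h. pole_monomial_rep p n c (affine_coord q h) = k h) (at 0)"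
  proof (cases p)
    case None
    then obtain z where "q = Some z" using \<open>q \<noteq> p\<close> by (cases q) auto
    with None show ?thesis
      by (intro exI[of _ "\<lambda>h. c * (z + h) ^ n"]) (auto simp: pole_monomial_rep_def intro!: analytic_intros)
  next
    case p: (Some a)
    show ?thesis
    proof (cases q)
      case (Some z)
      then show ?thesis
        using p \<open>q \<noteq> p\<close>
        by (intro exI[of _ "\<lambda>h. c * inverse (z + h - a) ^ n"])
           (auto simp: pole_monomial_rep_def intro!: analytic_intros)
    next
      case None
      \<comment> \<open>With \<open>z = 1 / h\<close>, the function \<open>1 / (z - a)\<close>
        becomes \<open>h / (1 - a * h)\<close>, which is analytic at \<open>h = 0\<close>.\<close>
      have "eventually (\<lambda>h. pole_monomial_rep p n c (affine_coord q h) = c * (h / (1 - a * h)) ^ n) (at 0)"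
        using eventually_nonzero_at_0
        by eventually_elim (simp add: pole_monomial_rep_def p None field_simps)
      then show ?thesis
        by (intro exI[of _ "\<lambda>h. c * (h / (1 - a * h)) ^ n"]) (auto intro!: analytic_intros)
    qed
  qed
  then obtain k where k: "k analytic_on {0}"
      "eventually (\<lambda>h. pole_monomial_rep p n c (affine_coord q h) = k h) (at 0)"
    by blast
  from fun_germ_pole_monomial[of p n c q] k(2)
  have "eventually (\<lambda>h. fun_germ (pole_monomial p n c) q h = k h) (at 0)"
    by eventually_elim simp
  with k(1) show "\<not> is_pole (fun_germ (pole_monomial p n c) q) 0"
    unfolding fun_regular_at_iff by blast
qed

text \<open>Induction on a bound for the pole order: subtracting the leading term, a global function
  with its only possible pole at \<open>p\<close>, lowers the bound by one.\<close>

lemma principal_part_exists: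
  "\<exists>\<sigma>. fun_regular_on \<sigma> (- {p}) \<and> fun_regular_on (\<phi> - \<sigma>) {p}"
proof -
  have *: "\<exists>\<sigma>. fun_regular_on \<sigma> (- {p}) \<and> fun_regular_on (\<phi> - \<sigma>) {p}"
    if "k analytic_on {0}" "eventually (\<lambda>h. fun_germ \<phi> p h = k h / h ^ n) (at 0)" for n k \<phi>
    using that
  proof (induction n arbitrary: k \<phi>)
    case 0
    then have "fun_regular_on \<phi> {p}"
      by (auto simp: fun_regular_on_def fun_regular_at_iff)
    then show ?case
      by (intro exI[of _ 0]) (simp add: fun_regular_on_zero)
  next
    case (Suc n)
    obtain l where l: "l analytic_on {0}" "eventually (\<lambda>h. k h = k 0 + h * l h) (at 0)"
      by (rule analytic_split_constant[OF Suc.prems(1)])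
    define \<mu> where "\<mu> = pole_monomial p (Suc n) (k 0)"
    have "eventually (\<lambda>h. fun_germ (\<phi> - \<mu>) p h = l h / h ^ n) (at 0)"
      using fun_germ_diff[of \<phi> \<mu> p] Suc.prems(2) l(2) eventually_nonzero_at_0
        fun_germ_pole_monomial_centre[of p "Suc n" "k 0"]
      by eventually_elim (simp add: \<mu>_def add_divide_distrib)
    from Suc.IH[OF l(1) this] obtain \<sigma> where "fun_regular_on \<sigma> (- {p})" "fun_regular_on (\<phi> - \<mu> - \<sigma>) {p}"
      by blast
    then have "fun_regular_on (\<mu> + \<sigma>) (- {p})" "fun_regular_on (\<phi> - (\<mu> + \<sigma>)) {p}"
      by (simp_all add: fun_regular_on_add pole_monomial_regular \<mu>_def algebra_simps)
    then show ?case by blast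
  qed
  obtain n k where "k analytic_on {0}" "eventually (\<lambda>h. fun_germ \<phi> p h = k h / h ^ n) (at 0)"
    by (rule pole_order_bound[OF fun_germ_meromorphic])
  then show ?thesis by (rule *)
qed

text \<open>Compactness of the sphere: a punctured neighbourhood of infinity is free of poles, and
  in the remaining closed ball the singularities are sparse.\<close>

lemma finite_poles: "finite {p. is_pole (fun_germ \<phi> p) 0}"
proof -
  let ?f = "Rep_merom_fun \<phi>"
  have "eventually (\<lambda>h. ?f analytic_on {inverse h}) (at 0)"
    by (rule eventually_analytic_at_infinity[OF Rep_merom_funD(2,3)])
  then obtain d where d: "d > 0" "\<And>h. h \<noteq> 0 \<Longrightarrow> dist h 0 < d \<Longrightarrow> ?f analytic_on {inverse h}"
    by (auto simp: eventually_at)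
  have "{z. is_pole ?f z} \<subseteq> {z \<in> cball 0 (inverse d). \<not> ?f analytic_on {z}}"
  proof
    fix z assume "z \<in> {z. is_pole ?f z}"
    then have z: "\<not> ?f analytic_on {z}"
      using analytic_at_imp_no_pole by blast
    moreover have "norm z \<le> inverse d"
    proof (rule ccontr)
      assume "\<not> norm z \<le> inverse d"
      then have *: "inverse d < norm z" by simp
      then have "z \<noteq> 0" using d(1) by auto
      moreover have "norm (inverse z) < d"
        using less_imp_inverse_less[OF *] d(1) by (simp add: norm_inverse)
      ultimately show False
        using d(2)[of "inverse z"] z by simp
    qed
    ultimately show "z \<in> {z \<in> cball 0 (inverse d). \<not> ?f analytic_on {z}}" by simp
  qed
  moreover have "finite {z \<in> cball 0 (inverse d). \<not> ?f analytic_on {z}}"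
  proof -
    have "finite (cball 0 (inverse d) \<inter> {z \<in> cball 0 (inverse d). \<not> ?f analytic_on {z}})"
      by (intro sparse_in_compact_finite meromorphic_on_imp_sparse_singularities'
          meromorphic_on_subset[OF Rep_merom_funD(2)]) auto
    then show ?thesis by (rule rev_finite_subset) auto
  qed
  ultimately have "finite {z. is_pole ?f z}"
    by (rule finite_subset)
  moreover have "{p. is_pole (fun_germ \<phi> p) 0} \<subseteq> insert None (Some ` {z. is_pole ?f z})"
  proof
    fix p assume p: "p \<in> {p. is_pole (fun_germ \<phi> p) 0}"
    show "p \<in> insert None (Some ` {z. is_pole ?f z})"
    proof (cases p)
      case (Some a)
      then have "fun_germ \<phi> p = (\<lambda>h. ?f (a + h))" by auto
      then show ?thesis using p Some is_pole_shift_0[of ?f a] by auto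
    qed simp
  qed
  ultimately show ?thesis
    by (meson finite_subset finite_insert finite_imageI)
qed

text \<open>Induction on the number of poles. No pole lies in \<open>A \<inter> B\<close>, so each
  principal part is regular on \<open>A\<close> or on \<open>B\<close> and can be added to the
  corresponding summand.\<close>

lemma fun_split:
  assumes "A \<union> B = UNIV" "fun_regular_on \<phi> (A \<inter> B)"
  shows "\<exists>\<phi>\<^sub>1 \<phi>\<^sub>2. \<phi> = \<phi>\<^sub>1 + \<phi>\<^sub>2 \<and> fun_regular_on \<phi>\<^sub>1 A \<and> fun_regular_on \<phi>\<^sub>2 B"
  using assms(2)
proof (induction "card {p. is_pole (fun_germ \<phi> p) 0}" arbitrary: \<phi> rule: less_induct)
  case less
  show ?case
  proof (cases "{p. is_pole (fun_germ \<phi> p) 0} = {}")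
    case True
    then have "fun_regular_on \<phi> UNIV" by (auto simp: fun_regular_on_def)
    then have "\<phi> = \<phi> + 0 \<and> fun_regular_on \<phi> A \<and> fun_regular_on 0 B"
      by (auto simp: fun_regular_on_zero intro: fun_regular_on_subset)
    then show ?thesis by blast
  next
    case False
    then obtain p where p: "is_pole (fun_germ \<phi> p) 0" by blast
    with less.prems have p_notin: "p \<notin> A \<inter> B" by (auto simp: fun_regular_on_def)
    obtain \<sigma> where \<sigma>: "fun_regular_on \<sigma> (- {p})" "fun_regular_on (\<phi> - \<sigma>) {p}"
      using principal_part_exists by blast
    \<comment> \<open>The principal part is regular off \<open>p\<close>, so subtracting it creates
      no new pole and the number of poles really drops.\<close>
    have regular_off: "fun_regular_on (\<phi> - \<sigma>) {q}" if "q \<noteq> p" "\<not> is_pole (fun_germ \<phi> q) 0" for q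
      using that by (intro fun_regular_on_diff fun_regular_on_subset[OF \<sigma>(1)]) (auto simp: fun_regular_on_def)
    moreover have "\<not> is_pole (fun_germ (\<phi> - \<sigma>) p) 0"
      using \<sigma>(2) by (simp add: fun_regular_on_def)
    ultimately have "{q. is_pole (fun_germ (\<phi> - \<sigma>) q) 0} \<subset> {q. is_pole (fun_germ \<phi> q) 0}"
      using p unfolding fun_regular_on_def by (smt (verit) insertI1 mem_Collect_eq psubsetI subsetI)
    then have "card {q. is_pole (fun_germ (\<phi> - \<sigma>) q) 0} < card {q. is_pole (fun_germ \<phi> q) 0}"
      by (intro psubset_card_mono finite_poles)
    moreover have "fun_regular_on (\<phi> - \<sigma>) (A \<inter> B)"
      unfolding fun_regular_on_def
    proof
      fix q assume "q \<in> A \<inter> B"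
      with p_notin less.prems have "q \<noteq> p" "\<not> is_pole (fun_germ \<phi> q) 0"
        by (auto simp: fun_regular_on_def)
      then show "\<not> is_pole (fun_germ (\<phi> - \<sigma>) q) 0"
        using regular_off by (auto simp: fun_regular_on_def)
    qed
    ultimately obtain \<phi>\<^sub>1 \<phi>\<^sub>2 where *: "\<phi> - \<sigma> = \<phi>\<^sub>1 + \<phi>\<^sub>2" "fun_regular_on \<phi>\<^sub>1 A" "fun_regular_on \<phi>\<^sub>2 B"
      using less.hyps by blast
    show ?thesis
    proof (cases "p \<in> A")
      case False
      then have "fun_regular_on (\<phi>\<^sub>1 + \<sigma>) A"
        by (intro fun_regular_on_add * fun_regular_on_subset[OF \<sigma>(1)]) auto
      moreover have "\<phi> = (\<phi>\<^sub>1 + \<sigma>) + \<phi>\<^sub>2"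
        using *(1) by (simp add: diff_eq_eq add_ac)
      ultimately show ?thesis using *(3) by blast
    next
      case True
      then have "fun_regular_on (\<phi>\<^sub>2 + \<sigma>) B"
        using p_notin by (intro fun_regular_on_add * fun_regular_on_subset[OF \<sigma>(1)]) auto
      moreover have "\<phi> = \<phi>\<^sub>1 + (\<phi>\<^sub>2 + \<sigma>)"
        using *(1) by (simp add: diff_eq_eq add_ac)
      ultimately show ?thesis using *(2) by blast
    qed
  qed
qed

text \<open>
  \<open>coord_inf c\<close> is the affine coordinate sending \<open>c\<close> to infinity, with inverse \<open>point_inf c\<close>; its value
  at \<open>c\<close> itself is junk.
\<close>

fun coord_inf :: "proj_line \<Rightarrow> proj_line \<Rightarrow> complex" where
  "coord_inf None q = (case q of Some z \<Rightarrow> z | None \<Rightarrow> 0)"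
| "coord_inf (Some a) q = (case q of Some z \<Rightarrow> inverse (z - a) | None \<Rightarrow> 0)"

fun point_inf :: "proj_line \<Rightarrow> complex \<Rightarrow> proj_line" where
  "point_inf None w = Some w"
| "point_inf (Some a) w = (if w = 0 then None else Some (a + inverse w))"

lemma point_inf_neq: "point_inf c w \<noteq> c"
  by (cases c) auto

lemma coord_point_inf [simp]: "coord_inf c (point_inf c w) = w"
  by (cases c) auto

lemma point_coord_inf: "q \<noteq> c \<Longrightarrow> point_inf c (coord_inf c q) = q"
  by (cases c; cases q) auto

text \<open>The coefficient of \<open>\<alpha>\<close> in the coordinate \<open>w = 1 / h\<close>, where \<open>h\<close> is the coordinate centred at \<open>c\<close>.\<close>

definition raw_pull :: "proj_line \<Rightarrow> merom_form \<Rightarrow> complex \<Rightarrow> complex" where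
  "raw_pull c \<alpha> w = - form_germ \<alpha> c (inverse w) / w ^ 2"

text \<open>Division by zero gives \<open>raw_pull\<close> a junk value at \<open>w = 0\<close>, the
  finite coordinate where \<open>h\<close> is infinite; removing singularities restores the true
  coefficient where the form is regular.\<close>

definition pull :: "proj_line \<Rightarrow> merom_form \<Rightarrow> complex \<Rightarrow> complex" where
  "pull c \<alpha> = remove_sings (raw_pull c \<alpha>)"

text \<open>\<open>\<sigma>\<close> expresses the coordinate centred at \<open>q\<close> through the
  coordinate \<open>w\<close> with its pole at \<open>c\<close>, and \<open>\<tau>\<close> is its
  local inverse. Coefficients are multiplied by the derivative of \<open>\<sigma>\<close> and
  velocities by that of \<open>\<tau>\<close>; since the two are reciprocal, coefficient times
  velocity does not depend on the chart.\<close>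

lemma chart_transition:
  assumes "q \<noteq> c"
  obtains \<sigma> \<tau> :: "complex \<Rightarrow> complex" where
    "\<sigma> analytic_on {coord_inf c q}" "\<sigma> (coord_inf c q) = 0"
    "eventually (\<lambda>w. \<sigma> w \<noteq> 0) (at (coord_inf c q))"
    "\<tau> analytic_on {0}" "\<tau> 0 = coord_inf c q" "deriv \<sigma> (coord_inf c q) * deriv \<tau> 0 = 1"
    "\<And>\<alpha>. eventually (\<lambda>w. raw_pull c \<alpha> w = form_germ \<alpha> q (\<sigma> w) * deriv \<sigma> w) (at (coord_inf c q))"
    "eventually (\<lambda>w. from_coord q (\<sigma> w) = point_inf c w) (nhds (coord_inf c q))"
    "eventually (\<lambda>h. coord_inf c (from_coord q h) = \<tau> h) (nhds 0)"
proof (cases c)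
  case c: None
  then obtain z where q: "q = Some z" using assms by (cases q) auto
  show thesis
  proof (rule that[of "\<lambda>w. w - z" "\<lambda>h. z + h"]; (unfold c q coord_inf.simps option.case)?)
    have d: "deriv (\<lambda>w. w - z) w = 1" for w
      by (rule DERIV_imp_deriv) (auto intro!: derivative_eq_intros)
    have d': "deriv (\<lambda>h. z + h) 0 = 1"
      by (rule DERIV_imp_deriv) (auto intro!: derivative_eq_intros)
    show "deriv (\<lambda>w. w - z) z * deriv (\<lambda>h. z + h) 0 = 1"
      by (simp add: d d')
    \<comment> \<open>If \<open>z = 0\<close>, this excludes the point at which
      \<open>raw_pull\<close> divides by zero.\<close>
    have "eventually (\<lambda>w::complex. w \<noteq> 0) (at z)"
      by (cases "z = 0") (auto simp: eventually_neq_at_within intro!: tendsto_imp_eventually_ne tendsto_ident_at)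
    then show "eventually (\<lambda>w. raw_pull None \<alpha> w = form_germ \<alpha> (Some z) (w - z) * deriv (\<lambda>w. w - z) w) (at z)" for \<alpha>
      by eventually_elim (simp add: raw_pull_def d field_simps)
  qed (auto intro!: analytic_intros simp: eventually_at_filter)
next
  case c: (Some a)
  show thesis
  proof (cases q)
    case q: (Some z)
    with c assms have "z \<noteq> a" by auto
    define w\<^sub>0 where "w\<^sub>0 = inverse (z - a)"
    have w\<^sub>0: "coord_inf c q = w\<^sub>0" "w\<^sub>0 \<noteq> 0" "inverse w\<^sub>0 = z - a"
      using \<open>z \<noteq> a\<close> by (auto simp: c q w\<^sub>0_def)
    have nz: "eventually (\<lambda>w. w \<noteq> 0) (nhds w\<^sub>0)"
      using w\<^sub>0(2) by (intro t1_space_nhds)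
    \<comment> \<open>From \<open>w = 1 / (z' - a)\<close> a nearby point has affine coordinate
      \<open>z' = a + 1 / w\<close>, and \<open>h = z' - z\<close>.\<close>
    show thesis
    proof (rule that[of "\<lambda>w. a + inverse w - z" "\<lambda>h. inverse (z + h - a)"]; (unfold w\<^sub>0(1))?)
      show "(\<lambda>w. a + inverse w - z) analytic_on {w\<^sub>0}" "(\<lambda>h. inverse (z + h - a)) analytic_on {0}"
        using w\<^sub>0(2) \<open>z \<noteq> a\<close> by (auto intro!: analytic_intros)
      have d: "deriv (\<lambda>w. a + inverse w - z) w = - 1 / w ^ 2" if "w \<noteq> 0" for w
        using that by (intro DERIV_imp_deriv) (auto intro!: derivative_eq_intros simp: power2_eq_square field_simps)
      have d': "deriv (\<lambda>h. inverse (z + h - a)) 0 = - (w\<^sub>0 ^ 2)"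
        using \<open>z \<noteq> a\<close> by (intro DERIV_imp_deriv) (auto intro!: derivative_eq_intros simp: power2_eq_square field_simps w\<^sub>0_def)
      show "deriv (\<lambda>w. a + inverse w - z) w\<^sub>0 * deriv (\<lambda>h. inverse (z + h - a)) 0 = 1"
        using w\<^sub>0(2) by (simp add: d d')
      have "eventually (\<lambda>w. w \<noteq> w\<^sub>0) (at w\<^sub>0)" by (rule eventually_neq_at_within)
      then show "eventually (\<lambda>w. a + inverse w - z \<noteq> 0) (at w\<^sub>0)"
      proof eventually_elim
        case (elim w)
        have "inverse w \<noteq> inverse w\<^sub>0" using elim by simp
        then show ?case using w\<^sub>0(3) by (auto simp: algebra_simps)
      qed
      have "eventually (\<lambda>w. w \<noteq> 0) (at w\<^sub>0)"
        using nz by (auto simp: eventually_at_filter elim: eventually_mono)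
      then show "eventually (\<lambda>w. raw_pull c \<alpha> w = form_germ \<alpha> q (a + inverse w - z) * deriv (\<lambda>w. a + inverse w - z) w) (at w\<^sub>0)" for \<alpha>
        by eventually_elim (simp add: raw_pull_def c q d)
      show "eventually (\<lambda>w. from_coord q (a + inverse w - z) = point_inf c w) (nhds w\<^sub>0)"
        using nz by eventually_elim (simp add: c q)
    qed (use w\<^sub>0(3) in \<open>auto simp: c q w\<^sub>0_def\<close>)
  next
    case q: None
    have lin: "eventually (\<lambda>w. 1 + b * w \<noteq> 0) (nhds 0)" for b :: complex
    proof -
      have "isCont (\<lambda>w. 1 + b * w) 0"
        by (intro continuous_intros)
      then show ?thesis
        using continuous_at_avoid[of 0 "\<lambda>w. 1 + b * w" 0]
        by (auto simp: eventually_nhds_metric dist_commute)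
    qed
    have w\<^sub>0: "coord_inf c q = 0" by (simp add: c q)
    \<comment> \<open>Here \<open>h\<close> is the inverse of \<open>a + 1 / w\<close>, which
      simplifies to \<open>w / (1 + a * w)\<close>; solving for \<open>w\<close> gives
      \<open>\<tau>\<close>. Both forms extend over 0.\<close>
    show thesis
    proof (rule that[of "\<lambda>w. w / (1 + a * w)" "\<lambda>h. h / (1 - a * h)"]; (unfold w\<^sub>0)?)
      show "(\<lambda>w. w / (1 + a * w)) analytic_on {0}" "(\<lambda>h. h / (1 - a * h)) analytic_on {0}"
        by (auto intro!: analytic_intros)
      have d: "deriv (\<lambda>w. w / (1 + a * w)) w = 1 / (1 + a * w) ^ 2" if "1 + a * w \<noteq> 0" for w
        using that by (intro DERIV_imp_deriv) (auto intro!: derivative_eq_intros simp: power2_eq_square algebra_simps)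
      have d': "deriv (\<lambda>h. h / (1 - a * h)) 0 = 1"
        by (intro DERIV_imp_deriv) (auto intro!: derivative_eq_intros)
      show "deriv (\<lambda>w. w / (1 + a * w)) 0 * deriv (\<lambda>h. h / (1 - a * h)) 0 = 1"
        by (simp add: d d')
      have lin': "eventually (\<lambda>w. 1 + a * w \<noteq> 0) (at 0)"
        using lin[of a] by (auto simp: eventually_at_filter elim: eventually_mono)
      from lin' eventually_nonzero_at_0
      show "eventually (\<lambda>w. w / (1 + a * w) \<noteq> 0) (at 0)"
        by eventually_elim simp
      from lin' eventually_nonzero_at_0
      show "eventually (\<lambda>w. raw_pull c \<alpha> w = form_germ \<alpha> q (w / (1 + a * w)) * deriv (\<lambda>w. w / (1 + a * w)) w) (at 0)" for \<alpha>
      proof eventually_elim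
        case (elim w)
        have "inverse (w / (1 + a * w)) = a + inverse w" using elim by (simp add: field_simps)
        moreover have "- x / (w / (1 + a * w))\<^sup>2 * (1 / (1 + a * w)\<^sup>2) = - x / w\<^sup>2" for x
          using elim by (simp add: field_simps)
        ultimately show ?case
          by (simp only: raw_pull_def c q d[OF elim(1)] form_germ.simps)
      qed
      show "eventually (\<lambda>w. from_coord q (w / (1 + a * w)) = point_inf c w) (nhds 0)"
        using lin[of a] by eventually_elim (auto simp: c q field_simps)
      show "eventually (\<lambda>h. coord_inf c (from_coord q h) = h / (1 - a * h)) (nhds 0)"
        using lin[of "- a"] by eventually_elim (auto simp: c q field_simps)
    qed auto
  qed
qed

lemma raw_pull_meromorphic: "raw_pull c \<alpha> meromorphic_on UNIV"
proof -
  have "raw_pull c \<alpha> meromorphic_on {w}" for w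
  proof -
    let ?q = "point_inf c w"
    obtain \<sigma> where \<sigma>: "\<sigma> analytic_on {w}" "\<sigma> w = 0"
      "eventually (\<lambda>x. raw_pull c \<alpha> x = form_germ \<alpha> ?q (\<sigma> x) * deriv \<sigma> x) (at w)"
      by (rule chart_transition[OF point_inf_neq[of c w], unfolded coord_point_inf]) blast
    have "(\<lambda>x. form_germ \<alpha> ?q (\<sigma> x)) meromorphic_on {w}"
      by (rule meromorphic_on_compose[OF form_germ_meromorphic \<sigma>(1)]) (simp add: \<sigma>(2))
    moreover have "deriv \<sigma> meromorphic_on {w}"
      using \<sigma>(1) by (intro analytic_on_imp_meromorphic_on analytic_deriv)
    ultimately have "(\<lambda>x. form_germ \<alpha> ?q (\<sigma> x) * deriv \<sigma> x) meromorphic_on {w}"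
      by (rule meromorphic_on_mult)
    then show ?thesis
      by (rule meromorphic_at_cong) (use \<sigma>(3) in eventually_elim, simp)
  qed
  then show ?thesis using meromorphic_on_meromorphic_at by blast
qed

lemma pull_meromorphic: "pull c \<alpha> meromorphic_on UNIV"
  unfolding pull_def by (intro meromorphic_intros raw_pull_meromorphic)

text \<open>Besides analyticity the exact value is recorded, because \<open>curve_integral\<close>
  evaluates the normalised coefficient at the point itself.\<close>

lemma pull_regular:
  assumes "q \<noteq> c" "form_regular_on \<alpha> {q}"
    and \<sigma>: "\<sigma> analytic_on {coord_inf c q}" "\<sigma> (coord_inf c q) = 0"
      "eventually (\<lambda>w. \<sigma> w \<noteq> 0) (at (coord_inf c q))"
      "eventually (\<lambda>w. raw_pull c \<alpha> w = form_germ \<alpha> q (\<sigma> w) * deriv \<sigma> w) (at (coord_inf c q))"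
  shows "pull c \<alpha> analytic_on {coord_inf c q}"
    and "pull c \<alpha> (coord_inf c q) = remove_sings (form_germ \<alpha> q) 0 * deriv \<sigma> (coord_inf c q)"
proof -
  define w\<^sub>0 where "w\<^sub>0 = coord_inf c q"
  note \<sigma> = \<sigma>[folded w\<^sub>0_def]
  obtain k where k: "k analytic_on {0}" "eventually (\<lambda>h. form_germ \<alpha> q h = k h) (at 0)"
    using regular_onE(2)[OF assms(2) singletonI] by blast
  \<comment> \<open>The germ is controlled only on a punctured neighbourhood of 0, so
    \<open>\<sigma>\<close> has to avoid 0 near its zero.\<close>
  have "filterlim \<sigma> (at 0) (at w\<^sub>0)"
    unfolding filterlim_at
    using \<sigma>(2,3) isContD[OF analytic_at_imp_isCont[OF \<sigma>(1)]] by auto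
  from eventually_compose_filterlim[OF k(2) this] \<sigma>(4)
  have ev: "eventually (\<lambda>w. raw_pull c \<alpha> w = k (\<sigma> w) * deriv \<sigma> w) (at w\<^sub>0)"
    by eventually_elim simp
  have ana: "(\<lambda>w. k (\<sigma> w) * deriv \<sigma> w) analytic_on {w\<^sub>0}"
    by (intro analytic_intros analytic_deriv \<sigma>(1) analytic_on_compose_gen[OF \<sigma>(1) k(1), unfolded o_def])
       (simp add: \<sigma>(2))
  have "eventually (\<lambda>w. pull c \<alpha> w = k (\<sigma> w) * deriv \<sigma> w) (at w\<^sub>0)"
    using ev eventually_remove_sings_at[OF raw_pull_meromorphic, of c \<alpha> w\<^sub>0]
    unfolding pull_def by eventually_elim simp
  moreover have val: "pull c \<alpha> w\<^sub>0 = k 0 * deriv \<sigma> w\<^sub>0"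
    using remove_sings_cong[OF ev refl] ana \<sigma>(2) by (simp add: pull_def)
  ultimately have "eventually (\<lambda>w. pull c \<alpha> w = k (\<sigma> w) * deriv \<sigma> w) (nhds w\<^sub>0)"
    using \<sigma>(2) by (simp add: eventually_nhds_conv_at)
  then show "pull c \<alpha> analytic_on {coord_inf c q}"
    using ana analytic_at_cong[of "pull c \<alpha>" "\<lambda>w. k (\<sigma> w) * deriv \<sigma> w" w\<^sub>0 w\<^sub>0] by (simp add: w\<^sub>0_def)
  have "remove_sings (form_germ \<alpha> q) 0 = k 0"
    using remove_sings_cong[OF k(2) refl] k(1) by simp
  with val show "pull c \<alpha> (coord_inf c q) = remove_sings (form_germ \<alpha> q) 0 * deriv \<sigma> (coord_inf c q)"
    by (simp add: w\<^sub>0_def)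
qed

lemma pull_analytic:
  assumes "form_regular_on \<alpha> {point_inf c w}"
  shows "pull c \<alpha> analytic_on {w}"
proof -
  obtain \<sigma> where \<sigma>: "\<sigma> analytic_on {w}" "\<sigma> w = 0" "eventually (\<lambda>w. \<sigma> w \<noteq> 0) (at w)"
    "eventually (\<lambda>x. raw_pull c \<alpha> x = form_germ \<alpha> (point_inf c w) (\<sigma> x) * deriv \<sigma> x) (at w)"
    by (rule chart_transition[OF point_inf_neq[of c w], unfolded coord_point_inf]) blast
  show ?thesis
    using pull_regular(1)[OF point_inf_neq assms, unfolded coord_point_inf, OF \<sigma>] .
qed

text \<open>With \<open>P\<close> moved to infinity the form has an entire coefficient and hence an
  entire primitive \<open>G\<close>. In the coordinate at \<open>P\<close>,
  \<open>G (inverse h)\<close> is a primitive on the whole punctured plane.\<close>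

lemma Res_single_pole:
  assumes "form_regular_on \<alpha> (- {P})"
  shows "Res P \<alpha> = 0"
proof -
  have "pull P \<alpha> analytic_on {w}" for w
    by (intro pull_analytic form_regular_on_subset[OF assms]) (use point_inf_neq[of P w] in auto)
  then have holo: "pull P \<alpha> holomorphic_on UNIV"
    by (meson analytic_imp_holomorphic analytic_on_analytic_at)
  then obtain G where G: "\<And>w. (G has_field_derivative pull P \<alpha> w) (at w)"
    using holomorphic_convex_primitive'[of UNIV "pull P \<alpha>"] by auto
  let ?f = "\<lambda>h. pull P \<alpha> (inverse h) * (- 1 / h ^ 2)"
  have "residue ?f 0 = 0"
  proof (rule residue_primitive[where S = UNIV and G = "\<lambda>h. G (inverse h)"])
    show "((\<lambda>h. G (inverse h)) has_field_derivative ?f h) (at h)" if "h \<in> UNIV - {0}" for h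
    proof (rule DERIV_chain2[OF G])
      show "(inverse has_field_derivative - 1 / h ^ 2) (at h)"
        by (rule DERIV_cong[OF DERIV_inverse]) (use that in \<open>simp_all add: field_simps numeral_2_eq_2\<close>)
    qed
    show "?f holomorphic_on UNIV - {0}"
      by (intro holomorphic_intros holomorphic_on_compose_gen[OF _ holo, unfolded o_def]) auto
  qed auto
  moreover have "eventually (\<lambda>h. form_germ \<alpha> P h = ?f h) (at 0)"
    using eventually_analytic_germ[OF form_germ_meromorphic[of \<alpha> P]] eventually_nonzero_at_0
  proof eventually_elim
    case (elim h)
    have "(\<lambda>w. form_germ \<alpha> P (inverse w)) analytic_on {inverse h}"
    proof (rule analytic_on_compose_gen[of inverse "{inverse h}" "form_germ \<alpha> P" "{h}", unfolded o_def])
      show "inverse analytic_on {inverse h}"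
        using elim(2) by (intro analytic_intros) auto
    qed (use elim in auto)
    then have "raw_pull P \<alpha> analytic_on {inverse h}"
      unfolding raw_pull_def[abs_def] using elim by (intro analytic_intros) auto
    then have "pull P \<alpha> (inverse h) = raw_pull P \<alpha> (inverse h)"
      by (simp add: pull_def)
    then show ?case using elim by (simp add: raw_pull_def field_simps)
  qed
  ultimately show ?thesis
    by (simp add: Res_def residue_cong[OF _ refl, of "form_germ \<alpha> P" ?f])
qed

section \<open>The commutator and the topology of the projective line\<close>

text \<open>The terms with both functions of the same type vanish, which reduces the scalar to
  \<open>L (\<phi>\<^sub>2 d\<psi>\<^sub>1) - L (\<psi>\<^sub>2 d\<phi>\<^sub>1)\<close>.
  Integration by parts turns the second term into \<open>L (\<phi>\<^sub>1 d\<psi>\<^sub>2)\<close>,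
  and these are the two surviving terms of \<open>L (\<phi> d\<psi>)\<close>.\<close>

lemma commutator_of_functional:
  assumes AB: "A \<union> B = UNIV"
    and V: "V = {\<alpha> \<in> K_forms. form_regular_on \<alpha> (A \<inter> B)}"
    and L_add: "\<And>\<alpha> \<beta>. form_regular_on \<alpha> (A \<inter> B) \<Longrightarrow> form_regular_on \<beta> (A \<inter> B) \<Longrightarrow> L (\<alpha> + \<beta>) = L \<alpha> + L \<beta>"
    and L_scale: "\<And>c \<alpha>. form_regular_on \<alpha> (A \<inter> B) \<Longrightarrow> L (scale_form c \<alpha>) = c * L \<alpha>"
    and L_A: "\<And>\<alpha>. form_regular_on \<alpha> A \<Longrightarrow> L \<alpha> = 0"
    and L_B: "\<And>\<alpha>. form_regular_on \<alpha> B \<Longrightarrow> L \<alpha> = 0"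
    and \<phi>: "fun_regular_on \<phi> (A \<inter> B)" and \<psi>: "fun_regular_on \<psi> (A \<inter> B)"
    and w: "w \<in> carrier (Sym V)"
  defines "T \<equiv> split_op V (\<lambda>\<phi> \<alpha>. L (mult_form \<phi> \<alpha>)) A B"
  shows "T \<phi> (T \<psi> w) \<ominus>\<^bsub>Sym V\<^esub> T \<psi> (T \<phi> w) = sym_scale V (L (mult_form \<phi> (ext_d \<psi>))) w"
proof -
  interpret form_space V
    by unfold_locales
       (auto simp: V zero_in_K_forms K_forms_closed form_regular_on_zero form_regular_on_add form_regular_on_scale)
  have sub: "fun_regular_on \<eta> (A \<inter> B)" if "fun_regular_on \<eta> A \<or> fun_regular_on \<eta> B" for \<eta>
    using that by (auto intro: fun_regular_on_subset)
  have L_exact: "L (ext_d \<eta>) = 0" if \<eta>: "fun_regular_on \<eta> (A \<inter> B)" for \<eta>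
  proof -
    obtain \<eta>\<^sub>1 \<eta>\<^sub>2 where *: "\<eta> = \<eta>\<^sub>1 + \<eta>\<^sub>2" "fun_regular_on \<eta>\<^sub>1 A" "fun_regular_on \<eta>\<^sub>2 B"
      using fun_split[OF AB \<eta>] by blast
    then have "L (ext_d \<eta>) = L (ext_d \<eta>\<^sub>1) + L (ext_d \<eta>\<^sub>2)"
      by (simp add: ext_d_add L_add form_regular_on_ext_d sub)
    with * show ?thesis
      by (simp add: L_A L_B form_regular_on_ext_d)
  qed
  have F: "linear_functional (\<lambda>\<alpha>. L (mult_form \<eta> \<alpha>)) \<and> ext_d \<eta> \<in> V"
    if "fun_regular_on \<eta> A \<or> fun_regular_on \<eta> B" for \<eta>
    using sub[OF that] unfolding linear_functional_def
    by (auto simp: V mult_form_add_right mult_form_scale L_add L_scale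
        form_regular_on_mult ext_d_in_K_forms form_regular_on_ext_d)
  obtain \<phi>\<^sub>1 \<phi>\<^sub>2 \<psi>\<^sub>1 \<psi>\<^sub>2 where
    \<phi>12: "\<phi> = \<phi>\<^sub>1 + \<phi>\<^sub>2" "fun_regular_on \<phi>\<^sub>1 A" "fun_regular_on \<phi>\<^sub>2 B" and
    \<psi>12: "\<psi> = \<psi>\<^sub>1 + \<psi>\<^sub>2" "fun_regular_on \<psi>\<^sub>1 A" "fun_regular_on \<psi>\<^sub>2 B" and
    commutator: "\<And>w. w \<in> carrier (Sym V) \<Longrightarrow> T \<phi> (T \<psi> w) \<ominus>\<^bsub>Sym V\<^esub> T \<psi> (T \<phi> w) =
       sym_scale V (L (mult_form \<phi>\<^sub>1 (ext_d \<psi>\<^sub>1)) + L (mult_form \<phi>\<^sub>2 (ext_d \<psi>\<^sub>1)) -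
         (L (mult_form \<psi>\<^sub>1 (ext_d \<phi>\<^sub>1)) + L (mult_form \<psi>\<^sub>2 (ext_d \<phi>\<^sub>1)))) w"
    unfolding T_def
    by (rule commutator_split_op[OF fun_split[OF AB \<phi>] fun_split[OF AB \<psi>], of "\<lambda>\<phi> \<alpha>. L (mult_form \<phi> \<alpha>)"])
       (use F in blast)+
  note regular = \<phi>12(2,3) \<psi>12(2,3)
  have regular': "fun_regular_on \<eta> (A \<inter> B)" if "\<eta> \<in> {\<phi>\<^sub>1, \<phi>\<^sub>2, \<psi>\<^sub>1, \<psi>\<^sub>2}" for \<eta>
    using that regular by (auto intro: sub)
  have zeros: "L (mult_form \<phi>\<^sub>1 (ext_d \<psi>\<^sub>1)) = 0" "L (mult_form \<psi>\<^sub>1 (ext_d \<phi>\<^sub>1)) = 0"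
      "L (mult_form \<phi>\<^sub>2 (ext_d \<psi>\<^sub>2)) = 0"
    using regular by (simp_all add: L_A L_B form_regular_on_mult form_regular_on_ext_d)
  have "0 = L (ext_d (mult_fun \<phi>\<^sub>1 \<psi>\<^sub>2))"
    using regular' by (simp add: L_exact fun_regular_on_mult)
  also have "\<dots> = L (mult_form \<phi>\<^sub>1 (ext_d \<psi>\<^sub>2)) + L (mult_form \<psi>\<^sub>2 (ext_d \<phi>\<^sub>1))"
    using regular' by (simp add: ext_d_mult L_add form_regular_on_mult form_regular_on_ext_d)
  finally have parts: "L (mult_form \<psi>\<^sub>2 (ext_d \<phi>\<^sub>1)) = - L (mult_form \<phi>\<^sub>1 (ext_d \<psi>\<^sub>2))"
    by (simp add: eq_neg_iff_add_eq_0 add.commute)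
  have "L (mult_form \<phi> (ext_d \<psi>)) =
      L (mult_form \<phi>\<^sub>1 (ext_d \<psi>\<^sub>1)) + L (mult_form \<phi>\<^sub>1 (ext_d \<psi>\<^sub>2)) +
      (L (mult_form \<phi>\<^sub>2 (ext_d \<psi>\<^sub>1)) + L (mult_form \<phi>\<^sub>2 (ext_d \<psi>\<^sub>2)))"
    using regular'
    by (simp add: \<phi>12(1) \<psi>12(1) ext_d_add mult_form_add_left mult_form_add_right L_add
        form_regular_on_add form_regular_on_mult form_regular_on_ext_d)
  then show ?thesis
    using commutator[OF w] by (simp add: zeros parts add.commute)
qed

section \<open>Continuity of the coordinates with prescribed pole\<close>

lemma open_coord_preimage:
  assumes "open S"
  shows "openin proj_top {q. q \<noteq> c \<and> coord_inf c q \<in> S}"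
  unfolding openin_proj_top
proof
  fix p :: proj_line
  have *: "open {h. h \<in> U \<and> v h \<in> S}" if "open U" "continuous_on U v" for U :: "complex set" and v :: "complex \<Rightarrow> complex"
    using continuous_open_preimage[OF that(2,1) assms] by (simp add: vimage_def Int_def)
  have nz: "open {h. u h \<noteq> 0}" if "continuous_on UNIV u" for u :: "complex \<Rightarrow> complex"
    using that by (intro open_Collect_neq) auto
  consider a where "c = None" "p = Some a" | "c = None" "p = None"
    | b a where "c = Some b" "p = Some a" | b where "c = Some b" "p = None"
    by (cases c; cases p) auto
  then show "open {h. from_coord p h \<in> {q. q \<noteq> c \<and> coord_inf c q \<in> S}}"
  proof cases
    case 1
    have "open {h. h \<in> UNIV \<and> a + h \<in> S}"
      by (intro * continuous_intros) auto
    with 1 show ?thesis by simp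
  next
    case 2
    have "open {h. h \<in> {h. h \<noteq> 0} \<and> inverse h \<in> S}"
      by (intro * continuous_intros nz) auto
    also have "{h. h \<in> {h. h \<noteq> 0} \<and> inverse h \<in> S} = {h. from_coord p h \<in> {q. q \<noteq> c \<and> coord_inf c q \<in> S}}"
      using 2 by auto
    finally show ?thesis .
  next
    case 3
    have "open {h. h \<in> {h. a + h - b \<noteq> 0} \<and> inverse (a + h - b) \<in> S}"
      by (intro * continuous_intros nz) auto
    also have "{h. h \<in> {h. a + h - b \<noteq> 0} \<and> inverse (a + h - b) \<in> S} =
        {h. from_coord p h \<in> {q. q \<noteq> c \<and> coord_inf c q \<in> S}}"
      using 3 by auto
    finally show ?thesis .
  next
    case 4
    have "open {h. h \<in> {h. 1 - b * h \<noteq> 0} \<and> h / (1 - b * h) \<in> S}"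
      by (intro * continuous_intros nz) auto
    also have "{h. h \<in> {h. 1 - b * h \<noteq> 0} \<and> h / (1 - b * h) \<in> S} =
        {h. from_coord p h \<in> {q. q \<noteq> c \<and> coord_inf c q \<in> S}}"
    proof (intro Collect_cong)
      fix h
      show "h \<in> {h. 1 - b * h \<noteq> 0} \<and> h / (1 - b * h) \<in> S \<longleftrightarrow>
          from_coord p h \<in> {q. q \<noteq> c \<and> coord_inf c q \<in> S}"
      proof (cases "h = 0")
        case False
        then have "inverse (inverse h - b) = h / (1 - b * h)" "inverse h \<noteq> b \<longleftrightarrow> 1 - b * h \<noteq> 0"
          by (auto simp: field_simps)
        with False 4 show ?thesis by simp
      qed (simp add: 4)
    qed
    finally show ?thesis .
  qed
qed

text \<open>Provides neighbourhoods of \<open>c\<close> in terms of the coordinate whose value at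
  \<open>c\<close> is junk. They are needed for the unbounded side of a curve, to which
  \<open>c\<close> belongs.\<close>

lemma open_coord_complement_ball:
  assumes "R > 0"
  shows "openin proj_top {q. q = c \<or> R < norm (coord_inf c q)}"
  unfolding openin_proj_top
proof
  fix p :: proj_line
  have *: "open {h. u h < v h}" if "continuous_on UNIV u" "continuous_on UNIV v" for u v :: "complex \<Rightarrow> real"
    using that by (rule open_Collect_less)
  \<comment> \<open>In the form \<open>R * norm z < 1\<close> the inequality also holds at
    \<open>z = 0\<close>, which is the point \<open>c\<close> to be included.\<close>
  have norm_inverse_gt: "R < norm (inverse z) \<longleftrightarrow> R * norm z < 1" if "z \<noteq> 0" for z :: complex
    using that by (simp add: norm_inverse inverse_eq_divide norm_divide pos_less_divide_eq)
  consider a where "c = None" "p = Some a" | "c = None" "p = None"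
    | b a where "c = Some b" "p = Some a" | b where "c = Some b" "p = None"
    by (cases c; cases p) auto
  then show "open {h. from_coord p h \<in> {q. q = c \<or> R < norm (coord_inf c q)}}"
  proof cases
    case 1
    have "open {h. R < norm (a + h)}"
      by (intro * continuous_intros)
    with 1 show ?thesis by simp
  next
    case 2
    have "open {h::complex. R * norm h < 1}"
      by (intro * continuous_intros)
    also have "{h. R * norm h < 1} = {h. from_coord p h \<in> {q. q = c \<or> R < norm (coord_inf c q)}}"
      using 2 norm_inverse_gt by auto
    finally show ?thesis .
  next
    case 3
    have "open {h. R * norm (a + h - b) < 1}"
      by (intro * continuous_intros)
    also have "{h. R * norm (a + h - b) < 1} = {h. from_coord p h \<in> {q. q = c \<or> R < norm (coord_inf c q)}}"
    proof (intro Collect_cong)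
      fix h
      show "R * norm (a + h - b) < 1 \<longleftrightarrow> from_coord p h \<in> {q. q = c \<or> R < norm (coord_inf c q)}"
        using 3 norm_inverse_gt[of "a + h - b"] by (cases "a + h - b = 0") auto
    qed
    finally show ?thesis .
  next
    case 4
    \<comment> \<open>Cleared of denominators, so that the point \<open>c\<close>, where
      \<open>1 - b * h = 0\<close>, satisfies it.\<close>
    have "open {h. R * norm (1 - b * h) < norm h}"
      by (intro * continuous_intros)
    also have "{h. R * norm (1 - b * h) < norm h} = {h. from_coord p h \<in> {q. q = c \<or> R < norm (coord_inf c q)}}"
    proof (intro Collect_cong)
      fix h
      show "R * norm (1 - b * h) < norm h \<longleftrightarrow> from_coord p h \<in> {q. q = c \<or> R < norm (coord_inf c q)}"
      proof (cases "h = 0")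
        case True
        then show ?thesis using 4 assms by simp
      next
        case False
        then have "inverse (inverse h - b) = h / (1 - b * h)" "inverse h = b \<longleftrightarrow> 1 - b * h = 0"
          by (auto simp: field_simps)
        with False 4 show ?thesis
          by (cases "1 - b * h = 0") (auto simp: norm_divide field_simps)
      qed
    qed
    finally show ?thesis .
  qed
qed

lemma open_point_preimage:
  assumes T: "openin proj_top T"
  shows "open {w. point_inf c w \<in> T}"
proof (cases c)
  case None
  then have "{w. point_inf c w \<in> T} = {h. from_coord (Some 0) h \<in> T}" by simp
  with T show ?thesis by (simp only: openin_proj_top)
next
  case (Some a)
  have T': "open {h. from_coord p h \<in> T}" for p
    using T by (simp only: openin_proj_top)
  have *: "open {w. w \<in> U \<and> from_coord p (v w) \<in> T}" if "open U" "continuous_on U v"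
    for U :: "complex set" and v :: "complex \<Rightarrow> complex" and p
    using continuous_open_preimage[OF that(2,1) T'[of p]] by (simp add: vimage_def Int_def)
  \<comment> \<open>Two charts cover the plane: off \<open>w = 0\<close> the affine one, and near
    \<open>w = 0\<close>, which is sent to infinity, the one at infinity.\<close>
  have "open {w. w \<in> {w. w \<noteq> 0} \<and> from_coord (Some 0) (a + inverse w) \<in> T}"
    by (intro * continuous_intros open_Collect_neq) auto
  moreover have "open {w. w \<in> {w. 1 + a * w \<noteq> 0} \<and> from_coord None (w / (1 + a * w)) \<in> T}"
    by (intro * continuous_intros open_Collect_neq) auto
  moreover have "{w. point_inf c w \<in> T} =
      {w. w \<in> {w. w \<noteq> 0} \<and> from_coord (Some 0) (a + inverse w) \<in> T} \<union>
      {w. w \<in> {w. 1 + a * w \<noteq> 0} \<and> from_coord None (w / (1 + a * w)) \<in> T}" (is "?l = ?r")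
  proof (rule Set.set_eqI)
    fix w
    show "w \<in> ?l \<longleftrightarrow> w \<in> ?r"
    proof (cases "w = 0")
      case False
      then have "1 + a * w \<noteq> 0 \<Longrightarrow> inverse (w / (1 + a * w)) = a + inverse w"
        by (simp add: field_simps)
      with False Some show ?thesis by auto
    qed (simp add: Some)
  qed
  ultimately show ?thesis by (simp only: open_Un)
qed

lemma continuous_map_point_inf: "continuous_map euclidean proj_top (point_inf c)"
  by (simp add: continuous_map open_point_preimage)

lemma openin_proj_top_Compl_singleton: "openin proj_top (- {x})"
  unfolding openin_proj_top
proof
  fix p :: proj_line
  have "h = h'" if "from_coord p h = x" "from_coord p h' = x" for h h'
    using that by (cases p) (auto split: if_splits)
  then have "\<exists>h\<^sub>0. {h. from_coord p h = x} \<subseteq> {h\<^sub>0}" by blast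
  then have "finite {h. from_coord p h = x}"
    using finite_subset by blast
  then have "open (- {h. from_coord p h = x})"
    by (intro open_Compl finite_imp_closed)
  then show "open {h. from_coord p h \<in> - {x}}"
    by (simp add: Collect_neg_eq)
qed

section \<open>Integration along the boundary of a disc\<close>

lemma remove_sings_form_germ:
  assumes "k analytic_on {0}" "eventually (\<lambda>h. form_germ \<alpha> p h = k h) (at 0)"
  shows "remove_sings (form_germ \<alpha> p) 0 = k 0"
  using remove_sings_cong[OF assms(2) refl] assms(1) by simp

lemma remove_sings_form_germ_add:
  assumes "form_regular_on \<alpha> {p}" "form_regular_on \<beta> {p}"
  shows "remove_sings (form_germ (\<alpha> + \<beta>) p) 0 =
    remove_sings (form_germ \<alpha> p) 0 + remove_sings (form_germ \<beta> p) 0"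
proof -
  obtain k l where k: "k analytic_on {0}" "eventually (\<lambda>h. form_germ \<alpha> p h = k h) (at 0)"
    and l: "l analytic_on {0}" "eventually (\<lambda>h. form_germ \<beta> p h = l h) (at 0)"
    using regular_onE(2)[OF assms(1) singletonI] regular_onE(2)[OF assms(2) singletonI] by blast
  have "eventually (\<lambda>h. form_germ (\<alpha> + \<beta>) p h = k h + l h) (at 0)"
    using form_germ_add[of \<alpha> \<beta> p] k(2) l(2) by eventually_elim simp
  then have "remove_sings (form_germ (\<alpha> + \<beta>) p) 0 = k 0 + l 0"
    by (intro remove_sings_form_germ analytic_intros k l)
  then show ?thesis
    by (simp add: remove_sings_form_germ[OF k] remove_sings_form_germ[OF l])
qed

lemma remove_sings_form_germ_scale:
  assumes "form_regular_on \<alpha> {p}"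
  shows "remove_sings (form_germ (scale_form c \<alpha>) p) 0 = c * remove_sings (form_germ \<alpha> p) 0"
proof -
  obtain k where k: "k analytic_on {0}" "eventually (\<lambda>h. form_germ \<alpha> p h = k h) (at 0)"
    using regular_onE(2)[OF assms singletonI] by blast
  have "eventually (\<lambda>h. form_germ (scale_form c \<alpha>) p h = c * k h) (at 0)"
    using form_germ_scale[of c \<alpha> p] k(2) by eventually_elim simp
  then have "remove_sings (form_germ (scale_form c \<alpha>) p) 0 = c * k 0"
    by (intro remove_sings_form_germ analytic_intros k)
  then show ?thesis
    by (simp add: remove_sings_form_germ[OF k])
qed

text \<open>Only at \<open>c\<close> is the value of \<open>coord_inf c\<close> junk, so for
  \<open>c\<close> off the curve the coordinate turns it into an honest plane curve.\<close>

locale charted_curve =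
  fixes \<gamma> :: "real \<Rightarrow> proj_line" and c :: proj_line
  assumes smooth: "smooth_simple_closed \<gamma>" and c_notin: "c \<notin> range \<gamma>"
begin

definition \<Gamma> :: "real \<Rightarrow> complex" where
  "\<Gamma> t = coord_inf c (\<gamma> t)"

lemma \<gamma>_neq: "\<gamma> t \<noteq> c"
  using c_notin by auto

lemma point_\<Gamma>: "point_inf c (\<Gamma> t) = \<gamma> t"
  by (simp add: \<Gamma>_def point_coord_inf \<gamma>_neq)

lemma eventually_from_to_coord:
  "eventually (\<lambda>s. from_coord (\<gamma> t) (to_coord (\<gamma> t) (\<gamma> s)) = \<gamma> s) (nhds t)"
proof -
  \<comment> \<open>The single point outside the domain of the chart centred at
    \<open>\<gamma> t\<close>, where \<open>to_coord\<close> is junk; by continuity the curve avoids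
    it near \<open>t\<close>.\<close>
  define x :: proj_line where "x = (case \<gamma> t of None \<Rightarrow> Some 0 | Some a \<Rightarrow> None)"
  have "openin euclideanreal {s \<in> topspace euclideanreal. \<gamma> s \<in> - {x}}"
    using smooth openin_proj_top_Compl_singleton
    unfolding smooth_simple_closed_def continuous_map by blast
  then have "open {s. \<gamma> s \<noteq> x}" by simp
  moreover have "\<gamma> t \<noteq> x" by (auto simp: x_def split: option.splits)
  ultimately have "eventually (\<lambda>s. \<gamma> s \<noteq> x) (nhds t)"
    using eventually_nhds by blast
  then show ?thesis
    by eventually_elim (auto simp: x_def split: option.splits)
qed

lemma local_coordinate:
  obtains g h where
    "eventually (\<lambda>s. to_coord (\<gamma> t) (\<gamma> s) = g s) (nhds t)" "g t = 0"
    "eventually (\<lambda>s. (g has_vector_derivative h s) (at s)) (nhds t)" "isCont h t"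
    "velocity \<gamma> t = h t"
proof -
  obtain \<epsilon> g where \<epsilon>: "\<epsilon> > 0"
    and g: "\<And>s. s \<in> ball t \<epsilon> \<Longrightarrow> g 0 s = to_coord (\<gamma> t) (\<gamma> s)"
      "\<And>s n. s \<in> ball t \<epsilon> \<Longrightarrow> (g n has_vector_derivative g (Suc n) s) (at s)"
    using smooth unfolding smooth_simple_closed_def smooth_at_def by blast
  have ball: "eventually (\<lambda>s. s \<in> ball t \<epsilon>) (nhds t)"
    using \<epsilon> by (intro eventually_nhds_in_open) auto
  show thesis
  proof (rule that[of "g 0" "g 1"])
    show eq: "eventually (\<lambda>s. to_coord (\<gamma> t) (\<gamma> s) = g 0 s) (nhds t)"
      using ball by eventually_elim (simp add: g)
    show "g 0 t = 0"
      using g(1)[of t] \<epsilon> by (cases "\<gamma> t") auto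
    show "eventually (\<lambda>s. (g 0 has_vector_derivative g 1 s) (at s)) (nhds t)"
      using ball by eventually_elim (use g(2)[of _ 0] in simp)
    \<comment> \<open>Continuity of the first derivative comes from the existence of the
      second.\<close>
    show "isCont (g 1) t"
      using g(2)[of t 1] \<epsilon> has_vector_derivative_continuous by auto
    have "((\<lambda>s. to_coord (\<gamma> t) (\<gamma> s)) has_vector_derivative g 1 t) (at t)"
    proof (rule has_vector_derivative_transform_within_open)
      show "(g 0 has_vector_derivative g 1 t) (at t)" using g(2)[of t 0] \<epsilon> by simp
      show "open (ball t \<epsilon>)" "t \<in> ball t \<epsilon>" using \<epsilon> by auto
    qed (simp add: g)
    then show "velocity \<gamma> t = g 1 t"
      unfolding velocity_def by (rule vector_derivative_at)
  qed
qed

text \<open>Near \<open>t\<close> the plane curve is \<open>\<tau>\<close> composed with the local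
  coordinate of the curve. The second claim gives a derivative at all nearby parameters, continuous
  at \<open>t\<close>, as C1 differentiability requires.\<close>

lemma \<Gamma>_derivative:
  assumes \<tau>: "\<tau> analytic_on {0}" "eventually (\<lambda>h. coord_inf c (from_coord (\<gamma> t) h) = \<tau> h) (nhds 0)"
  shows "(\<Gamma> has_vector_derivative velocity \<gamma> t * deriv \<tau> 0) (at t)"
    and "\<exists>D. eventually (\<lambda>s. (\<Gamma> has_vector_derivative D s) (at s)) (nhds t) \<and> isCont D t"
proof -
  obtain g h where g: "eventually (\<lambda>s. to_coord (\<gamma> t) (\<gamma> s) = g s) (nhds t)" "g t = 0"
    "eventually (\<lambda>s. (g has_vector_derivative h s) (at s)) (nhds t)" "isCont h t"
    "velocity \<gamma> t = h t"
    by (rule local_coordinate)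
  have "isCont g t"
    using eventually_nhds_x_imp_x[OF g(3)] has_vector_derivative_continuous by blast
  then have lim: "filterlim g (nhds 0) (nhds t)"
    using g(2) by (simp add: continuous_at tendsto_nhds_iff)
  define D where "D s = h s * deriv \<tau> (g s)" for s
  obtain A where "open A" "0 \<in> A" "\<tau> holomorphic_on A"
    using \<tau>(1) unfolding analytic_at by blast
  then have "eventually (\<lambda>x. \<tau> analytic_on {x}) (nhds 0)"
    using analytic_at eventually_nhds by blast
  from eventually_compose_filterlim[OF this lim]
  have \<tau>_der: "eventually (\<lambda>s. (\<tau> has_field_derivative deriv \<tau> (g s)) (at (g s))) (nhds t)"
    by eventually_elim
       (simp add: analytic_on_imp_differentiable_at DERIV_deriv_iff_field_differentiable)
  have "eventually (\<lambda>s. \<Gamma> s = (\<tau> \<circ> g) s) (nhds t)"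
    using eventually_compose_filterlim[OF \<tau>(2) lim] g(1) eventually_from_to_coord[of t]
    by eventually_elim (simp add: \<Gamma>_def)
  \<comment> \<open>To differentiate at a nearby \<open>s\<close>, the identity must hold on a
    neighbourhood of \<open>s\<close>.\<close>
  then have "eventually (\<lambda>s. eventually (\<lambda>s. \<Gamma> s = (\<tau> \<circ> g) s) (nhds s)) (nhds t)"
    by (simp add: eventually_eventually)
  with \<tau>_der g(3) have D: "eventually (\<lambda>s. (\<Gamma> has_vector_derivative D s) (at s)) (nhds t)"
  proof eventually_elim
    case (elim s)
    obtain U where "open U" "s \<in> U" "\<And>x. x \<in> U \<Longrightarrow> \<Gamma> x = (\<tau> \<circ> g) x"
      using elim(3) unfolding eventually_nhds by blast
    moreover have "((\<tau> \<circ> g) has_vector_derivative D s) (at s)"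
      unfolding D_def by (rule field_vector_diff_chain_at[OF elim(2,1)])
    ultimately show ?case
      by (metis has_vector_derivative_transform_within_open)
  qed
  have "isCont (deriv \<tau>) (g t)"
    using \<tau>(1) g(2) by (simp add: analytic_at_imp_isCont analytic_deriv)
  then have "isCont D t"
    unfolding D_def by (intro continuous_intros g(4) isCont_o2[OF \<open>isCont g t\<close>])
  with D show "\<exists>D. eventually (\<lambda>s. (\<Gamma> has_vector_derivative D s) (at s)) (nhds t) \<and> isCont D t"
    by blast
  show "(\<Gamma> has_vector_derivative velocity \<gamma> t * deriv \<tau> 0) (at t)"
    using eventually_nhds_x_imp_x[OF D] by (simp add: D_def g(2,5))
qed

lemma \<Gamma>_C1: "\<Gamma> C1_differentiable_on UNIV"
  unfolding C1_differentiable_on_def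
proof (intro exI conjI ballI)
  let ?D = "\<lambda>t. vector_derivative \<Gamma> (at t)"
  have *: "(\<Gamma> has_vector_derivative ?D t) (at t) \<and> isCont ?D t" for t
  proof -
    obtain \<tau> where "\<tau> analytic_on {0}" "eventually (\<lambda>h. coord_inf c (from_coord (\<gamma> t) h) = \<tau> h) (nhds 0)"
      by (rule chart_transition[OF \<gamma>_neq[of t]]) blast
    from \<Gamma>_derivative(2)[OF this] obtain D where
      D: "eventually (\<lambda>s. (\<Gamma> has_vector_derivative D s) (at s)) (nhds t)" "isCont D t" by blast
    \<comment> \<open>The local derivative \<open>D\<close> varies with \<open>t\<close>; near
      \<open>t\<close> it agrees with the global \<open>?D\<close>, which inherits its continuity
      there.\<close>
    have "eventually (\<lambda>s. ?D s = D s) (nhds t)"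
      using D(1) by eventually_elim (rule vector_derivative_at)
    from isCont_cong[OF this] D(2) have "isCont ?D t" by simp
    moreover have "(\<Gamma> has_vector_derivative ?D t) (at t)"
      using eventually_nhds_x_imp_x[OF D(1)] by (simp add: vector_derivative_at)
    ultimately show ?thesis by blast
  qed
  show "(\<Gamma> has_vector_derivative ?D t) (at t)" for t using * by blast
  show "continuous_on UNIV ?D" using * by (simp add: continuous_on_eq_continuous_at)
qed

lemma valid_path_\<Gamma>: "valid_path \<Gamma>"
  unfolding valid_path_def
  by (intro C1_differentiable_imp_piecewise C1_differentiable_on_subset[OF \<Gamma>_C1]) auto

lemma pull_times_velocity:
  assumes "form_regular_on \<alpha> (range \<gamma>)"
  shows "pull c \<alpha> (\<Gamma> t) * vector_derivative \<Gamma> (at t) =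
      remove_sings (form_germ \<alpha> (\<gamma> t)) 0 * velocity \<gamma> t"
proof -
  obtain \<sigma> \<tau> :: "complex \<Rightarrow> complex" where
    \<sigma>: "\<sigma> analytic_on {coord_inf c (\<gamma> t)}" "\<sigma> (coord_inf c (\<gamma> t)) = 0"
    "eventually (\<lambda>w. \<sigma> w \<noteq> 0) (at (coord_inf c (\<gamma> t)))"
    "eventually (\<lambda>w. raw_pull c \<alpha> w = form_germ \<alpha> (\<gamma> t) (\<sigma> w) * deriv \<sigma> w) (at (coord_inf c (\<gamma> t)))"
    and \<tau>: "\<tau> analytic_on {0}" "eventually (\<lambda>h. coord_inf c (from_coord (\<gamma> t) h) = \<tau> h) (nhds 0)"
    and inv: "deriv \<sigma> (coord_inf c (\<gamma> t)) * deriv \<tau> 0 = 1"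
    by (rule chart_transition[OF \<gamma>_neq[of t]]) blast
  have "pull c \<alpha> (\<Gamma> t) = remove_sings (form_germ \<alpha> (\<gamma> t)) 0 * deriv \<sigma> (coord_inf c (\<gamma> t))"
    unfolding \<Gamma>_def
    by (rule pull_regular(2)[OF \<gamma>_neq form_regular_on_subset[OF assms] \<sigma>]) auto
  moreover have "vector_derivative \<Gamma> (at t) = velocity \<gamma> t * deriv \<tau> 0"
    using \<Gamma>_derivative(1)[OF \<tau>] by (rule vector_derivative_at)
  ultimately show ?thesis
    using inv by (simp add: algebra_simps)
  qed

lemma curve_integral_eq:
  assumes "form_regular_on \<alpha> (range \<gamma>)"
  shows "(pull c \<alpha> has_contour_integral curve_integral \<gamma> \<alpha>) \<Gamma>"
proof -
  have "contour_integral \<Gamma> (pull c \<alpha>) = curve_integral \<gamma> \<alpha>"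
    by (simp add: contour_integral_integral curve_integral_def pull_times_velocity[OF assms])
  moreover have "pull c \<alpha> analytic_on path_image \<Gamma>"
  proof (subst analytic_on_analytic_at, rule ballI)
    fix w assume "w \<in> path_image \<Gamma>"
    then obtain t where "w = \<Gamma> t" by (auto simp: path_image_def)
    then show "pull c \<alpha> analytic_on {w}"
      by (intro pull_analytic form_regular_on_subset[OF assms]) (simp add: point_\<Gamma>)
  qed
  then obtain S where "open S" "path_image \<Gamma> \<subseteq> S" "pull c \<alpha> holomorphic_on S"
    by (auto simp: analytic_on_holomorphic)
  then have "pull c \<alpha> contour_integrable_on \<Gamma>"
    using contour_integrable_holomorphic_simple valid_path_\<Gamma> by blast
  ultimately show ?thesis
    using has_contour_integral_integral by metis
qed

text \<open>Supplies the integrability behind additivity; it is read off from the contour integral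
  of an analytic function along a valid path.\<close>

lemma curve_integral_has_integral:
  assumes "form_regular_on \<alpha> (range \<gamma>)"
  shows "((\<lambda>t. remove_sings (form_germ \<alpha> (\<gamma> t)) 0 * velocity \<gamma> t) has_integral curve_integral \<gamma> \<alpha>) {0..1}"
  using curve_integral_eq[OF assms]
  by (simp add: has_contour_integral pull_times_velocity[OF assms])

lemma curve_integral_add:
  assumes "form_regular_on \<alpha> (range \<gamma>)" "form_regular_on \<beta> (range \<gamma>)"
  shows "curve_integral \<gamma> (\<alpha> + \<beta>) = curve_integral \<gamma> \<alpha> + curve_integral \<gamma> \<beta>"
proof -
  have "remove_sings (form_germ (\<alpha> + \<beta>) (\<gamma> t)) 0 * velocity \<gamma> t =
      remove_sings (form_germ \<alpha> (\<gamma> t)) 0 * velocity \<gamma> t + remove_sings (form_germ \<beta> (\<gamma> t)) 0 * velocity \<gamma> t" for t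
    using remove_sings_form_germ_add[of \<alpha> "\<gamma> t" \<beta>] assms
    by (simp add: distrib_right form_regular_on_subset)
  then show ?thesis
    using has_integral_add[OF curve_integral_has_integral[OF assms(1)] curve_integral_has_integral[OF assms(2)]]
    by (simp add: curve_integral_def integral_unique)
qed

lemma curve_integral_scale:
  assumes "form_regular_on \<alpha> (range \<gamma>)"
  shows "curve_integral \<gamma> (scale_form k \<alpha>) = k * curve_integral \<gamma> \<alpha>"
proof -
  have "remove_sings (form_germ (scale_form k \<alpha>) (\<gamma> t)) 0 * velocity \<gamma> t =
      k * (remove_sings (form_germ \<alpha> (\<gamma> t)) 0 * velocity \<gamma> t)" for t
    using remove_sings_form_germ_scale[of \<alpha> "\<gamma> t" k] assms
    by (simp add: form_regular_on_subset)
  then show ?thesis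
    by (simp only: curve_integral_def integral_mult_right)
qed

section \<open>The two sides of the curve\<close>

lemma \<gamma>_periodic: "\<gamma> (t + of_int n) = \<gamma> t"
proof -
  have nat: "\<gamma> (t + of_nat m) = \<gamma> t" for m t
  proof (induction m)
    case (Suc m)
    have "\<gamma> (t + of_nat m + 1) = \<gamma> (t + of_nat m)"
      using smooth unfolding smooth_simple_closed_def by blast
    with Suc show ?case by (simp add: add_ac)
  qed simp
  show ?thesis
  proof (cases "n \<ge> 0")
    case True
    then show ?thesis using nat[of t "nat n"] by simp
  next
    case False
    then show ?thesis using nat[of "t + of_int n" "nat (- n)"] by simp
  qed
qed

lemma path_image_\<Gamma>: "path_image \<Gamma> = range \<Gamma>"
proof
  show "range \<Gamma> \<subseteq> path_image \<Gamma>"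
  proof
    fix w assume "w \<in> range \<Gamma>"
    then obtain t where w: "w = \<Gamma> t" by blast
    have "\<Gamma> t = \<Gamma> (frac t)"
      using \<gamma>_periodic[of "frac t" "\<lfloor>t\<rfloor>"] by (simp add: \<Gamma>_def frac_def)
    moreover have "frac t \<in> {0..1}" by (simp add: frac_lt_1 less_imp_le)
    ultimately show "w \<in> path_image \<Gamma>" unfolding w path_image_def by blast
  qed
qed (auto simp: path_image_def)

lemma \<Gamma>_loop: "pathfinish \<Gamma> = pathstart \<Gamma>"
  using \<gamma>_periodic[of 0 1] by (simp add: pathfinish_def pathstart_def \<Gamma>_def)

lemma simple_path_\<Gamma>: "simple_path \<Gamma>"
  unfolding simple_path_def loop_free_def
proof (intro conjI ballI impI)
  show "path \<Gamma>" by (rule valid_path_imp_path[OF valid_path_\<Gamma>])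
  fix x y :: real assume xy: "x \<in> {0..1}" "y \<in> {0..1}" "\<Gamma> x = \<Gamma> y"
  then have "\<gamma> x = \<gamma> y" by (metis point_\<Gamma>)
  \<comment> \<open>Injectivity is given on the half-open interval, so the endpoint 1 is moved to 0
    by periodicity.\<close>
  define r where "r z = (if z = 1 then 0 else z)" for z :: real
  have "\<gamma> (r z) = \<gamma> z" for z
    using \<gamma>_periodic[of 0 1] by (simp add: r_def)
  with \<open>\<gamma> x = \<gamma> y\<close> have "\<gamma> (r x) = \<gamma> (r y)" by simp
  moreover have "inj_on \<gamma> {0..<1}"
    using smooth unfolding smooth_simple_closed_def by blast
  moreover have "r x \<in> {0..<1}" "r y \<in> {0..<1}" using xy by (auto simp: r_def)
  ultimately have "r x = r y" by (auto dest: inj_onD)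
  then show "x = y \<or> x = 0 \<and> y = 1 \<or> x = 1 \<and> y = 0"
    by (auto simp: r_def split: if_splits)
qed

lemmas Jordan = Jordan_inside_outside[OF simple_path_\<Gamma> \<Gamma>_loop]

lemma outside_contains_complement_ball:
  obtains R where "R > 0" "path_image \<Gamma> \<subseteq> ball 0 R" "\<And>w. R < norm w \<Longrightarrow> w \<in> outside (path_image \<Gamma>)"
proof -
  have "bounded (path_image \<Gamma> \<union> inside (path_image \<Gamma>))"
    using Jordan bounded_simple_path_image[OF simple_path_\<Gamma>] by simp
  then obtain R where R: "R > 0" "path_image \<Gamma> \<union> inside (path_image \<Gamma>) \<subseteq> ball 0 R"
    using bounded_subset_ballD[of _ 0] by blast
  show thesis
  proof (rule that[OF R(1)])
    show "path_image \<Gamma> \<subseteq> ball 0 R" using R(2) by blast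
    fix w :: complex assume "R < norm w"
    then have "w \<notin> path_image \<Gamma> \<union> inside (path_image \<Gamma>)" using R(2) by auto
    then show "w \<in> outside (path_image \<Gamma>)" using Jordan by blast
  qed
qed

definition inner :: "proj_line set" where
  "inner = {q. q \<noteq> c \<and> coord_inf c q \<in> inside (path_image \<Gamma>)}"

text \<open>In the coordinate with its pole at \<open>c\<close> that point is infinity, hence it
  joins the unbounded side.\<close>

definition outer :: "proj_line set" where
  "outer = {q. q = c \<or> coord_inf c q \<in> outside (path_image \<Gamma>)}"

lemma inner_eq: "inner = point_inf c ` inside (path_image \<Gamma>)"
proof
  show "inner \<subseteq> point_inf c ` inside (path_image \<Gamma>)"
  proof
    fix q assume "q \<in> inner"
    then have "q = point_inf c (coord_inf c q)" "coord_inf c q \<in> inside (path_image \<Gamma>)"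
      by (auto simp: inner_def point_coord_inf)
    then show "q \<in> point_inf c ` inside (path_image \<Gamma>)" by blast
  qed
  show "point_inf c ` inside (path_image \<Gamma>) \<subseteq> inner"
    by (auto simp: inner_def point_inf_neq)
qed

lemma open_inner: "openin proj_top inner"
  unfolding inner_def using Jordan by (intro open_coord_preimage) blast

lemma open_outer: "openin proj_top outer"
proof -
  obtain R where R: "R > 0" "\<And>w. R < norm w \<Longrightarrow> w \<in> outside (path_image \<Gamma>)"
    by (rule outside_contains_complement_ball) blast
  have "outer = {q. q \<noteq> c \<and> coord_inf c q \<in> outside (path_image \<Gamma>)} \<union> {q. q = c \<or> R < norm (coord_inf c q)}"
    using R(2) by (auto simp: outer_def)
  moreover have "open (outside (path_image \<Gamma>))" using Jordan by blast
  ultimately show ?thesis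
    by (simp only: openin_Un open_coord_preimage open_coord_complement_ball[OF R(1)])
qed

lemma inner_outer: "inner \<inter> outer = {}" "- range \<gamma> = inner \<union> outer"
proof -
  show "inner \<inter> outer = {}"
    using inside_Int_outside[of "path_image \<Gamma>"] unfolding inner_def outer_def by blast
  show "- range \<gamma> = inner \<union> outer"
  proof (rule Set.set_eqI)
    fix q
    show "q \<in> - range \<gamma> \<longleftrightarrow> q \<in> inner \<union> outer"
    proof (cases "q = c")
      case True
      then show ?thesis using c_notin by (simp add: outer_def)
    next
      case False
      have "q \<in> range \<gamma> \<longleftrightarrow> coord_inf c q \<in> path_image \<Gamma>"
      proof
        assume "coord_inf c q \<in> path_image \<Gamma>"
        then obtain t where "coord_inf c q = \<Gamma> t" by (auto simp: path_image_\<Gamma>)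
        then have "q = \<gamma> t" by (metis False point_\<Gamma> point_coord_inf)
        then show "q \<in> range \<gamma>" by blast
      qed (auto simp: path_image_\<Gamma> \<Gamma>_def)
      also have "\<dots> \<longleftrightarrow> \<not> (coord_inf c q \<in> inside (path_image \<Gamma>) \<or> coord_inf c q \<in> outside (path_image \<Gamma>))"
        using Jordan by blast
      finally show ?thesis using False by (auto simp: inner_def outer_def)
    qed
  qed
qed

text \<open>The two sides are disjoint open sets covering the complement of the curve, and
  \<open>U\<close> meets the outer one in \<open>c\<close>.\<close>

lemma connected_subset_outer:
  assumes "connectedin proj_top U" "U \<inter> range \<gamma> = {}" "c \<in> U"
  shows "U \<subseteq> outer"
proof -
  have "U \<subseteq> inner \<union> outer" using assms(2) inner_outer(2) by blast
  moreover have "outer \<inter> U \<noteq> {}" using assms(3) by (auto simp: outer_def)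
  ultimately have "inner \<inter> U = {}"
    using assms(1) open_inner open_outer inner_outer(1) unfolding connectedin by blast
  with \<open>U \<subseteq> inner \<union> outer\<close> show ?thesis by blast
qed

text \<open>The poles lie in \<open>U\<close>, hence on the side of \<open>c\<close>, so that the
  curve has winding number 0 about each of them.\<close>

lemma curve_integral_eq_0:
  assumes U: "connectedin proj_top U" "U \<inter> range \<gamma> = {}" "c \<in> U"
    and \<alpha>: "form_regular_on \<alpha> (- U)"
  shows "curve_integral \<gamma> \<alpha> = 0"
proof -
  obtain R where R: "R > 0" "path_image \<Gamma> \<subseteq> ball 0 R"
    by (rule outside_contains_complement_ball) blast
  \<comment> \<open>Restricting to a compact ball that contains the curve makes the singular points
    finite in number; the residue theorem is applied inside that ball.\<close>
  define pts where "pts = {w \<in> cball 0 R. \<not> pull c \<alpha> analytic_on {w}}"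
  have "finite (cball 0 R \<inter> pts)" unfolding pts_def
    by (intro sparse_in_compact_finite meromorphic_on_imp_sparse_singularities'
          meromorphic_on_subset[OF pull_meromorphic]) auto
  then have finite_pts: "finite pts" by (rule rev_finite_subset) (auto simp: pts_def)
  have pole_in_U: "point_inf c w \<in> U" if "w \<in> pts" for w
    using that pull_analytic[of \<alpha> c w] form_regular_on_subset[OF \<alpha>, of "{point_inf c w}"]
    by (auto simp: pts_def)
  have outside: "w \<in> outside (path_image \<Gamma>)" if "w \<in> pts" for w
    using connected_subset_outer[OF U] pole_in_U[OF that] by (auto simp: outer_def point_inf_neq)
  have "contour_integral \<Gamma> (pull c \<alpha>) =
      2 * pi * \<i> * (\<Sum>w\<in>pts. winding_number \<Gamma> w * residue (pull c \<alpha>) w)"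
  proof (rule Residue_theorem[where S = "ball 0 R"])
    show "pull c \<alpha> holomorphic_on ball 0 R - pts"
      by (rule analytic_imp_holomorphic, subst analytic_on_analytic_at) (auto simp: pts_def)
    show "path_image \<Gamma> \<subseteq> ball 0 R - pts"
      using R(2) outside outside_no_overlap[of "path_image \<Gamma>"] by blast
    show "\<forall>w. w \<notin> ball 0 R \<longrightarrow> winding_number \<Gamma> w = 0"
      using winding_number_zero_outside[OF valid_path_imp_path[OF valid_path_\<Gamma>] convex_ball \<Gamma>_loop _ R(2)]
      by blast
  qed (use finite_pts valid_path_\<Gamma> \<Gamma>_loop in auto)
  also have "\<dots> = 0"
    using outside winding_number_zero_in_outside[OF valid_path_imp_path[OF valid_path_\<Gamma>] \<Gamma>_loop]
    by simp
  finally have "contour_integral \<Gamma> (pull c \<alpha>) = 0" .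
  moreover have "form_regular_on \<alpha> (range \<gamma>)"
    using form_regular_on_subset[OF \<alpha>] U(2) by blast
  ultimately show ?thesis
    using curve_integral_eq contour_integral_unique by metis
qed

text \<open>The connected exterior is covered by the disjoint open sets \<open>D\<close> and
  \<open>D'\<close>. As \<open>D\<close> meets it near \<open>c\<close>, \<open>D'\<close> misses
  it, and comparison with the two sides leaves \<open>D' = inner\<close>, the image of the Jordan
  interior.\<close>

lemma connected_complementary_component:
  assumes D: "openin proj_top D" "connectedin proj_top D" "D \<inter> range \<gamma> = {}" "c \<in> D"
    and D': "openin proj_top D'" "D' \<inter> D = {}" "D \<union> D' = - range \<gamma>"
  shows "connectedin proj_top D'" "D' \<noteq> {}"
proof -
  have "D \<subseteq> outer" using connected_subset_outer[OF D(2-4)] .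
  let ?O = "outside (path_image \<Gamma>)"
  obtain R where R: "R > 0" "\<And>w. R < norm w \<Longrightarrow> w \<in> ?O"
    by (rule outside_contains_complement_ball) blast
  obtain w where w: "w \<in> ?O" "point_inf c w \<in> D"
  proof -
    have "open {h. from_coord c h \<in> D}" using D(1) by (simp only: openin_proj_top)
    moreover have "from_coord c 0 = c" by (cases c) auto
    ultimately obtain e where e: "e > 0" "ball 0 e \<subseteq> {h. from_coord c h \<in> D}"
      using D(4) openE[of "{h. from_coord c h \<in> D}" 0] by auto
    \<comment> \<open>Large enough for both purposes: beyond \<open>R\<close> the point is outside
      the curve, and beyond \<open>inverse e\<close> it lies in the part of \<open>D\<close> around
      \<open>c\<close>.\<close>
    define w where "w = complex_of_real (R + inverse e + 1)"
    have "norm w = R + inverse e + 1"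
      using R(1) e(1) by (simp add: w_def flip: of_real_add of_real_inverse)
    then have "R < norm w" "inverse e < norm w" using R(1) e(1) by (simp_all add: add_pos_pos)
    then have "w \<noteq> 0" using R(1) by auto
    have "norm (inverse w) < e"
      using less_imp_inverse_less[OF \<open>inverse e < norm w\<close>] e(1) by (simp add: norm_inverse)
    moreover have "from_coord c (inverse w) = point_inf c w"
      using \<open>w \<noteq> 0\<close> by (cases c) auto
    ultimately show thesis using that[of w] R(2)[OF \<open>R < norm w\<close>] e(2) by auto
  qed
  have "{w. point_inf c w \<in> D} \<inter> ?O = {} \<or> {w. point_inf c w \<in> D'} \<inter> ?O = {}"
  proof (rule connectedD)
    show "connected ?O" using Jordan by blast
    show "open {w. point_inf c w \<in> D}" "open {w. point_inf c w \<in> D'}"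
      by (intro open_point_preimage D(1) D'(1))+
    show "{w. point_inf c w \<in> D} \<inter> {w. point_inf c w \<in> D'} \<inter> ?O = {}"
      using D'(2) by blast
    have "point_inf c w \<in> - range \<gamma>" if "w \<in> ?O" for w
      using that inner_outer(2) by (auto simp: outer_def)
    then show "?O \<subseteq> {w. point_inf c w \<in> D} \<union> {w. point_inf c w \<in> D'}"
      using D'(3) by blast
  qed
  with w have no_O: "{w. point_inf c w \<in> D'} \<inter> ?O = {}" by blast
  have "D' \<inter> outer = {}"
  proof (rule ccontr)
    assume "D' \<inter> outer \<noteq> {}"
    then obtain q where q: "q \<in> D'" "q \<in> outer" by blast
    moreover from q(1) have "q \<noteq> c" using D(4) D'(2) by blast
    ultimately have "coord_inf c q \<in> ?O" "point_inf c (coord_inf c q) = q"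
      by (auto simp: outer_def point_coord_inf)
    then have "coord_inf c q \<in> {w. point_inf c w \<in> D'} \<inter> ?O" using q(1) by simp
    with no_O show False by blast
  qed
  moreover have "D \<union> D' = inner \<union> outer" by (simp only: D'(3) inner_outer(2))
  ultimately have "D' = inner"
    using inner_outer(1) \<open>D \<subseteq> outer\<close> by (intro equalityI subsetI) blast+
  then have eq: "D' = point_inf c ` inside (path_image \<Gamma>)" by (simp add: inner_eq)
  show "connectedin proj_top D'"
    unfolding eq using Jordan
    by (intro connectedin_continuous_map_image[OF continuous_map_point_inf]) (simp add: connectedin_iff_connected)
  show "D' \<noteq> {}" using eq Jordan by auto
qed

end


section \<open>The three commutators\<close>

lemma oriented_boundary_charted_curve:
  "oriented_boundary D \<gamma> \<Longrightarrow> c \<notin> proj_top frontier_of D \<Longrightarrow> charted_curve \<gamma> c"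
  by (simp add: charted_curve_def oriented_boundary_def)

text \<open>A form regular on \<open>?A\<close> has its poles in \<open>D\<close>, and a form
  regular on \<open>?B\<close> has its poles in the exterior. Each kind is integrated in a
  coordinate whose pole lies in the same region.\<close>

lemma disc_commutator:
  assumes D: "is_disc D" and \<gamma>: "oriented_boundary D \<gamma>"
    and \<phi>: "fun_regular_on \<phi> (boundary D)" and \<psi>: "fun_regular_on \<psi> (boundary D)"
    and w: "w \<in> carrier (W_along D)"
  shows "op_disc D \<gamma> \<phi> (op_disc D \<gamma> \<psi> w) \<ominus>\<^bsub>W_along D\<^esub> op_disc D \<gamma> \<psi> (op_disc D \<gamma> \<phi> w) =
    sym_scale (K_along D) (- (1 / (2 * of_real pi * \<i>) * curve_integral \<gamma> (mult_form \<phi> (ext_d \<psi>)))) w"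
proof -
  let ?cl = "proj_top closure_of D"
  let ?A = "boundary D \<union> - ?cl" and ?B = "boundary D \<union> D"
  have range: "range \<gamma> = boundary D"
    using \<gamma> by (simp add: oriented_boundary_def)
  have D_open: "openin proj_top D" and D_conn: "connectedin proj_top D" and "D \<noteq> {}"
    using D by (auto simp: is_disc_def)
  have frontier: "boundary D = ?cl - D"
    using D_open by (simp add: frontier_of_def interior_of_openin)
  have D_sub: "D \<subseteq> ?cl"
    by (rule closure_of_subset) simp
  \<comment> \<open>Since \<open>D\<close> is open, the two sets are the complement and the closure
    of \<open>D\<close>, so they cover everything and meet in the boundary.\<close>
  have A: "?A = - D" and B: "?B = ?cl" and AB: "?A \<union> ?B = UNIV" "?A \<inter> ?B = boundary D"
    using D_sub by (auto simp: frontier)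
  obtain c where c: "c \<in> D" using \<open>D \<noteq> {}\<close> by blast
  interpret C: charted_curve \<gamma> c
    using oriented_boundary_charted_curve[OF \<gamma>] c by (simp add: frontier)
  have D': "connectedin proj_top (- ?cl)" "- ?cl \<noteq> {}"
  proof -
    have D'_open: "openin proj_top (- ?cl)"
      using closedin_closure_of[of proj_top D] by (simp add: closedin_def Compl_eq_Diff_UNIV)
    show "connectedin proj_top (- ?cl)" "- ?cl \<noteq> {}"
      by (rule C.connected_complementary_component[OF D_open D_conn _ c D'_open];
          use D_sub in \<open>auto simp: range frontier\<close>)+
  qed
  then obtain c' where c': "c' \<in> - ?cl" by blast
  interpret C': charted_curve \<gamma> c'
    using oriented_boundary_charted_curve[OF \<gamma>] c' by (simp add: frontier)
  let ?L = "\<lambda>\<alpha>. - (1 / (2 * of_real pi * \<i>) * curve_integral \<gamma> \<alpha>)"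
  show ?thesis
    unfolding op_disc_def
  proof (rule commutator_of_functional[where L = ?L, OF AB(1)]; (unfold AB(2))?)
    show "K_along D = {\<alpha> \<in> K_forms. form_regular_on \<alpha> (boundary D)}"
      by (simp add: K_along_def)
    show "?L (\<alpha> + \<beta>) = ?L \<alpha> + ?L \<beta>"
      if "form_regular_on \<alpha> (boundary D)" "form_regular_on \<beta> (boundary D)" for \<alpha> \<beta>
      using that by (simp add: C.curve_integral_add range algebra_simps add_divide_distrib)
    show "?L (scale_form k \<alpha>) = k * ?L \<alpha>" if "form_regular_on \<alpha> (boundary D)" for k \<alpha>
      using that by (simp add: C.curve_integral_scale range)
    show "?L \<alpha> = 0" if "form_regular_on \<alpha> ?A" for \<alpha>
    proof -
      have "curve_integral \<gamma> \<alpha> = 0"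
        by (rule C.curve_integral_eq_0[OF D_conn _ c that[unfolded A]]) (auto simp: range frontier)
      then show ?thesis by simp
    qed
    show "?L \<alpha> = 0" if "form_regular_on \<alpha> ?B" for \<alpha>
    proof -
      have "curve_integral \<gamma> \<alpha> = 0"
        by (rule C'.curve_integral_eq_0[OF D'(1) _ c']) (use that[unfolded B] in \<open>auto simp: range frontier\<close>)
      then show ?thesis by simp
    qed
  qed (use \<phi> \<psi> w in auto)
qed

text \<open>Here \<open>A \<inter> B\<close> is empty, so all regularity conditions on the
  intersection hold trivially and \<open>V\<close> is all of \<open>K_forms\<close>.
  \<open>L\<close> kills forms regular at \<open>P\<close> and, by the single pole lemma, forms
  regular elsewhere.\<close>

lemma point_commutator:
  assumes "w \<in> carrier W"
  shows "op_at P \<phi> (op_at P \<psi> w) \<ominus>\<^bsub>W\<^esub> op_at P \<psi> (op_at P \<phi> w) =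
    sym_scale K_forms (Res P (mult_form \<phi> (ext_d \<psi>))) w"
  unfolding op_at_def
  by (rule commutator_of_functional[where L = "Res P"])
     (use assms in \<open>auto simp: Res_add Res_scale Res_regular Res_single_pole fun_regular_on_def form_regular_on_def\<close>)

lemma outer_point_commutator:
  assumes "w \<in> carrier W"
  shows "op_from Q \<phi> (op_from Q \<psi> w) \<ominus>\<^bsub>W\<^esub> op_from Q \<psi> (op_from Q \<phi> w) =
    sym_scale K_forms (- Res Q (mult_form \<phi> (ext_d \<psi>))) w"
  unfolding op_from_def
  by (rule commutator_of_functional[where L = "\<lambda>\<alpha>. - Res Q \<alpha>"])
     (use assms in \<open>auto simp: Res_add Res_scale Res_regular Res_single_pole fun_regular_on_def form_regular_on_def\<close>)

theorem proposition5p9: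
  fixes \<phi> \<psi> :: merom_fun
  shows
    "(\<forall>D \<gamma>. is_disc D \<and> oriented_boundary D \<gamma> \<and>
        fun_regular_on \<phi> (boundary D) \<and> fun_regular_on \<psi> (boundary D) \<longrightarrow>
        (\<forall>w\<in>carrier (W_along D).
           op_disc D \<gamma> \<phi> (op_disc D \<gamma> \<psi> w) \<ominus>\<^bsub>W_along D\<^esub> op_disc D \<gamma> \<psi> (op_disc D \<gamma> \<phi> w) =
           sym_scale (K_along D)
             (- (1 / (2 * of_real pi * \<i>) * curve_integral \<gamma> (mult_form \<phi> (ext_d \<psi>)))) w)) \<and>
     (\<forall>P. \<forall>w\<in>carrier W.
        op_at P \<phi> (op_at P \<psi> w) \<ominus>\<^bsub>W\<^esub> op_at P \<psi> (op_at P \<phi> w) =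
        sym_scale K_forms (Res P (mult_form \<phi> (ext_d \<psi>))) w) \<and>
     (\<forall>Q. \<forall>w\<in>carrier W.
        op_from Q \<phi> (op_from Q \<psi> w) \<ominus>\<^bsub>W\<^esub> op_from Q \<psi> (op_from Q \<phi> w) =
        sym_scale K_forms (- Res Q (mult_form \<phi> (ext_d \<psi>))) w)"
  by (intro conjI allI impI ballI; (elim conjE)?; rule disc_commutator point_commutator outer_point_commutator; assumption)

end
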